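(* Let $\hat G$ be a Hausdorff topological group, $G$ a topological subgroup of $\hat G$, $Q$ a locally compact Hausdorff group, and $1\to G\to\hat G\xrightarrow{q}Q\to1$ an exact sequence of topological groups (in particular $q$ is a continuous homomorphism). Let $\Lambda$ be a discrete subgroup of $Q$ with a homomorphism $s_1\colon\Lambda\to\hat G$ satisfying $q\circ s_1=\mathrm{id}_\Lambda$. Assume there is a relatively compact strict fundamental domain $B$ for the left multiplication action of $\Lambda$ on $Q$ with a finite partition $B=\coprod_{i=1}^pB^i$ into Borel sets such that for each $i$ there is a continuous map $\bar s_2^i\colon\overline{B^i}\to\hat G$ with $q\circ\bar s_2^i=\mathrm{id}_{\overline{B^i}}$. Then for every $\hat G$-quasi-invariant continuous quasimorphism $\phi\colon G\to\mathbb{R}$ there is a continuous quasimorphism $\hat\phi\colon\hat G\to\mathbb{R}$ with $\hat\phi|_G=\phi$ and $D(\hat\phi)\le D(\phi)+3D'(\phi)$.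
   Context: A quasimorphism on a group $G$ is $\phi\colon G\to\mathbb{R}$ with defect $D(\phi)=\sup_{x,y\in G}|\phi(xy)-\phi(x)-\phi(y)|<\infty$. For a normal subgroup $G\trianglelefteq\hat G$, $\phi$ is $\hat G$-quasi-invariant if there is $D'\ge0$ with $|\phi(\hat gx\hat g^{-1})-\phi(x)|\le D'$ for all $\hat g\in\hat G$, $x\in G$; $D'(\phi)$ is the smallest such $D'$. A strict fundamental domain for the action is a subset of $Q$ meeting each $\Lambda$-orbit in exactly one point. *)

theory Defs
  imports "HOL-Analysis.Analysis" "HOL-Algebra.Group"
begin

definition topological_group :: "('a, 'b) monoid_scheme \<Rightarrow> 'a topology \<Rightarrow> bool" where
  "topological_group G T \<longleftrightarrow> group G \<and> topspace T = carrier G \<and>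
     continuous_map (prod_topology T T) T (\<lambda>(x, y). x \<otimes>\<^bsub>G\<^esub> y) \<and>
     continuous_map T T (\<lambda>x. inv\<^bsub>G\<^esub> x)"

definition borel_sets_of :: "'a topology \<Rightarrow> 'a set set" where
  "borel_sets_of T = sigma_sets (topspace T) {U. openin T U}"

definition defect :: "('a, 'b) monoid_scheme \<Rightarrow> ('a \<Rightarrow> real) \<Rightarrow> real" where
  "defect G \<phi> = Sup {\<bar>\<phi> (x \<otimes>\<^bsub>G\<^esub> y) - \<phi> x - \<phi> y\<bar> | x y. x \<in> carrier G \<and> y \<in> carrier G}"

definition quasimorphism :: "('a, 'b) monoid_scheme \<Rightarrow> ('a \<Rightarrow> real) \<Rightarrow> bool" where
  "quasimorphism G \<phi> \<longleftrightarrow>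
     bdd_above {\<bar>\<phi> (x \<otimes>\<^bsub>G\<^esub> y) - \<phi> x - \<phi> y\<bar> | x y. x \<in> carrier G \<and> y \<in> carrier G}"

definition quasi_invariant :: "('a, 'b) monoid_scheme \<Rightarrow> 'a set \<Rightarrow> ('a \<Rightarrow> real) \<Rightarrow> bool" where
  "quasi_invariant Gh H \<phi> \<longleftrightarrow> (\<exists>D\<ge>0. \<forall>g\<in>carrier Gh. \<forall>x\<in>H.
      \<bar>\<phi> (g \<otimes>\<^bsub>Gh\<^esub> x \<otimes>\<^bsub>Gh\<^esub> inv\<^bsub>Gh\<^esub> g) - \<phi> x\<bar> \<le> D)"

definition conj_defect :: "('a, 'b) monoid_scheme \<Rightarrow> 'a set \<Rightarrow> ('a \<Rightarrow> real) \<Rightarrow> real" where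
  "conj_defect Gh H \<phi> = Inf {D. 0 \<le> D \<and> (\<forall>g\<in>carrier Gh. \<forall>x\<in>H.
      \<bar>\<phi> (g \<otimes>\<^bsub>Gh\<^esub> x \<otimes>\<^bsub>Gh\<^esub> inv\<^bsub>Gh\<^esub> g) - \<phi> x\<bar> \<le> D)}"

end

theory Submission
  imports Defs
begin

text \<open>
  Finitely many translates of the closures of the \<open>B\<^sup>i\<close> cover a neighbourhood of \<open>1\<close>, so one of them has
  interior points; translating the section over that interior gives continuous local sections
  around every point of \<open>Q\<close>. As \<open>\<Lambda>\<close> is discrete and cocompact, there are finitely many
  \<open>\<Lambda>\<close>-equivariant local sections \<open>s\<^sub>i\<close> and a \<open>\<Lambda>\<close>-invariant continuous partition of unity \<open>\<rho>\<^sub>i\<close>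
  subordinate to their domains. Cut \<open>[0,1]\<close> into consecutive intervals \<open>I\<^sub>i(y)\<close> of length \<open>\<rho>\<^sub>i(y)\<close> and put
  \<open>F(x,y) = \<Sum>\<^sub>i\<^sub>j |I\<^sub>i(y) \<inter> I\<^sub>j(y q(x))| \<phi>(x s\<^sub>j(y q(x))\<^sup>-\<^sup>1 s\<^sub>i(y))\<close>.
  This is continuous and \<open>\<Lambda>\<close>-invariant in \<open>y\<close>; it equals \<open>\<phi>(x)\<close> for \<open>x \<in> G\<close>, because only the terms \<open>i = j\<close>
  survive; and \<open>F(xx',y)\<close> differs from \<open>F(x,y) + F(x',y q(x))\<close> by at most \<open>D + D'\<close>, by splitting
  into triple overlaps. The extension is the mean of \<open>F(x,\<cdot>)\<close> over the quotient of \<open>Q\<close> by \<open>\<Lambda>\<close> with respect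
  to the right invariant mean obtained from a Haar functional on \<open>Q\<close>.
\<close>

section \<open>Compactly supported functions\<close>

text \<open>With a single section \<open>s\<close> the cochain
  \<open>\<phi>(x s(y q(x))^-1 s(y))\<close> would do, but continuous equivariant sections exist in
  general only locally, and a piecewise one is discontinuous in \<open>y\<close>, out of reach of a
  functional on continuous functions. The section is therefore chosen at random, with probabilities
  continuous in the point. The choices at two points must be coupled: independent weights
  \<open>\<rho>\<^sub>i(y) \<rho>\<^sub>j(y q(x))\<close> would leave off-diagonal terms for
  \<open>x\<close> in \<open>G\<close> and spoil the equality with \<open>\<phi>\<close>. Reading
  every choice off one uniform number in \<open>[0,1]\<close> lets equal points choose equal
  sections and couples three points at once, as the defect estimate requires.

  The pointwise estimate costs one product in \<open>G\<close> and one conjugation by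
  \<open>x\<close>, hence \<open>D + D'\<close>; the stated constant is a weakening of it.

  The mean has to be invariant on the right, whereas the Haar functional is invariant on the left;
  the compact quotient by \<open>\<Lambda>\<close> bridges the two. A positive functional on
  compactly supported functions is enough for all this, with no countability condition on
  \<open>Q\<close>.\<close>

lemma tube_uniform:
  fixes H :: "'a \<times> 'b \<Rightarrow> real"
  assumes H: "continuous_map (prod_topology X Y) euclideanreal H"
    and K: "compactin Y K" and x0: "x0 \<in> topspace X" and e: "e > 0"
  obtains U where "openin X U" "x0 \<in> U" "\<And>x y. x \<in> U \<Longrightarrow> y \<in> K \<Longrightarrow> \<bar>H (x, y) - H (x0, y)\<bar> < e"
proof -
  \<comment> \<open>The comparison value \<open>H (x0, y)\<close> is made a function on the product,
    so that the desired estimate describes an open set containing \<open>{x0} \<times> K\<close>, as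
    the tube lemma needs.\<close>
  have "continuous_map (prod_topology X Y) (prod_topology X Y) (\<lambda>p. (x0, snd p))"
    using x0 by (intro continuous_map_pairedI continuous_map_snd) auto
  then have "continuous_map (prod_topology X Y) euclideanreal (H \<circ> (\<lambda>p. (x0, snd p)))"
    using H by (rule continuous_map_compose)
  then have "continuous_map (prod_topology X Y) euclideanreal (\<lambda>p. \<bar>H p - H (x0, snd p)\<bar>)"
    using H by (intro continuous_intros) (auto simp: o_def)
  then have W: "openin (prod_topology X Y)
      {p \<in> topspace (prod_topology X Y). \<bar>H p - H (x0, snd p)\<bar> \<in> {..<e}}" (is "openin _ ?W")
    by (rule openin_continuous_map_preimage) auto
  have "{x0} \<times> K \<subseteq> ?W"
    using x0 e compactin_subset_topspace[OF K] by auto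
  from tube_lemma_right[OF W K x0 this] obtain U V where
    "openin X U" "openin Y V" "x0 \<in> U" "K \<subseteq> V" "U \<times> V \<subseteq> ?W" by blast
  moreover have "\<bar>H (x, y) - H (x0, y)\<bar> < e" if "x \<in> U" "y \<in> K" for x y
  proof -
    have "(x, y) \<in> ?W" using calculation that by blast
    then show ?thesis by simp
  qed
  ultimately show thesis by (intro that[of U])
qed

lemma continuous_map_real_locally:
  fixes f :: "'a \<Rightarrow> real"
  assumes "\<And>x e. x \<in> topspace X \<Longrightarrow> e > 0 \<Longrightarrow> \<exists>U. openin X U \<and> x \<in> U \<and> (\<forall>y\<in>U. \<bar>f y - f x\<bar> \<le> e)"
  shows "continuous_map X euclideanreal f"
  unfolding continuous_map_eq_topcontinuous_at topcontinuous_at_def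
proof (intro ballI conjI allI impI)
  fix x V assume x: "x \<in> topspace X" and V: "openin euclideanreal V \<and> f x \<in> V"
  then obtain e where e: "e > 0" "\<And>z. dist z (f x) < e \<Longrightarrow> z \<in> V"
    by (auto simp: open_dist)
  with assms[OF x, of "e/2"] obtain U where U: "openin X U" "x \<in> U" "\<forall>y\<in>U. \<bar>f y - f x\<bar> \<le> e/2" by auto
  then have "f y \<in> V" if "y \<in> U" for y
    using e U that by (intro e(2)) (force simp: dist_real_def)
  with U show "\<exists>U. openin X U \<and> x \<in> U \<and> (\<forall>y\<in>U. f y \<in> V)" by blast
qed auto

lemma compactin_finite_subcover:
  assumes K: "compactin T K" and V: "\<And>x. x \<in> K \<Longrightarrow> openin T (V x) \<and> x \<in> V x"
  obtains F where "finite F" "F \<subseteq> K" "K \<subseteq> \<Union>(V ` F)"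
proof -
  have "\<exists>\<F>. finite \<F> \<and> \<F> \<subseteq> V ` K \<and> K \<subseteq> \<Union>\<F>"
    using V by (intro compactinD[OF K]) auto
  then obtain \<F> where F: "finite \<F>" "\<F> \<subseteq> V ` K" "K \<subseteq> \<Union>\<F>" by blast
  obtain F where "F \<subseteq> K" "finite F" "\<F> = V ` F"
    using finite_subset_image[OF F(1,2)] by blast
  with F that show thesis by blast
qed

text \<open>Only values on the space are constrained. Members that agree there may still differ as
  HOL functions, so integrands are exchanged through \<open>J_cong\<close> later on.\<close>

definition Cc :: "'a topology \<Rightarrow> ('a \<Rightarrow> real) set" where
  "Cc T = {f. continuous_map T euclideanreal f \<and>
              (\<exists>K. compactin T K \<and> (\<forall>x\<in>topspace T - K. f x = 0))}"

lemma CcI: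
  "continuous_map T euclideanreal f \<Longrightarrow> compactin T K \<Longrightarrow> (\<And>x. x \<in> topspace T \<Longrightarrow> x \<notin> K \<Longrightarrow> f x = 0) \<Longrightarrow> f \<in> Cc T"
  unfolding Cc_def by blast

lemma Cc_continuous: "f \<in> Cc T \<Longrightarrow> continuous_map T euclideanreal f"
  unfolding Cc_def by blast

lemma Cc_support:
  assumes "f \<in> Cc T"
  obtains K where "compactin T K" "\<And>x. x \<in> topspace T \<Longrightarrow> x \<notin> K \<Longrightarrow> f x = 0"
  using assms unfolding Cc_def by blast

lemma Cc_zero [simp]: "(\<lambda>x. 0) \<in> Cc T"
  by (rule CcI[of _ _ "{}"]) auto

lemma Cc_mult_right: 
  assumes "f \<in> Cc T" "continuous_map T euclideanreal g"
  shows "(\<lambda>x. f x * g x) \<in> Cc T"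
proof -
  obtain K where "compactin T K" "\<And>x. x \<in> topspace T \<Longrightarrow> x \<notin> K \<Longrightarrow> f x = 0"
    using Cc_support[OF assms(1)] by blast
  then show ?thesis
    using continuous_map_real_mult[OF Cc_continuous[OF assms(1)] assms(2)]
    by (intro CcI[where K=K]) auto
qed

lemma Cc_mult_left: 
  assumes "f \<in> Cc T" "continuous_map T euclideanreal g"
  shows "(\<lambda>x. g x * f x) \<in> Cc T"
  using Cc_mult_right[OF assms] by (simp add: mult.commute)

lemma Cc_scale: "f \<in> Cc T \<Longrightarrow> (\<lambda>x. c * f x) \<in> Cc T"
  by (rule Cc_mult_left) auto

lemma Cc_uminus: "f \<in> Cc T \<Longrightarrow> (\<lambda>x. - f x) \<in> Cc T"
  using Cc_scale[of f T "-1"] by simp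

lemma Cc_binary:
  assumes f: "f \<in> Cc T" and g: "g \<in> Cc T" and h: "h 0 0 = (0::real)"
    and c: "continuous_map T euclideanreal (\<lambda>x. h (f x) (g x))"
  shows "(\<lambda>x. h (f x) (g x)) \<in> Cc T"
proof -
  obtain K K' where K: "compactin T K" "\<And>x. x \<in> topspace T \<Longrightarrow> x \<notin> K \<Longrightarrow> f x = 0"
    and K': "compactin T K'" "\<And>x. x \<in> topspace T \<Longrightarrow> x \<notin> K' \<Longrightarrow> g x = 0"
    using f g by (metis Cc_support)
  show ?thesis
    by (rule CcI[OF c compactin_Un[OF K(1) K'(1)]]) (simp add: K K' h)
qed

lemma Cc_add: "f \<in> Cc T \<Longrightarrow> g \<in> Cc T \<Longrightarrow> (\<lambda>x. f x + g x) \<in> Cc T"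
  by (rule Cc_binary[where h="(+)"]) (auto intro: continuous_map_add[OF Cc_continuous Cc_continuous])

lemma Cc_diff: "f \<in> Cc T \<Longrightarrow> g \<in> Cc T \<Longrightarrow> (\<lambda>x. f x - g x) \<in> Cc T"
  by (rule Cc_binary[where h="(-)"]) (auto intro: continuous_map_diff[OF Cc_continuous Cc_continuous])

lemma Cc_max: "f \<in> Cc T \<Longrightarrow> g \<in> Cc T \<Longrightarrow> (\<lambda>x. max (f x) (g x)) \<in> Cc T"
  by (rule Cc_binary[where h=max]) (auto intro: continuous_map_real_max[OF Cc_continuous Cc_continuous])

lemma Cc_abs: "f \<in> Cc T \<Longrightarrow> (\<lambda>x. \<bar>f x\<bar>) \<in> Cc T"
  by (rule Cc_binary[where h="\<lambda>a b. \<bar>a\<bar>", of f T f])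
     (auto intro: continuous_map_real_abs[OF Cc_continuous])

lemma Cc_sum: "finite I \<Longrightarrow> (\<And>i. i \<in> I \<Longrightarrow> f i \<in> Cc T) \<Longrightarrow> (\<lambda>x. \<Sum>i\<in>I. f i x) \<in> Cc T"
  by (induction I rule: finite_induct) (auto intro!: Cc_add)

lemma Cc_bounded:
  assumes "f \<in> Cc T"
  obtains C where "C > 0" "\<And>x. x \<in> topspace T \<Longrightarrow> \<bar>f x\<bar> \<le> C"
proof -
  obtain K where K: "compactin T K" "\<And>x. x \<in> topspace T \<Longrightarrow> x \<notin> K \<Longrightarrow> f x = 0"
    using assms by (metis Cc_support)
  have "compactin euclideanreal (f ` K)"
    using image_compactin[OF K(1) Cc_continuous[OF assms]] .
  then have "bounded (f ` K)"
    by (simp add: compact_imp_bounded)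
  then obtain C where C: "\<And>x. x \<in> K \<Longrightarrow> \<bar>f x\<bar> \<le> C"
    by (auto simp: bounded_iff)
  have "\<bar>f x\<bar> \<le> max C 1" if "x \<in> topspace T" for x
    using C[of x] K(2)[OF that] by (cases "x \<in> K") auto
  then show thesis
    by (intro that[of "max C 1"]) auto
qed

lemma bump:
  assumes lc: "locally_compact_space T" and haus: "Hausdorff_space T"
    and U: "openin T U" and x: "x \<in> U"
  obtains f where "f \<in> Cc T" "\<And>y. 0 \<le> f y" "\<And>y. f y \<le> 1" "f x = 1"
    "\<And>y. y \<in> topspace T \<Longrightarrow> y \<notin> U \<Longrightarrow> f y = 0"
proof -
  have xT: "x \<in> topspace T"
    using U x openin_subset by blast
  obtain W K where W: "openin T W" "compactin T K" "x \<in> W" "W \<subseteq> K"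
    using lc xT unfolding locally_compact_space_def by blast
  have "completely_regular_space T"
    using lc haus by (simp add: locally_compact_regular_imp_completely_regular_space
        locally_compact_Hausdorff_imp_regular_space)
  then obtain h where h: "continuous_map T euclideanreal h" "h x = (0::real)"
      "h ` (topspace T - U \<inter> W) \<subseteq> {1}"
    using openin_Int[OF U W(1)] W(3) x unfolding completely_regular_space_alt' by (metis IntI)
  \<comment> \<open>\<open>h\<close> is 1 off \<open>U \<inter> W\<close>, so the support lies in
    the compact \<open>K\<close> as well as in \<open>U\<close>. Clipping yields the bounds 0 and 1
    even off the space, where \<open>h\<close> is uncontrolled.\<close>
  let ?f = "\<lambda>y. max 0 (1 - \<bar>h y\<bar>)"
  have z: "?f y = 0" if "y \<in> topspace T" "y \<notin> U \<inter> W" for y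
  proof -
    have "h y = 1" using h(3) that by blast
    then show ?thesis by simp
  qed
  have "continuous_map T euclideanreal ?f"
    by (intro continuous_intros h)
  then have "?f \<in> Cc T"
    using W z by (intro CcI[where K=K]) auto
  then show thesis
    using z h(2) by (intro that[of ?f]) auto
qed

lemma finite_partition_of_unity:
  fixes U :: "'a \<Rightarrow> 'a set"
  assumes lc: "locally_compact_space T" and haus: "Hausdorff_space T"
    and K: "compactin T K" and U: "\<And>x. x \<in> K \<Longrightarrow> openin T (U x) \<and> x \<in> U x"
  obtains F a where "finite F" "F \<subseteq> K" "\<And>x. x \<in> F \<Longrightarrow> a x \<in> Cc T"
    "\<And>x y. x \<in> F \<Longrightarrow> 0 \<le> a x y" "\<And>x y. x \<in> F \<Longrightarrow> y \<in> topspace T \<Longrightarrow> y \<notin> U x \<Longrightarrow> a x y = (0::real)"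
    "\<And>y. y \<in> K \<Longrightarrow> (\<Sum>x\<in>F. a x y) = 1" "\<And>y. (\<Sum>x\<in>F. a x y) \<le> 1"
proof -
  have "\<exists>f. f \<in> Cc T \<and> (\<forall>y. 0 \<le> f y) \<and> f x = 1 \<and> (\<forall>y\<in>topspace T - U x. f y = 0)" if "x \<in> K" for x
    using bump[OF lc haus, of "U x" x] U[OF that] by (metis DiffE)
  then obtain f where f: "\<And>x. x \<in> K \<Longrightarrow> f x \<in> Cc T" "\<And>x y. x \<in> K \<Longrightarrow> 0 \<le> f x y" "\<And>x. x \<in> K \<Longrightarrow> f x x = 1"
     "\<And>x y. x \<in> K \<Longrightarrow> y \<in> topspace T \<Longrightarrow> y \<notin> U x \<Longrightarrow> f x y = 0"
    by (metis DiffI)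
  let ?V = "\<lambda>x. {y \<in> topspace T. f x y \<in> {1/2<..}}"
  have "openin T (?V x) \<and> x \<in> ?V x" if x: "x \<in> K" for x
  proof
    show "openin T (?V x)"
      using Cc_continuous[OF f(1)[OF x]] by (rule openin_continuous_map_preimage) auto
    show "x \<in> ?V x"
      using f(3)[OF x] x compactin_subset_topspace[OF K] by auto
  qed
  then obtain F where F: "finite F" "F \<subseteq> K" "K \<subseteq> \<Union>(?V ` F)"
    by (rule compactin_finite_subcover[OF K])
  \<comment> \<open>At a point of \<open>K\<close> some bump exceeds 1/2, so the maximum is the sum
    itself and the quotients add up to 1. Elsewhere the floor 1/2 keeps the denominator positive and
    the total at most 1.\<close>
  let ?S = "\<lambda>y. max (1/2) (\<Sum>x\<in>F. f x y)"
  let ?a = "\<lambda>x y. f x y * (1 / ?S y)"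
  have Spos: "?S y > 0" for y by (simp add: max_def)
  have cS: "continuous_map T euclideanreal (\<lambda>y. 1 / ?S y)"
    using F Spos by (intro continuous_intros Cc_continuous f) (auto simp: less_le)
  have S1: "(\<Sum>x\<in>F. ?a x y) = (\<Sum>x\<in>F. f x y) / ?S y" for y
    by (simp add: sum_distrib_right sum_divide_distrib)
  show thesis
  proof (rule that[of F ?a])
    show "?a x \<in> Cc T" if "x \<in> F" for x
      using that F by (intro Cc_mult_right f cS) auto
    show "0 \<le> ?a x y" if "x \<in> F" for x y
      using that F f(2)[of x y] Spos[of y] by auto
    show "?a x y = 0" if "x \<in> F" "y \<in> topspace T" "y \<notin> U x" for x y
      using that F f(4)[of x y] by auto
    show "(\<Sum>x\<in>F. ?a x y) = 1" if y: "y \<in> K" for y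
    proof -
      obtain x where x: "x \<in> F" "f x y > 1/2" using F(3) y by auto
      have "f x y \<le> (\<Sum>x\<in>F. f x y)"
        using x F f(2) by (intro member_le_sum) auto
      then show ?thesis using x unfolding S1 by (auto simp: max_def)
    qed
    show "(\<Sum>x\<in>F. ?a x y) \<le> 1" for y
      unfolding S1 using Spos[of y] by simp
  qed (use F in auto)
qed

lemma Cc_dominating:
  assumes lc: "locally_compact_space T" and haus: "Hausdorff_space T" and K: "compactin T K"
  obtains f where "f \<in> Cc T" "\<And>y. 0 \<le> f y" "\<And>y. y \<in> K \<Longrightarrow> f y = 1" "\<And>y. f y \<le> 1"
proof -
  have "\<And>x. x \<in> K \<Longrightarrow> openin T (topspace T) \<and> x \<in> topspace T"
    using compactin_subset_topspace[OF K] by auto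
  then show thesis
  proof (rule finite_partition_of_unity[OF lc haus K])
    fix F and a :: "'a \<Rightarrow> 'a \<Rightarrow> real"
    assume "finite F" "\<And>x. x \<in> F \<Longrightarrow> a x \<in> Cc T" "\<And>x y. x \<in> F \<Longrightarrow> 0 \<le> a x y"
      "\<And>y. y \<in> K \<Longrightarrow> (\<Sum>x\<in>F. a x y) = 1" "\<And>y. (\<Sum>x\<in>F. a x y) \<le> 1"
    then show thesis
      by (intro that[of "\<lambda>y. \<Sum>x\<in>F. a x y"]) (auto intro: Cc_sum sum_nonneg)
  qed
qed

section \<open>Locally compact groups\<close>

locale top_group = group G for G :: "('a, 'b) monoid_scheme" (structure) +
  fixes T :: "'a topology"
  assumes top_group: "topological_group G T"
begin

lemma topspace_eq [simp]: "topspace T = carrier G"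
  using top_group by (simp add: topological_group_def)

lemma continuous_map_mult [continuous_intros]:
  assumes "continuous_map X T f" "continuous_map X T g"
  shows "continuous_map X T (\<lambda>x. f x \<otimes> g x)"
proof -
  have "continuous_map X T ((\<lambda>(x, y). x \<otimes> y) \<circ> (\<lambda>x. (f x, g x)))"
    using assms top_group unfolding topological_group_def
    by (intro continuous_map_compose[where X'="prod_topology T T"] continuous_map_pairedI) auto
  then show ?thesis by (simp add: o_def)
qed

lemma continuous_map_inv [continuous_intros]:
  assumes "continuous_map X T f"
  shows "continuous_map X T (\<lambda>x. inv (f x))"
proof -
  have "continuous_map X T ((\<lambda>x. inv x) \<circ> f)"
    using assms top_group unfolding topological_group_def
    by (intro continuous_map_compose[where X'="T"]) auto
  then show ?thesis by (simp add: o_def)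
qed

lemma continuous_map_const_mult: "g \<in> carrier G \<Longrightarrow> continuous_map T T (\<lambda>x. g \<otimes> x)"
  by (intro continuous_intros) auto

lemma continuous_map_mult_const: "g \<in> carrier G \<Longrightarrow> continuous_map T T (\<lambda>x. x \<otimes> g)"
  by (intro continuous_intros) auto

lemma compactin_mult:
  assumes "compactin T K" "compactin T L"
  shows "compactin T ((\<lambda>(x, y). x \<otimes> y) ` (K \<times> L))"
  using assms top_group unfolding topological_group_def
  by (intro image_compactin[where X="prod_topology T T"]) (auto simp: compactin_Times)

lemma compactin_inv: "compactin T K \<Longrightarrow> compactin T ((\<lambda>x. inv x) ` K)"
  using top_group unfolding topological_group_def
  by (intro image_compactin[where X="T"]) auto

lemma compactin_carrier: "compactin T K \<Longrightarrow> x \<in> K \<Longrightarrow> x \<in> carrier G"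
  using compactin_subset_topspace by fastforce

lemma openin_carrier: "openin T K \<Longrightarrow> x \<in> K \<Longrightarrow> x \<in> carrier G"
  using openin_subset by fastforce

lemma Cc_translate:
  assumes f: "f \<in> Cc T" and g: "g \<in> carrier G"
  shows "(\<lambda>x. f (g \<otimes> x)) \<in> Cc T"
proof -
  obtain K where K: "compactin T K" "\<And>x. x \<in> carrier G \<Longrightarrow> x \<notin> K \<Longrightarrow> f x = 0"
    using Cc_support[OF f] by (metis topspace_eq)
  show ?thesis
  proof (rule CcI)
    show "continuous_map T euclideanreal (\<lambda>x. f (g \<otimes> x))"
      using continuous_map_compose[OF continuous_map_const_mult[OF g] Cc_continuous[OF f]]
      by (simp add: o_def)
    show "compactin T ((\<lambda>x. inv g \<otimes> x) ` K)"
      using K g by (intro image_compactin[where X="T"] continuous_map_const_mult) auto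
    show "f (g \<otimes> x) = 0" if "x \<in> topspace T" "x \<notin> (\<lambda>x. inv g \<otimes> x) ` K" for x
    proof (rule K(2))
      show "g \<otimes> x \<notin> K"
      proof
        assume "g \<otimes> x \<in> K"
        then have "inv g \<otimes> (g \<otimes> x) \<in> (\<lambda>x. inv g \<otimes> x) ` K" by blast
        with that g show False by (simp flip: m_assoc)
      qed
    qed (use that g in auto)
  qed
qed

text \<open>Both quotients are recorded because both occur: \<open>inv x \<otimes> y\<close> in the
  finiteness of returns of \<open>Lam\<close>, and \<open>x \<otimes> inv y\<close> in the
  construction of a neighbourhood with disjoint \<open>Lam\<close>-translates.\<close>

lemma nbhd_division:
  assumes U: "openin T U" "\<one> \<in> U"
  obtains V where "openin T V" "\<one> \<in> V" "\<And>x y. x \<in> V \<Longrightarrow> y \<in> V \<Longrightarrow> x \<otimes> inv y \<in> U \<and> inv x \<otimes> y \<in> U"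
proof -
  have c: "continuous_map (prod_topology T T) T (\<lambda>p. fst p \<otimes> inv (snd p))" 
    "continuous_map (prod_topology T T) T (\<lambda>p. inv (fst p) \<otimes> snd p)"
    by (intro continuous_intros)+
  let ?W = "{p \<in> topspace (prod_topology T T). fst p \<otimes> inv (snd p) \<in> U}
          \<inter> {p \<in> topspace (prod_topology T T). inv (fst p) \<otimes> snd p \<in> U}"
  have "openin (prod_topology T T) ?W"
    using openin_continuous_map_preimage[OF c(1) U(1)] openin_continuous_map_preimage[OF c(2) U(1)]
    by auto
  moreover have "(\<one>, \<one>) \<in> ?W" using U by auto
  ultimately have "\<exists>A B. openin T A \<and> openin T B \<and> \<one> \<in> A \<and> \<one> \<in> B \<and> A \<times> B \<subseteq> ?W"
    by (simp only: openin_prod_topology_alt)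
  then obtain A B where AB: "openin T A" "openin T B" "\<one> \<in> A" "\<one> \<in> B" "A \<times> B \<subseteq> ?W"
    by (elim exE conjE)
  show thesis
  proof (rule that[of "A \<inter> B"])
    fix x y assume "x \<in> A \<inter> B" "y \<in> A \<inter> B"
    then have "(x, y) \<in> ?W" using AB by blast
    then show "x \<otimes> inv y \<in> U \<and> inv x \<otimes> y \<in> U" by auto
  qed (use AB in auto)
qed

end

locale lc_group = top_group +
  assumes Hausdorff: "Hausdorff_space T" and loc_compact: "locally_compact_space T"
begin

text \<open>Compactness handles \<open>g\<close> in \<open>?L\<close>; for all other
  \<open>g\<close> both \<open>g\<close> and \<open>g \<otimes> v\<close> avoid the support of
  \<open>h\<close>. Increments stand on the right to suit the covering argument, where
  \<open>x\<close> is read as \<open>inv g \<otimes> (g \<otimes> x)\<close>.\<close>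

lemma uniformly_continuous:
  assumes h: "h \<in> Cc T" and e: "e > 0"
  obtains V where "openin T V" "\<one> \<in> V"
    "\<And>v g. v \<in> V \<Longrightarrow> g \<in> carrier G \<Longrightarrow> \<bar>h (g \<otimes> v) - h g\<bar> < e"
proof -
  obtain K where K: "compactin T K" "\<And>x. x \<in> carrier G \<Longrightarrow> x \<notin> K \<Longrightarrow> h x = 0"
    using Cc_support[OF h] by (metis topspace_eq)
  obtain W N where W: "openin T W" "compactin T N" "\<one> \<in> W" "W \<subseteq> N"
    using loc_compact unfolding locally_compact_space_def by (metis one_closed topspace_eq)
  \<comment> \<open>The second part is \<open>K N^-1\<close>: if
    \<open>g \<otimes> v \<in> K\<close> and \<open>v \<in> N\<close>, then \<open>g\<close> lies in
    it.\<close>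
  let ?L = "K \<union> (\<lambda>(x, y). x \<otimes> y) ` (K \<times> (\<lambda>x. inv x) ` N)"
  have L: "compactin T ?L"
    by (intro compactin_Un compactin_mult compactin_inv K W)
  have "continuous_map (prod_topology T T) T (\<lambda>p. snd p \<otimes> fst p)"
    by (intro continuous_intros)
  from continuous_map_compose[OF this Cc_continuous[OF h]]
  have "continuous_map (prod_topology T T) euclideanreal (\<lambda>p. h (snd p \<otimes> fst p))"
    by (simp add: o_def)
  then obtain U where
    U: "openin T U" "\<one> \<in> U" "\<And>x y. x \<in> U \<Longrightarrow> y \<in> ?L \<Longrightarrow>
      \<bar>h (snd (x, y) \<otimes> fst (x, y)) - h (snd (\<one>, y) \<otimes> fst (\<one>, y))\<bar> < e"
    using tube_uniform[OF _ L _ e, of T "\<lambda>p. h (snd p \<otimes> fst p)" \<one>] by auto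
  show thesis
  proof (rule that[of "U \<inter> W"])
    fix v g assume v: "v \<in> U \<inter> W" and g: "g \<in> carrier G"
    have vc: "v \<in> carrier G" "v \<in> N" using v U(1) W openin_carrier by blast+
    show "\<bar>h (g \<otimes> v) - h g\<bar> < e"
    proof (cases "g \<in> ?L")
      case True then show ?thesis using U(3)[of v g] v g by auto
    next
      case False
      have "g \<otimes> v \<notin> K"
      proof
        assume "g \<otimes> v \<in> K"
        then have "(g \<otimes> v) \<otimes> inv v \<in> ?L" using vc by force
        with False g vc show False by (simp add: m_assoc)
      qed
      then show ?thesis using False K(2) g vc e by auto
    qed
  qed (use U W in auto)
qed

end

section \<open>The Haar functional\<close>

text \<open>By Tychonoff the functions between 0 and \<open>c\<close> form a compact space for
  pointwise convergence. Directedness gives the closures of the sets \<open>A i\<close> the finite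
  intersection property, and \<open>L\<close> is a common point. This takes the place of a limit
  along shrinking neighbourhoods of 1, which need not reduce to a sequence.\<close>

lemma pointwise_cluster:
  fixes A :: "'i \<Rightarrow> ('f \<Rightarrow> real) set"
  assumes ne: "I \<noteq> {}" "\<And>i. i \<in> I \<Longrightarrow> A i \<noteq> {}"
    and dir: "\<And>i j. i \<in> I \<Longrightarrow> j \<in> I \<Longrightarrow> \<exists>k\<in>I. A k \<subseteq> A i \<inter> A j"
    and bd: "\<And>i h f. i \<in> I \<Longrightarrow> h \<in> A i \<Longrightarrow> 0 \<le> h f \<and> h f \<le> c f"
  obtains L where "\<And>i F e. i \<in> I \<Longrightarrow> finite F \<Longrightarrow> e > 0 \<Longrightarrow> \<exists>h\<in>A i. \<forall>f\<in>F. \<bar>h f - L f\<bar> < e"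
proof -
  let ?X = "product_topology (\<lambda>f. top_of_set {0..c f}) (UNIV::'f set)"
  have X: "compact_space ?X"
    by (simp add: compact_space_product_topology compact_space_subtopology)
  have top: "topspace ?X = PiE UNIV (\<lambda>f. {0..c f})" by simp
  have sub: "A i \<subseteq> topspace ?X" if "i \<in> I" for i
    unfolding top using bd[OF that] by (auto simp: PiE_def Pi_def)
  let ?\<U> = "(\<lambda>i. ?X closure_of A i) ` I"
  have fin: "\<exists>k\<in>I. \<forall>j\<in>J. A k \<subseteq> A j" if "finite J" "J \<subseteq> I" for J
    using that
  proof (induction J rule: finite_induct)
    case empty then show ?case using ne(1) by auto
  next
    case (insert j J)
    then obtain k where k: "k \<in> I" "\<forall>j\<in>J. A k \<subseteq> A j" by auto
    obtain l where "l \<in> I" "A l \<subseteq> A k \<inter> A j" using dir[OF k(1), of j] insert.prems by auto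
    with k show ?case by (intro bexI[of _ l]) auto
  qed
  have fip: "\<Inter>\<F> \<noteq> {}" if F: "finite \<F>" "\<F> \<subseteq> ?\<U>" for \<F>
  proof -
    obtain J where J: "J \<subseteq> I" "finite J" "\<F> = (\<lambda>i. ?X closure_of A i) ` J"
      using finite_subset_image[OF F] by blast
    obtain k where k: "k \<in> I" "\<forall>j\<in>J. A k \<subseteq> A j" using fin J by blast
    obtain h where "h \<in> A k" using ne(2) k by blast
    then have "h \<in> ?X closure_of A j" if "j \<in> J" for j
      using k(2) closure_of_subset[OF sub] J(1) that by blast
    then show ?thesis using J by blast
  qed
  have cl: "\<forall>C\<in>?\<U>. closedin ?X C" by auto
  have "\<Inter>?\<U> \<noteq> {}"
    using X cl fip unfolding compact_space_fip by metis
  then obtain L where L: "\<And>i. i \<in> I \<Longrightarrow> L \<in> ?X closure_of A i" by blast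
  show thesis
  proof (rule that)
    fix i and F :: "'f set" and e :: real assume i: "i \<in> I" and F: "finite F" and e: "e > 0"
    let ?U = "PiE UNIV (\<lambda>f. if f \<in> F then {0..c f} \<inter> ball (L f) e else {0..c f})"
    have "openin ?X ?U"
    proof (rule product_topology_basis)
      show "openin (top_of_set {0..c f}) (if f \<in> F then {0..c f} \<inter> ball (L f) e else {0..c f})" for f
        by (auto simp: openin_open_Int)
      show "finite {f. (if f \<in> F then {0..c f} \<inter> ball (L f) e else {0..c f}) \<noteq> topspace (top_of_set {0..c f})}"
        by (rule finite_subset[OF _ F]) auto
    qed
    moreover have "L \<in> topspace ?X" using L[OF i] by (simp add: in_closure_of)
    then have "L \<in> ?U" unfolding top using e by (auto simp: PiE_def Pi_def)
    ultimately obtain h where "h \<in> A i" "h \<in> ?U" using L[OF i] unfolding in_closure_of by blast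
    moreover have "\<bar>h f - L f\<bar> < e" if "f \<in> F" for f
    proof -
      have "h f \<in> (if f \<in> F then {0..c f} \<inter> ball (L f) e else {0..c f})"
        using \<open>h \<in> ?U\<close> by (rule PiE_mem) simp
      then show ?thesis using that by (auto simp: dist_real_def)
    qed
    ultimately show "\<exists>h\<in>A i. \<forall>f\<in>F. \<bar>h f - L f\<bar> < e" by blast
  qed
qed

lemma member_le_sum_list_real:
  fixes f :: "'a \<Rightarrow> real"
  assumes "x \<in> set xs" "\<And>y. y \<in> set xs \<Longrightarrow> 0 \<le> f y"
  shows "f x \<le> (\<Sum>y\<leftarrow>xs. f y)"
  using assms
proof (induction xs)
  case (Cons a xs)
  have "0 \<le> (\<Sum>y\<leftarrow>xs. f y)" using Cons.prems by (intro sum_list_nonneg) auto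
  moreover have "0 \<le> f a" using Cons.prems by simp
  ultimately show ?case using Cons by (cases "x = a") (auto intro!: add_increasing)
qed auto

lemma (in top_group) openin_carrier_set [simp]: "openin T (carrier G)"
  using openin_topspace[of T] by simp

section \<open>Haar's covering numbers\<close>

context lc_group
begin

definition Ccp :: "('a \<Rightarrow> real) set" where
  "Ccp = {f \<in> Cc T. \<forall>x\<in>carrier G. 0 \<le> f x}"

definition gauge :: "('a \<Rightarrow> real) \<Rightarrow> bool" where
  "gauge \<phi> \<longleftrightarrow> \<phi> \<in> Ccp \<and> (\<exists>x\<in>carrier G. 0 < \<phi> x)"

text \<open>Lists of weighted translates allow repetitions, so coverings are added by concatenation
  and composed by nesting, without merging equal translates.\<close>

definition comb :: "('a \<Rightarrow> real) \<Rightarrow> (real \<times> 'a) list \<Rightarrow> 'a \<Rightarrow> real" where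
  "comb \<phi> cs x = (\<Sum>(c, g)\<leftarrow>cs. c * \<phi> (g \<otimes> x))"

definition covers :: "('a \<Rightarrow> real) \<Rightarrow> ('a \<Rightarrow> real) \<Rightarrow> (real \<times> 'a) list \<Rightarrow> bool" where
  "covers f \<phi> cs \<longleftrightarrow> set cs \<subseteq> {0..} \<times> carrier G \<and> (\<forall>x\<in>carrier G. f x \<le> comb \<phi> cs x)"

text \<open>Haar's covering number, usually written \<open>(f : \<phi>)\<close>.\<close>

definition cov :: "('a \<Rightarrow> real) \<Rightarrow> ('a \<Rightarrow> real) \<Rightarrow> real" where
  "cov f \<phi> = Inf {(\<Sum>(c, g)\<leftarrow>cs. c) | cs. covers f \<phi> cs}"

lemma covers_weight_nonneg: "covers f \<phi> cs \<Longrightarrow> 0 \<le> (\<Sum>(c, g)\<leftarrow>cs. c)"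
  unfolding covers_def by (intro sum_list_nonneg) auto

lemma cov_le: "covers f \<phi> cs \<Longrightarrow> cov f \<phi> \<le> (\<Sum>(c, g)\<leftarrow>cs. c)"
  unfolding cov_def by (intro cInf_lower bdd_belowI[of _ 0]) (auto dest: covers_weight_nonneg)

lemma gauge_nonneg: "gauge \<phi> \<Longrightarrow> x \<in> carrier G \<Longrightarrow> 0 \<le> \<phi> x"
  unfolding gauge_def Ccp_def by auto

text \<open>Translating by \<open>x0 \<otimes> inv k\<close> moves the large values of \<phi> from
  \<open>x0\<close> to \<open>k\<close>. Finitely many such translates exceed \<open>?m\<close>
  somewhere on every part of the support of \<open>f\<close>, and the weight \<open>C / ?m\<close>
  lifts them above the bound \<open>C\<close> of \<open>f\<close>. Hence the infimum in
  \<open>cov\<close> ranges over a nonempty set.\<close>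

lemma ex_covers:
  assumes f: "f \<in> Ccp" and \<phi>: "gauge \<phi>"
  obtains cs where "covers f \<phi> cs"
proof -
  obtain x0 where x0: "x0 \<in> carrier G" "0 < \<phi> x0" using \<phi> unfolding gauge_def by auto
  have fC: "f \<in> Cc T" and \<phi>C: "\<phi> \<in> Cc T" using f \<phi> unfolding gauge_def Ccp_def by auto
  obtain C where C: "C > 0" "\<And>x. x \<in> carrier G \<Longrightarrow> \<bar>f x\<bar> \<le> C"
    using Cc_bounded[OF fC] by (metis topspace_eq)
  obtain K where K: "compactin T K" "\<And>x. x \<in> carrier G \<Longrightarrow> x \<notin> K \<Longrightarrow> f x = 0"
    using Cc_support[OF fC] by (metis topspace_eq)
  let ?m = "\<phi> x0 / 2"
  let ?g = "\<lambda>k. x0 \<otimes> inv k"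
  let ?U = "\<lambda>k. {x \<in> topspace T. \<phi> (?g k \<otimes> x) \<in> {?m<..}}"
  have "openin T (?U k) \<and> k \<in> ?U k" if k: "k \<in> K" for k
  proof
    have kc: "k \<in> carrier G" using compactin_carrier[OF K(1) k] .
    show "openin T (?U k)"
      using kc x0 by (intro openin_continuous_map_preimage[OF Cc_continuous[OF Cc_translate[OF \<phi>C]]]) auto
    show "k \<in> ?U k"
      using kc x0 by (simp add: m_assoc)
  qed
  then obtain F where F: "finite F" "F \<subseteq> K" "K \<subseteq> \<Union>(?U ` F)"
    by (rule compactin_finite_subcover[OF K(1)])
  obtain xs where xs: "set xs = F" using F(1) finite_list by blast
  have gc: "?g k \<in> carrier G" if "k \<in> F" for k
    using that F(2) compactin_carrier[OF K(1)] x0 by auto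
  let ?cs = "map (\<lambda>k. (C / ?m, ?g k)) xs"
  have comb: "comb \<phi> ?cs x = (\<Sum>k\<leftarrow>xs. C / ?m * \<phi> (?g k \<otimes> x))" for x
    by (simp add: comb_def o_def)
  have nn: "0 \<le> C / ?m * \<phi> (?g k \<otimes> x)" if "k \<in> set xs" "x \<in> carrier G" for k x
    using that gc xs C x0 by (intro mult_nonneg_nonneg gauge_nonneg[OF \<phi>]) auto
  have "f x \<le> comb \<phi> ?cs x" if x: "x \<in> carrier G" for x
  proof (cases "x \<in> K")
    case True
    then obtain k where k: "k \<in> F" "\<phi> (?g k \<otimes> x) > ?m" using F(3) by auto
    have "f x \<le> C" using C(2)[OF x] by auto
    also have "C = C / ?m * ?m" using x0 by simp
    also have "\<dots> \<le> C / ?m * \<phi> (?g k \<otimes> x)"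
      using k C x0 by (intro mult_left_mono) auto
    also have "\<dots> \<le> comb \<phi> ?cs x"
      unfolding comb using k nn[OF _ x] xs
      by (intro member_le_sum_list_real[where f="\<lambda>k. C / ?m * \<phi> (?g k \<otimes> x)"]) auto
    finally show ?thesis .
  next
    case False
    then have "f x = 0" using K(2) x by auto
    then show ?thesis unfolding comb using nn[OF _ x] by (auto intro!: sum_list_nonneg)
  qed
  then have "covers f \<phi> ?cs"
    unfolding covers_def using gc xs C x0 by auto
  then show thesis by (rule that)
qed

lemma cov_greatest:
  assumes "f \<in> Ccp" "gauge \<phi>" "\<And>cs. covers f \<phi> cs \<Longrightarrow> a \<le> (\<Sum>(c, g)\<leftarrow>cs. c)"
  shows "a \<le> cov f \<phi>"
  unfolding cov_def using ex_covers[OF assms(1,2)] assms(3)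
  by (intro cInf_greatest) auto

lemma cov_nonneg: "f \<in> Ccp \<Longrightarrow> gauge \<phi> \<Longrightarrow> 0 \<le> cov f \<phi>"
  by (rule cov_greatest) (auto dest: covers_weight_nonneg)

lemma cov_approx:
  assumes "f \<in> Ccp" "gauge \<phi>" "e > 0"
  obtains cs where "covers f \<phi> cs" "(\<Sum>(c, g)\<leftarrow>cs. c) < cov f \<phi> + e"
  using cov_greatest[OF assms(1,2), of "cov f \<phi> + e"] assms(3) by force

lemma cov_mono:
  assumes "f' \<in> Ccp" "gauge \<phi>" "\<And>x. x \<in> carrier G \<Longrightarrow> f x \<le> f' x"
  shows "cov f \<phi> \<le> cov f' \<phi>"
  using assms(1,2)
proof (rule cov_greatest)
  fix cs assume "covers f' \<phi> cs"
  then have "covers f \<phi> cs" using assms(3) unfolding covers_def by force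
  then show "cov f \<phi> \<le> (\<Sum>(c, g)\<leftarrow>cs. c)" by (rule cov_le)
qed

lemma Ccp_add: "f \<in> Ccp \<Longrightarrow> f' \<in> Ccp \<Longrightarrow> (\<lambda>x. f x + f' x) \<in> Ccp"
  unfolding Ccp_def by (auto intro: Cc_add)

lemma Ccp_scale: "f \<in> Ccp \<Longrightarrow> 0 \<le> c \<Longrightarrow> (\<lambda>x. c * f x) \<in> Ccp"
  unfolding Ccp_def by (auto intro: Cc_scale)

lemma Ccp_translate: "f \<in> Ccp \<Longrightarrow> g \<in> carrier G \<Longrightarrow> (\<lambda>x. f (g \<otimes> x)) \<in> Ccp"
  unfolding Ccp_def by (auto intro: Cc_translate)

lemma cov_add:
  assumes f: "f \<in> Ccp" "f' \<in> Ccp" and \<phi>: "gauge \<phi>"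
  shows "cov (\<lambda>x. f x + f' x) \<phi> \<le> cov f \<phi> + cov f' \<phi>"
proof (rule field_le_epsilon)
  fix e :: real assume e: "e > 0"
  obtain cs where cs: "covers f \<phi> cs" "(\<Sum>(c, g)\<leftarrow>cs. c) < cov f \<phi> + e/2"
    using cov_approx[OF f(1) \<phi>, of "e/2"] e by auto
  obtain ds where ds: "covers f' \<phi> ds" "(\<Sum>(c, g)\<leftarrow>ds. c) < cov f' \<phi> + e/2"
    using cov_approx[OF f(2) \<phi>, of "e/2"] e by auto
  have "covers (\<lambda>x. f x + f' x) \<phi> (cs @ ds)"
    using cs(1) ds(1) unfolding covers_def comb_def by (auto intro: add_mono)
  from cov_le[OF this] show "cov (\<lambda>x. f x + f' x) \<phi> \<le> cov f \<phi> + cov f' \<phi> + e"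
    using cs(2) ds(2) by simp
qed

text \<open>Substituting a covering of \<psi> by \<phi> into a covering of \<open>f\<close> by
  \<psi> gives a covering of \<open>f\<close> by \<phi> whose total weight is the product. This
  inequality later bounds the normalised covering numbers from above and away from 0.\<close>

lemma cov_trans:
  assumes f: "f \<in> Ccp" and \<psi>: "gauge \<psi>" and \<phi>: "gauge \<phi>"
  shows "cov f \<phi> \<le> cov f \<psi> * cov \<psi> \<phi>"
proof -
  have \<psi>p: "\<psi> \<in> Ccp" using \<psi> unfolding gauge_def by auto
  have *: "cov f \<phi> \<le> (\<Sum>(c, g)\<leftarrow>cs. c) * (\<Sum>(c, g)\<leftarrow>ds. c)"
    if cs: "covers f \<psi> cs" and ds: "covers \<psi> \<phi> ds" for cs ds
  proof -
    let ?es = "concat (map (\<lambda>(c, g). map (\<lambda>(d, h). (c * d, h \<otimes> g)) ds) cs)"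
    have w: "(\<Sum>(c, g)\<leftarrow>?es. c) = (\<Sum>(c, g)\<leftarrow>cs. c) * (\<Sum>(c, g)\<leftarrow>ds. c)"
      by (induction cs) (auto simp: distrib_right o_def case_prod_unfold sum_list_const_mult)
    have cb: "comb \<phi> ?es x = (\<Sum>(c, g)\<leftarrow>cs. c * comb \<phi> ds (g \<otimes> x))"
      if "x \<in> carrier G" "set cs \<subseteq> {0..} \<times> carrier G" for x
      using that(2)
    proof (induction cs)
      case (Cons a cs)
      obtain c g where a: "a = (c, g)" by force
      have g: "g \<in> carrier G" using Cons.prems a by auto
      have hc: "h \<in> carrier G" if "(d, h) \<in> set ds" for d h
        using ds that unfolding covers_def by auto
      have "comb \<phi> (map (\<lambda>(d, h). (c * d, h \<otimes> g)) ds) x = c * comb \<phi> ds (g \<otimes> x)"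
        unfolding comb_def sum_list_const_mult[symmetric]
        using hc g that(1) by (auto simp: o_def case_prod_unfold m_assoc intro!: arg_cong[where f=sum_list])
      moreover have "comb \<phi> (xs @ ys) x = comb \<phi> xs x + comb \<phi> ys x" for xs ys
        by (simp add: comb_def)
      ultimately show ?case using Cons a by simp
    qed (simp add: comb_def)
    have "f x \<le> comb \<phi> ?es x" if x: "x \<in> carrier G" for x
    proof -
      have "f x \<le> comb \<psi> cs x" using cs x unfolding covers_def by auto
      also have "\<dots> \<le> (\<Sum>(c, g)\<leftarrow>cs. c * comb \<phi> ds (g \<otimes> x))"
        unfolding comb_def[of \<psi>] using cs ds x unfolding covers_def
        by (intro sum_list_mono) (auto intro!: mult_left_mono)
      also have "\<dots> = comb \<phi> ?es x" using cb[OF x] cs unfolding covers_def by simp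
      finally show ?thesis .
    qed
    moreover have "set ?es \<subseteq> {0..} \<times> carrier G"
    proof
      fix p assume "p \<in> set ?es"
      then obtain c g d h where p: "(c, g) \<in> set cs" "(d, h) \<in> set ds" "p = (c * d, h \<otimes> g)"
        by auto
      then have "(c, g) \<in> {0..} \<times> carrier G" "(d, h) \<in> {0..} \<times> carrier G"
        using cs ds unfolding covers_def by blast+
      with p(3) show "p \<in> {0..} \<times> carrier G" by auto
    qed
    ultimately have "covers f \<phi> ?es" unfolding covers_def by blast
    from cov_le[OF this] show ?thesis using w by simp
  qed
  \<comment> \<open>The two infima are taken one at a time, dividing by the other factor. A factor
    equal to 0 is treated apart, using any single covering.\<close>
  have **: "cov f \<phi> \<le> (\<Sum>(c, g)\<leftarrow>cs. c) * cov \<psi> \<phi>" if cs: "covers f \<psi> cs" for cs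
  proof (cases "(\<Sum>(c, g)\<leftarrow>cs. c) = 0")
    case True
    obtain ds where "covers \<psi> \<phi> ds" using ex_covers[OF \<psi>p \<phi>] .
    from *[OF cs this] True show ?thesis by simp
  next
    case False
    then have pos: "(\<Sum>(c, g)\<leftarrow>cs. c) > 0" using covers_weight_nonneg[OF cs] by linarith
    have "cov f \<phi> / (\<Sum>(c, g)\<leftarrow>cs. c) \<le> cov \<psi> \<phi>"
      using *[OF cs] pos by (intro cov_greatest[OF \<psi>p \<phi>]) (simp add: field_simps)
    then show ?thesis using pos by (simp add: field_simps)
  qed
  show ?thesis
  proof (cases "cov \<psi> \<phi> = 0")
    case True
    obtain cs where "covers f \<psi> cs" using ex_covers[OF f \<psi>] .
    from **[OF this] True show ?thesis by simp
  next
    case False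
    then have pos: "cov \<psi> \<phi> > 0" using cov_nonneg[OF \<psi>p \<phi>] by linarith
    have "cov f \<phi> / cov \<psi> \<phi> \<le> cov f \<psi>"
      using ** pos by (intro cov_greatest[OF f \<psi>]) (simp add: field_simps)
    then show ?thesis using pos by (simp add: field_simps)
  qed
qed

lemma cov_scale_le:
  assumes f: "f \<in> Ccp" and \<phi>: "gauge \<phi>" and c: "0 < c"
  shows "cov (\<lambda>x. c * f x) \<phi> \<le> c * cov f \<phi>"
proof -
  have "cov (\<lambda>x. c * f x) \<phi> / c \<le> cov f \<phi>"
  proof (rule cov_greatest[OF f \<phi>])
    fix cs assume cs: "covers f \<phi> cs"
    let ?ds = "map (\<lambda>(d, g). (c * d, g)) cs"
    have "covers (\<lambda>x. c * f x) \<phi> ?ds"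
      using cs c unfolding covers_def comb_def
      by (auto simp: o_def case_prod_unfold mult.assoc sum_list_const_mult)
    from cov_le[OF this] have "cov (\<lambda>x. c * f x) \<phi> \<le> c * (\<Sum>(c, g)\<leftarrow>cs. c)"
      by (simp add: o_def case_prod_unfold sum_list_const_mult)
    then show "cov (\<lambda>x. c * f x) \<phi> / c \<le> (\<Sum>(c, g)\<leftarrow>cs. c)" using c by (simp add: field_simps)
  qed
  then show ?thesis using c by (simp add: field_simps)
qed

lemma cov_scale:
  assumes f: "f \<in> Ccp" and \<phi>: "gauge \<phi>" and c: "0 < c"
  shows "cov (\<lambda>x. c * f x) \<phi> = c * cov f \<phi>"
proof (rule antisym[OF cov_scale_le[OF assms]])
  have "cov (\<lambda>x. 1/c * (c * f x)) \<phi> \<le> 1/c * cov (\<lambda>x. c * f x) \<phi>"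
    using c f by (intro cov_scale_le Ccp_scale \<phi>) auto
  then show "c * cov f \<phi> \<le> cov (\<lambda>x. c * f x) \<phi>" using c by (simp add: field_simps)
qed

lemma cov_translate_le:
  assumes f: "f \<in> Ccp" and \<phi>: "gauge \<phi>" and g: "g \<in> carrier G"
  shows "cov (\<lambda>x. f (g \<otimes> x)) \<phi> \<le> cov f \<phi>"
proof (rule cov_greatest[OF f \<phi>])
  fix cs assume cs: "covers f \<phi> cs"
  let ?ds = "map (\<lambda>(d, h). (d, h \<otimes> g)) cs"
  have hc: "h \<in> carrier G" if "(d, h) \<in> set cs" for d h
    using cs that unfolding covers_def by auto
  have "f (g \<otimes> x) \<le> comb \<phi> ?ds x" if x: "x \<in> carrier G" for x
  proof -
    have "f (g \<otimes> x) \<le> comb \<phi> cs (g \<otimes> x)" using cs x g unfolding covers_def by auto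
    also have "\<dots> = comb \<phi> ?ds x"
      unfolding comb_def using hc x g
      by (auto simp: o_def case_prod_unfold m_assoc intro!: arg_cong[where f=sum_list])
    finally show ?thesis .
  qed
  moreover have "set ?ds \<subseteq> {0..} \<times> carrier G"
    using cs g unfolding covers_def by fastforce
  ultimately have "covers (\<lambda>x. f (g \<otimes> x)) \<phi> ?ds" unfolding covers_def by blast
  from cov_le[OF this] show "cov (\<lambda>x. f (g \<otimes> x)) \<phi> \<le> (\<Sum>(c, g)\<leftarrow>cs. c)"
    by (simp add: o_def case_prod_unfold)
qed

lemma cov_translate:
  assumes f: "f \<in> Ccp" and \<phi>: "gauge \<phi>" and g: "g \<in> carrier G"
  shows "cov (\<lambda>x. f (g \<otimes> x)) \<phi> = cov f \<phi>"
proof (rule antisym[OF cov_translate_le[OF assms]])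
  have "cov f \<phi> \<le> cov (\<lambda>x. f (g \<otimes> (inv g \<otimes> x))) \<phi>"
    using g f by (intro cov_mono \<phi> Ccp_translate[of "\<lambda>x. f (g \<otimes> x)"] Ccp_translate)
      (auto simp flip: m_assoc)
  also have "\<dots> \<le> cov (\<lambda>x. f (g \<otimes> x)) \<phi>"
    using g f by (intro cov_translate_le[of "\<lambda>x. f (g \<otimes> x)"] Ccp_translate \<phi>) auto
  finally show "cov f \<phi> \<le> cov (\<lambda>x. f (g \<otimes> x)) \<phi>" .
qed

text \<open>Evaluated at a point where \<open>f\<close> is positive, a covering must have weight at
  least \<open>f x / C\<close>, where \<open>C\<close> bounds \<phi>. This allows division by
  \<open>cov f0 \<phi>\<close>.\<close>

lemma cov_pos:
  assumes f: "gauge f" and \<phi>: "gauge \<phi>"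
  shows "0 < cov f \<phi>"
proof -
  have fp: "f \<in> Ccp" and \<phi>C: "\<phi> \<in> Cc T" using f \<phi> unfolding gauge_def Ccp_def by auto
  obtain x where x: "x \<in> carrier G" "0 < f x" using f unfolding gauge_def by auto
  obtain C where C: "C > 0" "\<And>x. x \<in> carrier G \<Longrightarrow> \<bar>\<phi> x\<bar> \<le> C"
    using Cc_bounded[OF \<phi>C] by (metis topspace_eq)
  have "f x / C \<le> cov f \<phi>"
  proof (rule cov_greatest[OF fp \<phi>])
    fix cs assume cs: "covers f \<phi> cs"
    have "f x \<le> comb \<phi> cs x" using cs x unfolding covers_def by auto
    also have "\<dots> \<le> (\<Sum>(c, g)\<leftarrow>cs. C * c)"
      unfolding comb_def
    proof (rule sum_list_mono)
      fix p assume p: "p \<in> set cs"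
      obtain c g where [simp]: "p = (c, g)" by force
      have "0 \<le> c" "g \<in> carrier G" using cs p unfolding covers_def by auto
      then have "c * \<phi> (g \<otimes> x) \<le> c * C" using C(2)[of "g \<otimes> x"] x by (intro mult_left_mono) auto
      then show "(case p of (c, g) \<Rightarrow> c * \<phi> (g \<otimes> x)) \<le> (case p of (c, g) \<Rightarrow> C * c)" by (simp add: mult.commute)
    qed
    also have "\<dots> = C * (\<Sum>(c, g)\<leftarrow>cs. c)" by (simp add: case_prod_unfold sum_list_const_mult)
    finally show "f x / C \<le> (\<Sum>(c, g)\<leftarrow>cs. c)" using C by (simp add: field_simps)
  qed
  moreover have "0 < f x / C" using x C by simp
  ultimately show ?thesis by linarith
qed

text \<open>Multiplying a covering of \<open>f\<^sub>1 + f\<^sub>2\<close> by the slowly varying weights \<open>f\<^sub>i / (f\<^sub>1 + f\<^sub>2 + \<delta>)\<close>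
  splits it into coverings of \<open>f\<^sub>1\<close> and of \<open>f\<^sub>2\<close>.\<close>

lemma cov_superadditive:
  assumes f: "f1 \<in> Ccp" "f2 \<in> Ccp" and f': "f' \<in> Ccp" "\<And>x. x \<in> carrier G \<Longrightarrow> f1 x + f2 x \<noteq> 0 \<Longrightarrow> f' x = 1"
    and \<delta>: "\<delta> > 0" 
  obtains V where "openin T V" "\<one> \<in> V" "\<And>\<phi>. gauge \<phi> \<Longrightarrow> (\<And>x. x \<in> carrier G \<Longrightarrow> x \<notin> V \<Longrightarrow> \<phi> x = 0) \<Longrightarrow>
     cov f1 \<phi> + cov f2 \<phi> \<le> (1 + 2 * \<delta>) * (cov (\<lambda>x. f1 x + f2 x) \<phi> + \<delta> * cov f' \<phi>)"
proof -
  \<comment> \<open>The floor \<delta> takes effect only off the carrier, where signs are unknown;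
    on the carrier the denominator is \<open>f1 x + f2 x + \<delta>\<close>.\<close>
  define h where "h f x = f x * (1 / max \<delta> (f1 x + f2 x + \<delta>))" for f x
  have nn: "0 \<le> f1 x" "0 \<le> f2 x" "0 \<le> f' x" if "x \<in> carrier G" for x 
    using f f' that unfolding Ccp_def by auto
  have hC: "h f \<in> Cc T" if "f \<in> Ccp" for f
    unfolding h_def
  proof (rule Cc_mult_right)
    have "continuous_map T euclideanreal (\<lambda>x. f1 x + f2 x)"
      using f unfolding Ccp_def by (intro Cc_continuous Cc_add) auto
    then have "continuous_map T euclideanreal (\<lambda>x. f1 x + f2 x + \<delta>)"
      by (rule continuous_map_add) auto
    then show "continuous_map T euclideanreal (\<lambda>x. 1 / max \<delta> (f1 x + f2 x + \<delta>))"
      using \<delta> by (intro continuous_map_real_divide continuous_map_real_max) (auto simp: max_def)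
  qed (use that in \<open>auto simp: Ccp_def\<close>)
  have hn: "0 \<le> h f x" if "f \<in> Ccp" "x \<in> carrier G" for f x
    using that \<delta> unfolding h_def Ccp_def by (auto simp: max_def)
  have h12: "h f1 x + h f2 x \<le> 1" if "x \<in> carrier G" for x
  proof -
    have "h f1 x + h f2 x = (f1 x + f2 x) / (f1 x + f2 x + \<delta>)"
      using nn[OF that] by (simp add: h_def max_def add_divide_distrib)
    then show ?thesis using nn[OF that] \<delta> by simp
  qed
  obtain V1 where V1: "openin T V1" "\<one> \<in> V1"
    "\<And>v g. v \<in> V1 \<Longrightarrow> g \<in> carrier G \<Longrightarrow> \<bar>h f1 (g \<otimes> v) - h f1 g\<bar> < \<delta>"
    using uniformly_continuous[OF hC[OF f(1)] \<delta>] by blast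
  obtain V2 where V2: "openin T V2" "\<one> \<in> V2"
    "\<And>v g. v \<in> V2 \<Longrightarrow> g \<in> carrier G \<Longrightarrow> \<bar>h f2 (g \<otimes> v) - h f2 g\<bar> < \<delta>"
    using uniformly_continuous[OF hC[OF f(2)] \<delta>] by blast
  \<comment> \<open>Where \<open>f1 + f2\<close> is nonzero, \<open>f'\<close> is 1 and
    \<open>?F\<close> is exactly the denominator of \<open>h\<close>, so multiplying
    \<open>?F\<close> by \<open>h f1\<close> or \<open>h f2\<close> returns \<open>f1\<close> or
    \<open>f2\<close>.\<close>
  let ?F = "\<lambda>x. f1 x + f2 x + \<delta> * f' x"
  have FC: "?F \<in> Ccp" using f f' \<delta> by (intro Ccp_add Ccp_scale) auto
  show thesis
  proof (rule that[of "V1 \<inter> V2"])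
    fix \<phi> assume \<phi>: "gauge \<phi>" and supp: "\<And>x. x \<in> carrier G \<Longrightarrow> x \<notin> V1 \<inter> V2 \<Longrightarrow> \<phi> x = 0"
    have key: "cov f1 \<phi> + cov f2 \<phi> \<le> (1 + 2 * \<delta>) * (\<Sum>(c, g)\<leftarrow>cs. c)" if cs: "covers ?F \<phi> cs" for cs
    proof -
      have *: "cov f \<phi> \<le> (\<Sum>(c, g)\<leftarrow>cs. c * (h f (inv g) + \<delta>))"
        if fC: "f \<in> Ccp" and fle: "\<And>x. x \<in> carrier G \<Longrightarrow> f x \<le> f1 x + f2 x" and
         V: "\<And>v g. v \<in> V1 \<inter> V2 \<Longrightarrow> g \<in> carrier G \<Longrightarrow> \<bar>h f (g \<otimes> v) - h f g\<bar> < \<delta>" for f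
      proof -
        let ?ds = "map (\<lambda>(c, g). (c * (h f (inv g) + \<delta>), g)) cs"
        have "f x \<le> comb \<phi> ?ds x" if x: "x \<in> carrier G" for x
        proof -
          have "f x \<le> h f x * ?F x"
          proof (cases "f1 x + f2 x = 0")
            case True
            have "f x \<le> 0" using fle[OF x] True by simp
            also have "0 \<le> h f x * ?F x" using hn[OF fC x] nn[OF x] \<delta> by (intro mult_nonneg_nonneg) auto
            finally show ?thesis .
          next
            case False
            then have "f' x = 1" using f'(2) x by auto
            then show ?thesis using nn[OF x] \<delta> by (auto simp: h_def max_def)
          qed
          also have "\<dots> \<le> h f x * comb \<phi> cs x"
            using cs x hn[OF fC x] unfolding covers_def by (intro mult_left_mono) auto
          also have "\<dots> = (\<Sum>p\<leftarrow>cs. h f x * (fst p * \<phi> (snd p \<otimes> x)))"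
            by (simp add: comb_def case_prod_unfold sum_list_const_mult)
          also have "\<dots> \<le> (\<Sum>p\<leftarrow>cs. fst p * (h f (inv (snd p)) + \<delta>) * \<phi> (snd p \<otimes> x))"
          proof (rule sum_list_mono)
            fix p assume "p \<in> set cs"
            then have p: "0 \<le> fst p" "snd p \<in> carrier G" using cs unfolding covers_def by auto
            show "h f x * (fst p * \<phi> (snd p \<otimes> x)) \<le> fst p * (h f (inv (snd p)) + \<delta>) * \<phi> (snd p \<otimes> x)"
            proof (cases "snd p \<otimes> x \<in> V1 \<inter> V2")
              case True
              \<comment> \<open>A translate contributes at \<open>x\<close> only if
                \<open>snd p \<otimes> x\<close> is in the small neighbourhood. Then
                \<open>x\<close> is a small right increment of \<open>inv (snd p)\<close>, and the
                variable weight \<open>h f x\<close> can be frozen at \<open>inv (snd p)\<close> at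
                the cost of \<delta>.\<close>
              have "inv (snd p) \<otimes> (snd p \<otimes> x) = x" using p x by (simp flip: m_assoc)
              then have "h f x \<le> h f (inv (snd p)) + \<delta>"
                using V[OF True, of "inv (snd p)"] p by auto
              then have "h f x * (fst p * \<phi> (snd p \<otimes> x)) \<le> (h f (inv (snd p)) + \<delta>) * (fst p * \<phi> (snd p \<otimes> x))"
                using p x gauge_nonneg[OF \<phi>, of "snd p \<otimes> x"] by (intro mult_right_mono) auto
              then show ?thesis by (simp add: mult_ac)
            next
              case False
              then have "\<phi> (snd p \<otimes> x) = 0" using supp p x by auto
              then show ?thesis by simp
            qed
          qed
          also have "\<dots> = comb \<phi> ?ds x" by (simp add: comb_def o_def case_prod_unfold)
          finally show ?thesis .
        qed
        moreover have "set ?ds \<subseteq> {0..} \<times> carrier G"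
        proof
          fix p assume "p \<in> set ?ds"
          then obtain c g where p: "(c, g) \<in> set cs" "p = (c * (h f (inv g) + \<delta>), g)" by auto
          then have "(c, g) \<in> {0..} \<times> carrier G" using cs unfolding covers_def by blast
          with p(2) show "p \<in> {0..} \<times> carrier G" using hn[OF fC, of "inv g"] \<delta> by auto
        qed
        ultimately have "covers f \<phi> ?ds" unfolding covers_def by blast
        from cov_le[OF this] show ?thesis by (simp add: o_def case_prod_unfold)
      qed
      have "cov f1 \<phi> + cov f2 \<phi> \<le> (\<Sum>(c, g)\<leftarrow>cs. c * (h f1 (inv g) + \<delta>)) + (\<Sum>(c, g)\<leftarrow>cs. c * (h f2 (inv g) + \<delta>))"
        using f nn V1 V2 by (intro add_mono *) auto
      also have "\<dots> = (\<Sum>p\<leftarrow>cs. fst p * (h f1 (inv (snd p)) + h f2 (inv (snd p)) + 2 * \<delta>))"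
        by (simp add: case_prod_unfold sum_list_addf[symmetric] algebra_simps)
      also have "\<dots> \<le> (\<Sum>p\<leftarrow>cs. (1 + 2 * \<delta>) * fst p)"
      proof (rule sum_list_mono)
        fix p assume "p \<in> set cs"
        then have p: "0 \<le> fst p" "snd p \<in> carrier G" using cs unfolding covers_def by auto
        then have "fst p * (h f1 (inv (snd p)) + h f2 (inv (snd p)) + 2 * \<delta>) \<le> fst p * (1 + 2 * \<delta>)"
          using h12[of "inv (snd p)"] by (intro mult_left_mono) auto
        then show "fst p * (h f1 (inv (snd p)) + h f2 (inv (snd p)) + 2 * \<delta>) \<le> (1 + 2 * \<delta>) * fst p"
          by (simp add: mult.commute)
      qed
      also have "\<dots> = (1 + 2 * \<delta>) * (\<Sum>(c, g)\<leftarrow>cs. c)" by (simp add: case_prod_unfold sum_list_const_mult)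
      finally show ?thesis .
    qed
    have "(cov f1 \<phi> + cov f2 \<phi>) / (1 + 2 * \<delta>) \<le> cov ?F \<phi>"
      using key \<delta> by (intro cov_greatest[OF FC \<phi>]) (simp add: field_simps)
    also have "\<dots> \<le> cov (\<lambda>x. f1 x + f2 x) \<phi> + cov (\<lambda>x. \<delta> * f' x) \<phi>"
      using f f' \<delta> \<phi> by (intro cov_add Ccp_add Ccp_scale) auto
    also have "\<dots> = cov (\<lambda>x. f1 x + f2 x) \<phi> + \<delta> * cov f' \<phi>"
      using f' \<delta> \<phi> by (simp add: cov_scale)
    finally show "cov f1 \<phi> + cov f2 \<phi> \<le> (1 + 2 * \<delta>) * (cov (\<lambda>x. f1 x + f2 x) \<phi> + \<delta> * cov f' \<phi>)"
      using \<delta> by (simp add: field_simps)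
  qed (use V1 V2 in auto)
qed

section \<open>The Haar functional as a cluster point of normalised covering numbers\<close>

lemma ex_gauge:
  assumes V: "openin T V" "g \<in> V"
  obtains \<phi> where "gauge \<phi>" "\<phi> g = 1" "\<And>x. x \<in> carrier G \<Longrightarrow> x \<notin> V \<Longrightarrow> \<phi> x = 0"
proof -
  obtain f where "f \<in> Cc T" "\<And>y. 0 \<le> f y" "\<And>y. f y \<le> 1" "f g = 1"
    "\<And>y. y \<in> topspace T \<Longrightarrow> y \<notin> V \<Longrightarrow> f y = 0"
    using bump[OF loc_compact Hausdorff V] by blast
  moreover have "g \<in> carrier G" using openin_carrier V by blast
  ultimately show thesis
    by (intro that[of f]) (auto simp: gauge_def Ccp_def intro!: bexI[of _ g])
qed

text \<open>Every ratio \<open>I \<phi>\<close> is already subadditive, homogeneous, monotone and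
  invariant, and these properties pass to cluster points. Full additivity appears only in the limit,
  from \<open>cov_superadditive\<close> for gauges supported near 1. Strict positivity comes from
  \<open>cov_trans\<close>: the ratio at \<open>f\<close> is at least \<open>1 / cov f0 f\<close>
  for every gauge \<phi>.\<close>

lemma Ccp_haar:
  obtains L where "\<And>f f'. f \<in> Ccp \<Longrightarrow> f' \<in> Ccp \<Longrightarrow> L (\<lambda>x. f x + f' x) = L f + L f'"
    "\<And>f c. f \<in> Ccp \<Longrightarrow> 0 < c \<Longrightarrow> L (\<lambda>x. c * f x) = c * L f"
    "\<And>f g. f \<in> Ccp \<Longrightarrow> g \<in> carrier G \<Longrightarrow> L (\<lambda>x. f (g \<otimes> x)) = L f"
    "\<And>f f'. f' \<in> Ccp \<Longrightarrow> f \<in> Ccp \<Longrightarrow> (\<And>x. x \<in> carrier G \<Longrightarrow> f x \<le> f' x) \<Longrightarrow> L f \<le> L f'"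
    "\<And>f. f \<in> Ccp \<Longrightarrow> 0 \<le> L f" "\<And>f. gauge f \<Longrightarrow> (0::real) < L f"
proof -
  obtain f0 where f0: "gauge f0"
    using ex_gauge[OF openin_topspace, of \<one>] by auto
  then have f0p: "f0 \<in> Ccp" unfolding gauge_def by auto
  \<comment> \<open>The cube in \<open>pointwise_cluster\<close> is indexed by all functions, so
    \<open>I \<phi>\<close> and \<open>c\<close> are set to 0 off \<open>Ccp\<close>. On
    \<open>Ccp\<close>, \<open>cov_trans\<close> keeps the ratio below \<open>cov f f0\<close>, a
    bound free of \<phi>.\<close>
  define I where "I \<phi> f = (if f \<in> Ccp then cov f \<phi> / cov f0 \<phi> else 0)" for \<phi> f
  define A where "A V = {I \<phi> | \<phi>. gauge \<phi> \<and> (\<forall>x\<in>carrier G - V. \<phi> x = 0)}" for V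
  define N where "N = {V. openin T V \<and> \<one> \<in> V}"
  define c where "c f = (if f \<in> Ccp then cov f f0 else 0)" for f
  have Ic: "0 \<le> I \<phi> f \<and> I \<phi> f \<le> c f" if \<phi>: "gauge \<phi>" for \<phi> f
    using cov_trans[OF _ f0 \<phi>, of f] cov_pos[OF f0 \<phi>] cov_nonneg[OF _ \<phi>, of f]
    by (auto simp: I_def c_def field_simps)
  have "topspace T \<in> N" unfolding N_def by auto
  then have N: "N \<noteq> {}" by auto
  have Ane: "A V \<noteq> {}" if V: "V \<in> N" for V
  proof -
    obtain \<phi> where "gauge \<phi>" "\<phi> \<one> = 1" "\<And>x. x \<in> carrier G \<Longrightarrow> x \<notin> V \<Longrightarrow> \<phi> x = 0"
      using V ex_gauge[of V \<one>] unfolding N_def by blast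
    then have "I \<phi> \<in> A V" unfolding A_def by auto
    then show ?thesis by blast
  qed
  have dir: "\<exists>W\<in>N. A W \<subseteq> A V \<inter> A V'" if "V \<in> N" "V' \<in> N" for V V'
    using that by (intro bexI[of _ "V \<inter> V'"]) (auto simp: N_def A_def)
  have bd: "0 \<le> h f \<and> h f \<le> c f" if "V \<in> N" "h \<in> A V" for V h f
    using that Ic unfolding A_def by auto
  obtain L where L: "\<And>V F e. V \<in> N \<Longrightarrow> finite F \<Longrightarrow> e > 0 \<Longrightarrow> \<exists>h\<in>A V. \<forall>f\<in>F. \<bar>h f - L f\<bar> < e"
    using pointwise_cluster[of N A c] N Ane dir bd by blast
  have Lap: "\<exists>\<phi>. gauge \<phi> \<and> (\<forall>x\<in>carrier G - V. \<phi> x = 0) \<and> (\<forall>f\<in>F. \<bar>I \<phi> f - L f\<bar> < e)"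
    if V: "V \<in> N" and F: "finite F" and e: "e > 0" for V F e
    using L[OF V F e] unfolding A_def by blast
  have L0: "\<exists>\<phi>. gauge \<phi> \<and> (\<forall>f\<in>F. \<bar>I \<phi> f - L f\<bar> < e)" if "finite F" "e > 0" for F e
    using Lap[OF \<open>topspace T \<in> N\<close> that] by blast
  show thesis
  proof (rule that[of L])
    fix f f' assume f: "f \<in> Ccp" "f' \<in> Ccp"
    let ?s = "\<lambda>x. f x + f' x"
    have s: "?s \<in> Ccp" using Ccp_add f by auto
    show "L ?s = L f + L f'"
    proof (rule antisym)
      show "L ?s \<le> L f + L f'"
      proof (rule field_le_epsilon)
        fix e :: real assume e: "e > 0"
        obtain \<phi> where \<phi>: "gauge \<phi>" "\<forall>k\<in>{f, f', ?s}. \<bar>I \<phi> k - L k\<bar> < e / 3"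
          using L0[of "{f, f', ?s}" "e/3"] e by auto
        have "I \<phi> ?s \<le> I \<phi> f + I \<phi> f'"
          using cov_add[OF f \<phi>(1)] cov_pos[OF f0 \<phi>(1)] f s by (simp add: I_def field_simps)
        moreover have "\<bar>I \<phi> f - L f\<bar> < e / 3" "\<bar>I \<phi> f' - L f'\<bar> < e / 3" "\<bar>I \<phi> ?s - L ?s\<bar> < e / 3"
          using \<phi>(2) by simp_all
        ultimately show "L ?s \<le> L f + L f' + e" unfolding abs_less_iff by linarith
      qed
      show "L f + L f' \<le> L ?s"
      proof (rule field_le_epsilon)
        fix e :: real assume e: "e > 0"
        obtain K where K: "compactin T K" "\<And>x. x \<in> carrier G \<Longrightarrow> x \<notin> K \<Longrightarrow> ?s x = 0"
          using Cc_support[of ?s T] s unfolding Ccp_def by (metis (no_types, lifting) mem_Collect_eq topspace_eq)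
        obtain f'' where f'': "f'' \<in> Cc T" "\<And>y. 0 \<le> f'' y" "\<And>y. y \<in> K \<Longrightarrow> f'' y = 1"
          using Cc_dominating[OF loc_compact Hausdorff K(1)] by metis
        have f''p: "f'' \<in> Ccp" using f'' unfolding Ccp_def by auto
        have cn: "0 \<le> c k" for k using Ic[OF f0, of k] by linarith
        \<comment> \<open>The excess coming from \<open>cov_superadditive\<close> is at most
          \<open>\<delta> * (2 * c ?s + 3 * c f'')\<close> once \<open>\<delta> \<le> 1\<close>; the
          3 is 1 + 2\<delta> at worst. This is pushed below \<open>e / 2\<close>, the summand 1
          keeps the denominator positive, and the other half of \<open>e\<close> pays for three
          approximation errors \<open>e / 6\<close>.\<close>
        define \<delta> where "\<delta> = min 1 (e / (2 * (2 * c ?s + 3 * c f'' + 1)))"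
        have \<delta>: "0 < \<delta>" "\<delta> \<le> 1" "\<delta> * (2 * c ?s + 3 * c f'') \<le> e / 2"
        proof -
          have p: "0 < 2 * c ?s + 3 * c f'' + 1" using cn[of ?s] cn[of f''] by linarith
          show "0 < \<delta>" "\<delta> \<le> 1" using e p unfolding \<delta>_def by auto
          have "\<delta> * (2 * c ?s + 3 * c f'') \<le> e / (2 * (2 * c ?s + 3 * c f'' + 1)) * (2 * c ?s + 3 * c f'' + 1)"
            using e cn[of ?s] cn[of f''] p by (intro mult_mono) (auto simp: \<delta>_def)
          also have "\<dots> = e / 2" using p by (simp add: field_simps)
          finally show "\<delta> * (2 * c ?s + 3 * c f'') \<le> e / 2" .
        qed
        have "f'' x = 1" if "x \<in> carrier G" "f x + f' x \<noteq> 0" for x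
          using K(2) f''(3) that by blast
        then obtain V where V: "openin T V" "\<one> \<in> V"
          "\<And>\<phi>. gauge \<phi> \<Longrightarrow> (\<And>x. x \<in> carrier G \<Longrightarrow> x \<notin> V \<Longrightarrow> \<phi> x = 0) \<Longrightarrow>
             cov f \<phi> + cov f' \<phi> \<le> (1 + 2 * \<delta>) * (cov ?s \<phi> + \<delta> * cov f'' \<phi>)"
          using cov_superadditive[OF f f''p _ \<delta>(1)] by blast
        obtain \<phi> where \<phi>: "gauge \<phi>" "\<forall>x\<in>carrier G - V. \<phi> x = 0" "\<forall>k\<in>{f, f', ?s}. \<bar>I \<phi> k - L k\<bar> < e / 6"
          using Lap[of V "{f, f', ?s}" "e/6"] e V unfolding N_def by auto
        let ?p = "cov f0 \<phi>"
        have p: "?p > 0" using cov_pos[OF f0 \<phi>(1)] .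
        have "I \<phi> f + I \<phi> f' = (cov f \<phi> + cov f' \<phi>) / ?p" using f by (simp add: I_def add_divide_distrib)
        also have "\<dots> \<le> (1 + 2 * \<delta>) * (cov ?s \<phi> + \<delta> * cov f'' \<phi>) / ?p"
          using V(3)[OF \<phi>(1)] \<phi>(2) p by (intro divide_right_mono) auto
        also have "\<dots> = (1 + 2 * \<delta>) * (I \<phi> ?s + \<delta> * I \<phi> f'')"
          using s f''p by (simp add: I_def add_divide_distrib distrib_left)
        also have "\<dots> = I \<phi> ?s + \<delta> * (2 * I \<phi> ?s + I \<phi> f'' + 2 * \<delta> * I \<phi> f'')"
          by (simp add: algebra_simps)
        also have "\<dots> \<le> I \<phi> ?s + \<delta> * (2 * c ?s + c f'' + 2 * 1 * c f'')"
          using Ic[OF \<phi>(1), of ?s] Ic[OF \<phi>(1), of f''] \<delta>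
          by (intro add_left_mono mult_left_mono add_mono mult_mono) auto
        also have "\<dots> \<le> I \<phi> ?s + e / 2" using \<delta>(3) by (simp add: algebra_simps)
        finally have "I \<phi> f + I \<phi> f' \<le> I \<phi> ?s + e / 2" .
        moreover have "\<bar>I \<phi> f - L f\<bar> < e / 6" "\<bar>I \<phi> f' - L f'\<bar> < e / 6" "\<bar>I \<phi> ?s - L ?s\<bar> < e / 6"
          using \<phi>(3) by simp_all
        ultimately show "L f + L f' \<le> L ?s + e" unfolding abs_less_iff by linarith
      qed
    qed
  next
    fix f and a :: real assume f: "f \<in> Ccp" and a: "0 < a"
    let ?s = "\<lambda>x. a * f x"
    have s: "?s \<in> Ccp" using Ccp_scale f a by auto
    have "\<bar>L ?s - a * L f\<bar> \<le> 0 + e" if e: "e > 0" for e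
    proof -
      obtain \<phi> where \<phi>: "gauge \<phi>" "\<forall>k\<in>{f, ?s}. \<bar>I \<phi> k - L k\<bar> < e / (a + 1)"
        using L0[of "{f, ?s}" "e / (a + 1)"] e a by auto
      have "I \<phi> ?s = a * I \<phi> f"
        using cov_scale[OF f \<phi>(1) a] f s by (simp add: I_def)
      then have "L ?s - a * L f = (L ?s - I \<phi> ?s) + a * (I \<phi> f - L f)"
        by (simp add: right_diff_distrib)
      also have "\<bar>\<dots>\<bar> \<le> \<bar>L ?s - I \<phi> ?s\<bar> + \<bar>a * (I \<phi> f - L f)\<bar>" by (rule abs_triangle_ineq)
      also have "\<dots> = \<bar>I \<phi> ?s - L ?s\<bar> + a * \<bar>I \<phi> f - L f\<bar>"
        using a by (simp add: abs_mult abs_minus_commute)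
      also have "\<dots> \<le> e / (a + 1) + a * (e / (a + 1))"
        using \<phi>(2) a by (intro add_mono mult_left_mono) auto
      also have "\<dots> = (1 + a) * (e / (1 + a))" by (simp only: distrib_right mult_1_left add.commute)
      also have "\<dots> = e" using a by simp
      finally show ?thesis by simp
    qed
    then have "\<bar>L ?s - a * L f\<bar> \<le> 0" by (rule field_le_epsilon)
    then show "L ?s = a * L f" by simp
  next
    fix f g assume f: "f \<in> Ccp" and g: "g \<in> carrier G"
    let ?s = "\<lambda>x. f (g \<otimes> x)"
    have s: "?s \<in> Ccp" using Ccp_translate f g by auto
    have "\<bar>L ?s - L f\<bar> \<le> 0 + e" if e: "e > 0" for e
    proof -
      obtain \<phi> where \<phi>: "gauge \<phi>" "\<forall>k\<in>{f, ?s}. \<bar>I \<phi> k - L k\<bar> < e / 2"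
        using L0[of "{f, ?s}" "e / 2"] e by auto
      have "I \<phi> ?s = I \<phi> f"
        using cov_translate[OF f \<phi>(1) g] f s by (simp add: I_def)
      moreover have "\<bar>I \<phi> f - L f\<bar> < e / 2" "\<bar>I \<phi> ?s - L ?s\<bar> < e / 2"
        using \<phi>(2) by simp_all
      ultimately show ?thesis unfolding abs_less_iff abs_le_iff by linarith
    qed
    then have "\<bar>L ?s - L f\<bar> \<le> 0" by (rule field_le_epsilon)
    then show "L ?s = L f" by simp
  next
    fix f f' assume f: "f' \<in> Ccp" "f \<in> Ccp" and le: "\<And>x. x \<in> carrier G \<Longrightarrow> f x \<le> f' x"
    show "L f \<le> L f'"
    proof (rule field_le_epsilon)
      fix e :: real assume "e > 0"
      then obtain \<phi> where \<phi>: "gauge \<phi>" "\<forall>k\<in>{f, f'}. \<bar>I \<phi> k - L k\<bar> < e / 2"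
        using L0[of "{f, f'}" "e/2"] by auto
      have "I \<phi> f \<le> I \<phi> f'"
        using cov_mono[OF f(1) \<phi>(1) le] f cov_pos[OF f0 \<phi>(1)] by (simp add: I_def divide_right_mono)
      moreover have "\<bar>I \<phi> f - L f\<bar> < e / 2" "\<bar>I \<phi> f' - L f'\<bar> < e / 2"
        using \<phi>(2) by simp_all
      ultimately show "L f \<le> L f' + e" unfolding abs_less_iff by linarith
    qed
  next
    fix f assume f: "f \<in> Ccp"
    show "0 \<le> L f"
    proof (rule field_le_epsilon)
      fix e :: real assume "e > 0"
      then obtain \<phi> where "gauge \<phi>" "\<bar>I \<phi> f - L f\<bar> < e"
        using L0[of "{f}" e] by auto
      with Ic[of \<phi> f] show "0 \<le> L f + e" by auto
    qed
  next
    fix f assume f: "gauge f"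
    then have fp: "f \<in> Ccp" unfolding gauge_def by auto
    have "1 / cov f0 f \<le> L f + e" if e: "e > 0" for e
    proof -
      obtain \<phi> where \<phi>: "gauge \<phi>" "\<bar>I \<phi> f - L f\<bar> < e"
        using L0[of "{f}" e] e by auto
      have "1 / cov f0 f \<le> I \<phi> f"
        using cov_trans[OF f0p f \<phi>(1)] cov_pos[OF f0 f] cov_pos[OF f0 \<phi>(1)] fp
        by (simp add: I_def field_simps)
      with \<phi>(2) show ?thesis by auto
    qed
    then have "1 / cov f0 f \<le> L f" by (rule field_le_epsilon)
    moreover have "0 < 1 / cov f0 f" using cov_pos[OF f0 f] by simp
    ultimately show "0 < L f" by linarith
  qed
qed

end

section \<open>The Haar functional on all compactly supported functions\<close>

locale haar = lc_group +
  fixes J :: "('a \<Rightarrow> real) \<Rightarrow> real"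
  assumes J_add: "f \<in> Cc T \<Longrightarrow> f' \<in> Cc T \<Longrightarrow> J (\<lambda>x. f x + f' x) = J f + J f'"
    and J_scale: "f \<in> Cc T \<Longrightarrow> J (\<lambda>x. c * f x) = c * J f"
    and J_translate: "f \<in> Cc T \<Longrightarrow> g \<in> carrier G \<Longrightarrow> J (\<lambda>x. f (g \<otimes> x)) = J f"
    and J_nonneg: "f \<in> Cc T \<Longrightarrow> (\<And>x. x \<in> carrier G \<Longrightarrow> 0 \<le> f x) \<Longrightarrow> 0 \<le> J f"
    and J_pos: "f \<in> Cc T \<Longrightarrow> (\<And>x. x \<in> carrier G \<Longrightarrow> 0 \<le> f x) \<Longrightarrow> x \<in> carrier G \<Longrightarrow> 0 < f x \<Longrightarrow> 0 < J f"

lemma (in lc_group) ex_haar: obtains J where "haar G T J"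
proof -
  obtain L where L: "\<And>f f'. f \<in> Ccp \<Longrightarrow> f' \<in> Ccp \<Longrightarrow> L (\<lambda>x. f x + f' x) = L f + L f'"
    "\<And>f c. f \<in> Ccp \<Longrightarrow> 0 < c \<Longrightarrow> L (\<lambda>x. c * f x) = c * L f"
    "\<And>f g. f \<in> Ccp \<Longrightarrow> g \<in> carrier G \<Longrightarrow> L (\<lambda>x. f (g \<otimes> x)) = L f"
    "\<And>f f'. f' \<in> Ccp \<Longrightarrow> f \<in> Ccp \<Longrightarrow> (\<And>x. x \<in> carrier G \<Longrightarrow> f x \<le> f' x) \<Longrightarrow> L f \<le> L f'"
    "\<And>f. f \<in> Ccp \<Longrightarrow> 0 \<le> L f" "\<And>f. gauge f \<Longrightarrow> (0::real) < L f"
    using Ccp_haar by blast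
  define P where "P f x = max (f x) (0::real)" for f and x :: 'a
  define M where "M f x = max (- f x) (0::real)" for f and x :: 'a
  define J where "J f = L (P f) - L (M f)" for f
  have PM: "P f \<in> Ccp" "M f \<in> Ccp" if "f \<in> Cc T" for f
    using that unfolding Ccp_def P_def M_def by (auto intro!: Cc_max Cc_uminus)
  \<comment> \<open>Any two ways of writing \<open>f\<close> as a difference of nonnegative
    functions give the same value, because \<open>P f + b = M f + a\<close>. Linearity and
    invariance then follow by picking a convenient decomposition.\<close>
  have J: "J f = L a - L b" if f: "f \<in> Cc T" and a: "a \<in> Ccp" and b: "b \<in> Ccp" and e: "\<And>x. f x = a x - b x" for f a b
  proof -
    have "(\<lambda>x. P f x + b x) = (\<lambda>x. M f x + a x)" using e by (auto simp: P_def M_def max_def)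
    then have "L (P f) + L b = L (M f) + L a"
      using L(1)[OF PM(1)[OF f] b] L(1)[OF PM(2)[OF f] a] by simp
    then show ?thesis by (simp add: J_def)
  qed
  have PMd: "f x = P f x - M f x" for f x by (auto simp: P_def M_def)
  \<comment> \<open>Homogeneity is available for positive factors, so the value at the zero function
    is read off from its being equal to twice itself.\<close>
  have z: "L (\<lambda>x. 0) = 0" using L(2)[of "\<lambda>x. 0" 2] by (simp add: Ccp_def)
  have Jp: "J f = L (P f)" if f: "f \<in> Cc T" "\<And>x. x \<in> carrier G \<Longrightarrow> 0 \<le> f x" for f
  proof -
    \<comment> \<open>\<open>M f\<close> is known to vanish on the carrier only, so it is compared
      with the zero function through monotonicity.\<close>
    have M: "M f x = 0" if "x \<in> carrier G" for x using f(2)[OF that] by (simp add: M_def)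
    have "L (M f) \<le> L (\<lambda>x. 0)"
      using M PM[OF f(1)] by (intro L(4)) (auto simp: Ccp_def)
    moreover have "0 \<le> L (M f)" using L(5) PM f by auto
    ultimately show ?thesis using z by (simp add: J_def)
  qed
  have "haar G T J"
  proof unfold_locales
    fix f f' assume f: "f \<in> Cc T" "f' \<in> Cc T"
    have "J (\<lambda>x. f x + f' x) = L (\<lambda>x. P f x + P f' x) - L (\<lambda>x. M f x + M f' x)"
      using f PMd[of f] PMd[of f'] by (intro J Cc_add[OF f] Ccp_add PM) auto
    also have "\<dots> = J f + J f'" using f by (simp add: L(1) PM J_def)
    finally show "J (\<lambda>x. f x + f' x) = J f + J f'" .
  next
    fix f and c :: real assume f: "f \<in> Cc T"
    consider "c = 0" | "c > 0" | "c < 0" by linarith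
    then show "J (\<lambda>x. c * f x) = c * J f"
    proof cases
      case 1
      have "P (\<lambda>x. 0) = M (\<lambda>x. 0)" by (rule ext) (simp add: P_def M_def)
      with 1 show ?thesis by (simp add: J_def)
    next
      case 2
      have "J (\<lambda>x. c * f x) = L (\<lambda>x. c * P f x) - L (\<lambda>x. c * M f x)"
        using 2 f PMd[of f] by (intro J Cc_scale[OF f] Ccp_scale PM[OF f]) (auto simp flip: right_diff_distrib)
      then show ?thesis using 2 f by (simp add: L(2) PM J_def right_diff_distrib)
    next
      case 3
      have "J (\<lambda>x. c * f x) = L (\<lambda>x. (- c) * M f x) - L (\<lambda>x. (- c) * P f x)"
      proof (intro J Cc_scale[OF f] Ccp_scale PM[OF f])
        show "c * f x = - c * M f x - - c * P f x" for x
          by (subst PMd) (simp add: algebra_simps)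
      qed (use 3 in auto)
      also have "\<dots> = (- c) * L (M f) - (- c) * L (P f)"
        using 3 f by (subst (1 2) L(2)) (auto intro: PM)
      finally show ?thesis by (simp add: J_def algebra_simps)
    qed
  next
    fix f g assume f: "f \<in> Cc T" and g: "g \<in> carrier G"
    have "J (\<lambda>x. f (g \<otimes> x)) = L (\<lambda>x. P f (g \<otimes> x)) - L (\<lambda>x. M f (g \<otimes> x))"
      using f g PMd[of f] by (intro J Cc_translate[OF f] Ccp_translate PM[OF f]) auto
    also have "\<dots> = J f" using f g by (simp add: L(3) PM J_def)
    finally show "J (\<lambda>x. f (g \<otimes> x)) = J f" .
  next
    fix f assume "f \<in> Cc T" "\<And>x. x \<in> carrier G \<Longrightarrow> 0 \<le> f x"
    then show "0 \<le> J f" using Jp L(5) PM by simp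
  next
    fix f x assume f: "f \<in> Cc T" "\<And>x. x \<in> carrier G \<Longrightarrow> 0 \<le> f x" and x: "x \<in> carrier G" "0 < f x"
    have "gauge (P f)" using PM(1)[OF f(1)] x unfolding gauge_def by (auto simp: P_def intro!: bexI[of _ x])
    then show "0 < J f" using Jp[OF f] L(6) by simp
  qed
  then show thesis by (rule that)
qed

context haar
begin

lemma J_zero: "J (\<lambda>x. 0) = 0"
  using J_scale[of "\<lambda>x. 0" 0] by simp

lemma J_diff: "f \<in> Cc T \<Longrightarrow> f' \<in> Cc T \<Longrightarrow> J (\<lambda>x. f x - f' x) = J f - J f'"
  using J_add[of f "\<lambda>x. -1 * f' x"] J_scale[of f' "-1"] Cc_scale[of f' T "-1"] by simp

lemma J_mono:
  assumes "f \<in> Cc T" "f' \<in> Cc T" "\<And>x. x \<in> carrier G \<Longrightarrow> f x \<le> f' x"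
  shows "J f \<le> J f'"
  using J_nonneg[of "\<lambda>x. f' x - f x"] J_diff[of f' f] assms by (auto intro: Cc_diff)

lemma J_cong:
  assumes "f \<in> Cc T" "f' \<in> Cc T" "\<And>x. x \<in> carrier G \<Longrightarrow> f x = f' x"
  shows "J f = J f'"
  using assms by (intro antisym J_mono) auto

lemma J_sum:
  "finite I \<Longrightarrow> (\<And>i. i \<in> I \<Longrightarrow> f i \<in> Cc T) \<Longrightarrow> J (\<lambda>x. \<Sum>i\<in>I. f i x) = (\<Sum>i\<in>I. J (f i))"
  by (induction I rule: finite_induct) (auto simp: J_zero J_add Cc_sum)

text \<open>Constants have no integral on a noncompact group, so errors are measured against a fixed
  \<open>k\<close>. Taking \<open>k\<close> to be the compactly supported factor of an integrand
  turns a uniform error on its support into a bound for \<open>J\<close>.\<close>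

lemma J_abs_le:
  assumes f: "f \<in> Cc T" and k: "k \<in> Cc T" and le: "\<And>x. x \<in> carrier G \<Longrightarrow> \<bar>f x\<bar> \<le> e * \<bar>k x\<bar>"
  shows "\<bar>J f\<bar> \<le> e * J (\<lambda>x. \<bar>k x\<bar>)"
proof -
  have k': "(\<lambda>x. e * \<bar>k x\<bar>) \<in> Cc T" using k by (intro Cc_scale Cc_abs)
  have "J f \<le> J (\<lambda>x. e * \<bar>k x\<bar>)"
    using le by (intro J_mono f k') (auto simp: abs_le_iff)
  moreover have "J (\<lambda>x. (-1) * f x) \<le> J (\<lambda>x. e * \<bar>k x\<bar>)"
    using le by (intro J_mono Cc_scale f k') (auto simp: abs_le_iff)
  ultimately show ?thesis
    using J_scale[OF Cc_abs[OF k], of e] J_scale[OF f, of "-1"] by simp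
qed

lemma J_abs_nonneg: "k \<in> Cc T \<Longrightarrow> 0 \<le> J (\<lambda>x. \<bar>k x\<bar>)"
  by (intro J_nonneg Cc_abs) auto

end

section \<open>Parameter integrals and Fubini's theorem\<close>

lemma continuous_map_slice:
  assumes "continuous_map (prod_topology X Y) Z (\<lambda>p. H (fst p) (snd p))" "x \<in> topspace X"
  shows "continuous_map Y Z (H x)"
proof -
  have "continuous_map Y (prod_topology X Y) (\<lambda>y. (x, y))"
    using assms(2) by (intro continuous_map_pairedI) auto
  from continuous_map_compose[OF this assms(1)] show ?thesis by (simp add: o_def)
qed

lemma continuous_map_swapped:
  assumes "continuous_map (prod_topology X Y) Z (\<lambda>p. H (fst p) (snd p))"
  shows "continuous_map (prod_topology Y X) Z (\<lambda>p. H (snd p) (fst p))"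
proof -
  have "continuous_map (prod_topology Y X) (prod_topology X Y) (\<lambda>p. (snd p, fst p))"
    by (intro continuous_map_pairedI continuous_map_fst continuous_map_snd)
  from continuous_map_compose[OF this assms(1)] show ?thesis by (simp add: o_def)
qed

context haar
begin

lemma J_integrand:
  assumes "\<psi> \<in> Cc T" "continuous_map (prod_topology X T) euclideanreal (\<lambda>p. H (fst p) (snd p))" "x \<in> topspace X"
  shows "(\<lambda>y. \<psi> y * H x y) \<in> Cc T"
  using assms by (intro Cc_mult_right continuous_map_slice[OF assms(2)])

lemma J_integral_close:
  assumes \<psi>: "\<psi> \<in> Cc T" and a: "continuous_map T euclideanreal a" and b: "continuous_map T euclideanreal b"
    and K: "\<And>x. x \<in> carrier G \<Longrightarrow> x \<notin> K \<Longrightarrow> \<psi> x = 0"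
    and ab: "\<And>x. x \<in> K \<Longrightarrow> x \<in> carrier G \<Longrightarrow> \<bar>a x - b x\<bar> \<le> e"
  shows "\<bar>J (\<lambda>y. \<psi> y * a y) - J (\<lambda>y. \<psi> y * b y)\<bar> \<le> e * J (\<lambda>y. \<bar>\<psi> y\<bar>)"
proof -
  have *: "(\<lambda>y. \<psi> y * a y) \<in> Cc T" "(\<lambda>y. \<psi> y * b y) \<in> Cc T" 
    using \<psi> a b by (auto intro: Cc_mult_right)
  have "\<bar>\<psi> x * a x - \<psi> x * b x\<bar> \<le> e * \<bar>\<psi> x\<bar>" if "x \<in> carrier G" for x
  proof (cases "x \<in> K")
    case True
    have "\<bar>\<psi> x * a x - \<psi> x * b x\<bar> = \<bar>a x - b x\<bar> * \<bar>\<psi> x\<bar>"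
      by (metis abs_mult mult.commute right_diff_distrib)
    also have "\<dots> \<le> e * \<bar>\<psi> x\<bar>" using ab[OF True that] by (intro mult_right_mono) auto
    finally show ?thesis .
  qed (use K that in auto)
  then have "\<bar>J (\<lambda>y. \<psi> y * a y - \<psi> y * b y)\<bar> \<le> e * J (\<lambda>y. \<bar>\<psi> y\<bar>)"
    using * \<psi> by (intro J_abs_le Cc_diff)
  then show ?thesis using J_diff[OF *] by simp
qed

text \<open>Only \<open>y\<close> in the compact support of \<psi> matters, and
  \<open>tube_uniform\<close> controls \<open>H x y - H x0 y\<close> for all of these at once. The
  tolerance is divided by \<open>?P + 1\<close> because \<open>?P\<close> may be 0.\<close>

lemma J_continuous_param:
  assumes \<psi>: "\<psi> \<in> Cc T" and H: "continuous_map (prod_topology X T) euclideanreal (\<lambda>p. H (fst p) (snd p))"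
  shows "continuous_map X euclideanreal (\<lambda>x. J (\<lambda>y. \<psi> y * H x y))"
proof (rule continuous_map_real_locally)
  fix x0 and e :: real assume x0: "x0 \<in> topspace X" and e: "e > 0"
  obtain K where K: "compactin T K" "\<And>x. x \<in> carrier G \<Longrightarrow> x \<notin> K \<Longrightarrow> \<psi> x = 0"
    using Cc_support[OF \<psi>] by (metis topspace_eq)
  let ?P = "J (\<lambda>y. \<bar>\<psi> y\<bar>)"
  have P: "?P \<ge> 0" using J_abs_nonneg[OF \<psi>] .
  have e': "e / (?P + 1) > 0" using e P by simp
  obtain U where U: "openin X U" "x0 \<in> U"
     "\<And>x y. x \<in> U \<Longrightarrow> y \<in> K \<Longrightarrow> \<bar>H (fst (x, y)) (snd (x, y)) - H (fst (x0, y)) (snd (x0, y))\<bar> < e / (?P + 1)"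
    using tube_uniform[OF H K(1) x0 e'] by blast
  have "\<bar>J (\<lambda>y. \<psi> y * H x y) - J (\<lambda>y. \<psi> y * H x0 y)\<bar> \<le> e" if x: "x \<in> U" for x
  proof -
    have xX: "x \<in> topspace X" using U(1) x openin_subset by blast
    have "\<bar>J (\<lambda>y. \<psi> y * H x y) - J (\<lambda>y. \<psi> y * H x0 y)\<bar> \<le> e / (?P + 1) * ?P"
      using U(3)[OF x] K(2)
      by (intro J_integral_close[where K=K] \<psi> continuous_map_slice[OF H] xX x0) (auto simp: less_imp_le)
    also have "\<dots> \<le> e" using P e by (simp add: field_simps)
    finally show ?thesis .
  qed
  with U show "\<exists>U. openin X U \<and> x0 \<in> U \<and> (\<forall>x\<in>U. \<bar>J (\<lambda>y. \<psi> y * H x y) - J (\<lambda>y. \<psi> y * H x0 y)\<bar> \<le> e)"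
    by blast
qed

lemma J_iterated_close:
  assumes k: "k \<in> Cc T" and \<psi>: "\<psi> \<in> Cc T"
    and H: "continuous_map (prod_topology T T) euclideanreal (\<lambda>p. H (fst p) (snd p))"
    and H': "continuous_map (prod_topology T T) euclideanreal (\<lambda>p. H' (fst p) (snd p))"
    and K: "\<And>x. x \<in> carrier G \<Longrightarrow> x \<notin> K \<Longrightarrow> k x = 0" and L: "\<And>x. x \<in> carrier G \<Longrightarrow> x \<notin> L \<Longrightarrow> \<psi> x = 0"
    and HH: "\<And>x y. x \<in> K \<Longrightarrow> y \<in> L \<Longrightarrow> x \<in> carrier G \<Longrightarrow> y \<in> carrier G \<Longrightarrow> \<bar>H x y - H' x y\<bar> \<le> e"
  shows "\<bar>J (\<lambda>x. k x * J (\<lambda>y. \<psi> y * H x y)) - J (\<lambda>x. k x * J (\<lambda>y. \<psi> y * H' x y))\<bar>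
           \<le> e * J (\<lambda>y. \<bar>\<psi> y\<bar>) * J (\<lambda>y. \<bar>k y\<bar>)"
proof (rule J_integral_close[OF k J_continuous_param[OF \<psi> H] J_continuous_param[OF \<psi> H'] K])
  fix x assume x: "x \<in> K" "x \<in> carrier G"
  show "\<bar>J (\<lambda>y. \<psi> y * H x y) - J (\<lambda>y. \<psi> y * H' x y)\<bar> \<le> e * J (\<lambda>y. \<bar>\<psi> y\<bar>)"
    using x HH[OF x(1) _ x(2)] L
    by (intro J_integral_close[where K=L] \<psi> continuous_map_slice[OF H] continuous_map_slice[OF H']) auto
qed auto

text \<open>For a finite sum of products of a function of \<open>x\<close> and a function of
  \<open>y\<close> the order of integration is exchanged by linearity. A partition of unity on the
  support of \<open>k\<close> approximates \<open>H\<close> by such a sum uniformly on the product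
  of the supports, so the two iterated integrals differ by an arbitrarily small multiple of a fixed
  number.\<close>

lemma J_Fubini:
  assumes k: "k \<in> Cc T" and \<psi>: "\<psi> \<in> Cc T"
    and H: "continuous_map (prod_topology T T) euclideanreal (\<lambda>p. H (fst p) (snd p))"
  shows "J (\<lambda>x. k x * J (\<lambda>y. \<psi> y * H x y)) = J (\<lambda>y. \<psi> y * J (\<lambda>x. k x * H x y))" (is "?l = ?r")
proof -
  obtain K where K: "compactin T K" "\<And>x. x \<in> carrier G \<Longrightarrow> x \<notin> K \<Longrightarrow> k x = 0"
    using Cc_support[OF k] by (metis topspace_eq)
  obtain L where L: "compactin T L" "\<And>x. x \<in> carrier G \<Longrightarrow> x \<notin> L \<Longrightarrow> \<psi> x = 0"
    using Cc_support[OF \<psi>] by (metis topspace_eq)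
  let ?P = "J (\<lambda>y. \<bar>\<psi> y\<bar>)" and ?Q = "J (\<lambda>y. \<bar>k y\<bar>)"
  have PQ: "0 \<le> ?P" "0 \<le> ?Q" using J_abs_nonneg k \<psi> by auto
  have approx: "\<bar>?l - ?r\<bar> \<le> e * (2 * ?P * ?Q)" if e: "e > 0" for e
  proof -
    have "\<exists>U. openin T U \<and> g \<in> U \<and> (\<forall>x\<in>U. \<forall>y\<in>L. \<bar>H x y - H g y\<bar> < e)" if g: "g \<in> K" for g
    proof -
      have "g \<in> topspace T" using compactin_carrier[OF K(1) g] by simp
      from tube_uniform[OF H L(1) this e] show ?thesis by (metis fst_conv snd_conv)
    qed
    then obtain U where U: "\<And>g. g \<in> K \<Longrightarrow> openin T (U g) \<and> g \<in> U g"
      "\<And>g x y. g \<in> K \<Longrightarrow> x \<in> U g \<Longrightarrow> y \<in> L \<Longrightarrow> \<bar>H x y - H g y\<bar> < e"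
      by metis
    from U(1) show ?thesis
    proof (rule finite_partition_of_unity[OF loc_compact Hausdorff K(1)])
      fix F and a :: "'a \<Rightarrow> 'a \<Rightarrow> real"
      assume F: "finite F" "F \<subseteq> K" and a: "\<And>x. x \<in> F \<Longrightarrow> a x \<in> Cc T" "\<And>x y. x \<in> F \<Longrightarrow> 0 \<le> a x y"
        "\<And>x y. x \<in> F \<Longrightarrow> y \<in> topspace T \<Longrightarrow> y \<notin> U x \<Longrightarrow> a x y = (0::real)" "\<And>y. y \<in> K \<Longrightarrow> (\<Sum>x\<in>F. a x y) = 1"
      have FG: "i \<in> topspace T" if "i \<in> F" for i using that F compactin_carrier[OF K(1)] by auto
      \<comment> \<open>\<open>H\<close> is replaced near each node \<open>i\<close> by its slice at
        \<open>i\<close>, which is within \<open>e\<close> of it on \<open>U i\<close> for every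
        \<open>y \<in> L\<close>.\<close>
      let ?H' = "\<lambda>x y. \<Sum>i\<in>F. a i x * H i y"
      have H': "continuous_map (prod_topology T T) euclideanreal (\<lambda>p. ?H' (fst p) (snd p))"
      proof (intro continuous_map_sum F continuous_map_real_mult)
        fix i assume i: "i \<in> F"
        show "continuous_map (prod_topology T T) euclideanreal (\<lambda>p. a i (fst p))"
          using continuous_map_compose[OF continuous_map_fst Cc_continuous[OF a(1)[OF i]]] by (simp add: o_def)
        show "continuous_map (prod_topology T T) euclideanreal (\<lambda>p. H i (snd p))"
          using continuous_map_compose[OF continuous_map_snd continuous_map_slice[OF H FG[OF i]]] by (simp add: o_def)
      qed
      have close: "\<bar>H x y - ?H' x y\<bar> \<le> e" if xy: "x \<in> K" "y \<in> L" for x y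
      proof -
        have "H x y - ?H' x y = (\<Sum>i\<in>F. a i x * (H x y - H i y))"
          using a(4)[OF xy(1)] by (simp add: right_diff_distrib sum_subtractf flip: sum_distrib_right)
        also have "\<bar>\<dots>\<bar> \<le> (\<Sum>i\<in>F. a i x * e)"
        proof (rule order_trans[OF sum_abs sum_mono])
          fix i assume i: "i \<in> F"
          show "\<bar>a i x * (H x y - H i y)\<bar> \<le> a i x * e"
          proof (cases "x \<in> U i")
            case True
            then have "\<bar>H x y - H i y\<bar> \<le> e" using U(2)[of i x y] i F xy by auto
            then show ?thesis using a(2)[OF i, of x] by (simp add: abs_mult mult_left_mono)
          next
            case False
            then show ?thesis using a(3)[OF i _ False] compactin_carrier[OF K(1) xy(1)] by simp
          qed
        qed
        also have "\<dots> = e" using a(4)[OF xy(1)] by (simp flip: sum_distrib_right)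
        finally show ?thesis .
      qed
      have ka: "(\<lambda>x. k x * a i x) \<in> Cc T" if "i \<in> F" for i
        using a(1)[OF that] k by (intro Cc_mult_right Cc_continuous) auto
      have \<psi>H: "(\<lambda>y. \<psi> y * H i y) \<in> Cc T" if "i \<in> F" for i
        using J_integrand[OF \<psi> H FG[OF that]] .
      have "J (\<lambda>x. k x * J (\<lambda>y. \<psi> y * ?H' x y)) = (\<Sum>i\<in>F. J (\<lambda>x. k x * a i x) * J (\<lambda>y. \<psi> y * H i y))"
      proof -
        have "J (\<lambda>y. \<psi> y * ?H' x y) = (\<Sum>i\<in>F. a i x * J (\<lambda>y. \<psi> y * H i y))" for x
        proof -
          have "(\<lambda>y. \<psi> y * ?H' x y) = (\<lambda>y. \<Sum>i\<in>F. a i x * (\<psi> y * H i y))"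
            by (simp add: sum_distrib_left mult_ac)
          then show ?thesis using F \<psi>H by (simp add: J_sum Cc_scale J_scale)
        qed
        then have "J (\<lambda>x. k x * J (\<lambda>y. \<psi> y * ?H' x y)) = J (\<lambda>x. \<Sum>i\<in>F. J (\<lambda>y. \<psi> y * H i y) * (k x * a i x))"
          by (simp add: sum_distrib_left mult_ac)
        also have "\<dots> = (\<Sum>i\<in>F. J (\<lambda>y. \<psi> y * H i y) * J (\<lambda>x. k x * a i x))"
          using F ka by (simp add: J_sum Cc_scale J_scale)
        finally show ?thesis by (simp add: mult.commute)
      qed
      moreover have "J (\<lambda>y. \<psi> y * J (\<lambda>x. k x * ?H' x y)) = (\<Sum>i\<in>F. J (\<lambda>x. k x * a i x) * J (\<lambda>y. \<psi> y * H i y))"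
      proof -
        have "J (\<lambda>x. k x * ?H' x y) = (\<Sum>i\<in>F. H i y * J (\<lambda>x. k x * a i x))" for y
        proof -
          have "(\<lambda>x. k x * ?H' x y) = (\<lambda>x. \<Sum>i\<in>F. H i y * (k x * a i x))"
            by (simp add: sum_distrib_left mult_ac)
          then show ?thesis using F ka by (simp add: J_sum Cc_scale J_scale)
        qed
        then have "J (\<lambda>y. \<psi> y * J (\<lambda>x. k x * ?H' x y)) = J (\<lambda>y. \<Sum>i\<in>F. J (\<lambda>x. k x * a i x) * (\<psi> y * H i y))"
          by (simp add: sum_distrib_left mult_ac)
        also have "\<dots> = (\<Sum>i\<in>F. J (\<lambda>x. k x * a i x) * J (\<lambda>y. \<psi> y * H i y))"
          using F \<psi>H by (simp add: J_sum Cc_scale J_scale)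
        finally show ?thesis .
      qed
      moreover have "\<bar>?l - J (\<lambda>x. k x * J (\<lambda>y. \<psi> y * ?H' x y))\<bar> \<le> e * ?P * ?Q"
        using close by (intro J_iterated_close[where K=K and L=L] k \<psi> H H' K(2) L(2)) auto
      moreover have "\<bar>?r - J (\<lambda>y. \<psi> y * J (\<lambda>x. k x * ?H' x y))\<bar> \<le> e * ?Q * ?P"
        using close by (intro J_iterated_close[where K=L and L=K, of \<psi> k "\<lambda>y x. H x y" "\<lambda>y x. ?H' x y"]
              continuous_map_swapped[OF H] continuous_map_swapped[OF H'] k \<psi> K(2) L(2)) auto
      ultimately show ?thesis by (simp add: algebra_simps)
    qed
  qed
  define X where "X = 2 * ?P * ?Q"
  have X: "0 \<le> X" using PQ by (simp add: X_def)
  have "\<bar>?l - ?r\<bar> \<le> 0 + e" if e: "e > 0" for e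
  proof -
    have "\<bar>?l - ?r\<bar> \<le> e / (X + 1) * X"
      using X e approx[of "e / (X + 1)"] unfolding X_def[symmetric] by simp
    also have "\<dots> \<le> e" using X e by (simp add: field_simps)
    finally show ?thesis by simp
  qed
  then have "\<bar>?l - ?r\<bar> \<le> 0" by (rule field_le_epsilon)
  then show ?thesis by simp
qed

end

section \<open>The invariant mean of a cocompact discrete subgroup\<close>

lemma (in group) mult_inv_cancel [simp]:
  assumes "g \<in> carrier G" "x \<in> carrier G"
  shows "inv g \<otimes> (g \<otimes> x) = x" "g \<otimes> (inv g \<otimes> x) = x"
  using assms by (simp_all flip: m_assoc)

text \<open>Cocompactness takes the form of a compact set meeting every orbit. Translates of
  \<open>C\<close> may overlap, since integration over the quotient goes through a cutoff function;
  in the application \<open>C\<close> is the closure of the fundamental domain.\<close>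

locale cocompact = lc_group +
  fixes Lam :: "'a set" and C :: "'a set"
  assumes Lam: "subgroup Lam G" and discrete: "subtopology T Lam = discrete_topology Lam"
    and C: "compactin T C" and Lam_C: "\<And>x. x \<in> carrier G \<Longrightarrow> \<exists>l\<in>Lam. l \<otimes> x \<in> C"
begin

lemma Lam_carrier [simp]: "l \<in> Lam \<Longrightarrow> l \<in> carrier G"
  using subgroup.subset[OF Lam] by blast

lemma ex_discrete_nbhd:
  obtains U where "openin T U" "\<one> \<in> U" "\<And>l. l \<in> Lam \<Longrightarrow> l \<in> U \<Longrightarrow> l = \<one>"
proof -
  have "openin (subtopology T Lam) {\<one>}"
    unfolding discrete using subgroup.one_closed[OF Lam] by simp
  then obtain U where "openin T U" "{\<one>} = U \<inter> Lam" unfolding openin_subtopology by blast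
  then show thesis by (intro that[of U]) auto
qed

text \<open>Such an \<open>l\<close> lies in the compact set \<open>K' K^-1\<close>. Finitely many
  translates \<open>k V\<close> cover it, and each contains at most one element of
  \<open>Lam\<close>, because \<open>V^-1 V\<close> lies in a neighbourhood that meets
  \<open>Lam\<close> only in 1.\<close>

lemma finite_returns:
  assumes K: "compactin T K" and K': "compactin T K'"
  shows "finite {l \<in> Lam. \<exists>x\<in>K. l \<otimes> x \<in> K'}" (is "finite ?S")
proof -
  obtain U where U: "openin T U" "\<one> \<in> U" "\<And>l. l \<in> Lam \<Longrightarrow> l \<in> U \<Longrightarrow> l = \<one>"
    using ex_discrete_nbhd by blast
  obtain V where V: "openin T V" "\<one> \<in> V" "\<And>x y. x \<in> V \<Longrightarrow> y \<in> V \<Longrightarrow> x \<otimes> inv y \<in> U \<and> inv x \<otimes> y \<in> U"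
    using nbhd_division[OF U(1,2)] by blast
  let ?R = "(\<lambda>(x, y). x \<otimes> y) ` (K' \<times> (\<lambda>x. inv x) ` K)"
  have R: "compactin T ?R" by (intro compactin_mult compactin_inv K K')
  let ?W = "\<lambda>k. {x \<in> topspace T. inv k \<otimes> x \<in> V}"
  have "openin T (?W k) \<and> k \<in> ?W k" if k: "k \<in> ?R" for k
  proof
    have kc: "k \<in> carrier G" using compactin_carrier[OF R k] .
    show "openin T (?W k)"
      using kc by (intro openin_continuous_map_preimage[OF continuous_map_const_mult V(1)]) auto
    show "k \<in> ?W k" using kc V by simp
  qed
  then obtain F where F: "finite F" "F \<subseteq> ?R" "?R \<subseteq> \<Union>(?W ` F)"
    by (rule compactin_finite_subcover[OF R])
  have SR: "l \<in> ?R" if l: "l \<in> ?S" for l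
  proof -
    obtain x where x: "x \<in> K" "l \<otimes> x \<in> K'" "l \<in> Lam" using l by blast
    then have "(l \<otimes> x) \<otimes> inv x \<in> ?R" by force
    then show ?thesis using x compactin_carrier[OF K] by (simp add: m_assoc)
  qed
  have "?S \<subseteq> (\<Union>k\<in>F. Lam \<inter> ?W k)"
  proof
    fix l assume l: "l \<in> ?S"
    then have "l \<in> Lam" "l \<in> ?R" using SR[OF l] by auto
    then show "l \<in> (\<Union>k\<in>F. Lam \<inter> ?W k)" using F(3) by blast
  qed
  moreover have "finite (Lam \<inter> ?W k)" if k: "k \<in> F" for k
  proof (cases "Lam \<inter> ?W k = {}")
    case False
    then obtain l where l: "l \<in> Lam" "inv k \<otimes> l \<in> V" by auto
    have kc: "k \<in> carrier G" using k F(2) compactin_carrier[OF R] by blast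
    have "l' = l" if l': "l' \<in> Lam" "inv k \<otimes> l' \<in> V" for l'
    proof -
      have "inv (inv k \<otimes> l) \<otimes> (inv k \<otimes> l') \<in> U" using V(3) l l' by blast
      moreover have "inv (inv k \<otimes> l) \<otimes> (inv k \<otimes> l') = inv l \<otimes> l'"
        using kc l l' by (simp add: inv_mult_group m_assoc)
      moreover have "inv l \<otimes> l' \<in> Lam"
        using l l' Lam by (simp add: subgroup.m_closed subgroup.m_inv_closed)
      ultimately have "inv l \<otimes> l' = \<one>" using U(3) by simp
      then show ?thesis using l l' by (metis Lam_carrier inv_closed inv_equality inv_inv)
    qed
    then have "Lam \<inter> ?W k \<subseteq> {l}" by auto
    then show ?thesis using finite_subset by blast
  qed simp
  ultimately show ?thesis using F(1) by (meson finite_UN_I finite_subset)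
qed

text \<open>The periodisation of \<open>h\<close> over \<open>Lam\<close>. Keeping only nonzero
  terms makes the index set finite for compactly supported \<open>h\<close>; a sum over an infinite
  \<open>Lam\<close> would be 0 by convention.\<close>

definition per :: "('a \<Rightarrow> real) \<Rightarrow> 'a \<Rightarrow> real" where
  "per h y = (\<Sum>l\<in>{l\<in>Lam. h (l \<otimes> y) \<noteq> 0}. h (l \<otimes> y))"

lemma per_eq:
  assumes "finite S" "S \<subseteq> Lam" "\<And>l. l \<in> Lam \<Longrightarrow> h (l \<otimes> y) \<noteq> 0 \<Longrightarrow> l \<in> S"
  shows "per h y = (\<Sum>l\<in>S. h (l \<otimes> y))"
  unfolding per_def using assms by (intro sum.mono_neutral_left) auto

lemma per_finite:
  assumes h: "h \<in> Cc T" and y: "y \<in> carrier G"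
  shows "finite {l\<in>Lam. h (l \<otimes> y) \<noteq> 0}"
proof -
  obtain K where K: "compactin T K" "\<And>x. x \<in> carrier G \<Longrightarrow> x \<notin> K \<Longrightarrow> h x = 0"
    using Cc_support[OF h] by (metis topspace_eq)
  have "compactin T {y}" using y by simp
  from finite_returns[OF this K(1)] show ?thesis
  proof (rule rev_finite_subset)
    show "{l \<in> Lam. h (l \<otimes> y) \<noteq> 0} \<subseteq> {l \<in> Lam. \<exists>x\<in>{y}. l \<otimes> x \<in> K}"
      using K(2) y by auto (meson Lam_carrier m_closed)
  qed
qed

lemma per_inv:
  assumes l0: "l0 \<in> Lam" and y: "y \<in> carrier G"
  shows "per h (l0 \<otimes> y) = per h y"
  unfolding per_def
proof (rule sum.reindex_bij_witness[of _ "\<lambda>l. l \<otimes> inv l0" "\<lambda>l. l \<otimes> l0"])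
  fix l assume "l \<in> {l \<in> Lam. h (l \<otimes> y) \<noteq> 0}"
  then show "l \<otimes> inv l0 \<otimes> l0 = l" "l \<otimes> inv l0 \<in> {l \<in> Lam. h (l \<otimes> (l0 \<otimes> y)) \<noteq> 0}"
    using l0 y Lam by (auto simp: m_assoc subgroup.m_closed subgroup.m_inv_closed)
next
  fix l assume "l \<in> {l \<in> Lam. h (l \<otimes> (l0 \<otimes> y)) \<noteq> 0}"
  then show "l \<otimes> l0 \<otimes> inv l0 = l" "l \<otimes> l0 \<in> {l \<in> Lam. h (l \<otimes> y) \<noteq> 0}"
    "h (l \<otimes> l0 \<otimes> y) = h (l \<otimes> (l0 \<otimes> y))"
    using l0 y Lam by (auto simp: m_assoc subgroup.m_closed)
qed

text \<open>On a neighbourhood inside a compact set one and the same finite set of translates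
  accounts for all nonzero terms, by \<open>finite_returns\<close>.\<close>

lemma per_continuous:
  assumes h: "h \<in> Cc T"
  shows "continuous_map T euclideanreal (per h)"
proof (rule continuous_map_real_locally)
  fix y0 and e :: real assume y0: "y0 \<in> topspace T" and e: "e > 0"
  obtain K where K: "compactin T K" "\<And>x. x \<in> carrier G \<Longrightarrow> x \<notin> K \<Longrightarrow> h x = 0"
    using Cc_support[OF h] by (metis topspace_eq)
  obtain W N where W: "openin T W" "compactin T N" "y0 \<in> W" "W \<subseteq> N"
    using loc_compact y0 unfolding locally_compact_space_def by blast
  define S where "S = {l \<in> Lam. \<exists>x\<in>N. l \<otimes> x \<in> K}"
  have S: "finite S" "S \<subseteq> Lam" using finite_returns[OF W(2) K(1)] by (auto simp: S_def)
  have eq: "per h y = (\<Sum>l\<in>S. h (l \<otimes> y))" if y: "y \<in> W" for y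
  proof (rule per_eq[OF S])
    fix l assume "l \<in> Lam" "h (l \<otimes> y) \<noteq> 0"
    moreover have "y \<in> carrier G" using W(1) y openin_carrier by blast
    ultimately show "l \<in> S" using K(2)[of "l \<otimes> y"] y W(4) unfolding S_def by auto
  qed
  let ?s = "\<lambda>y. \<Sum>l\<in>S. h (l \<otimes> y)"
  have "?s \<in> Cc T" using S h by (intro Cc_sum Cc_translate) auto
  then have "openin T {y \<in> topspace T. ?s y \<in> ball (?s y0) e}"
    by (intro openin_continuous_map_preimage[OF Cc_continuous]) auto
  then have "openin T (W \<inter> {y \<in> topspace T. ?s y \<in> ball (?s y0) e})"
    using W(1) by blast
  moreover have "\<bar>per h y - per h y0\<bar> \<le> e" if "y \<in> W \<inter> {y \<in> topspace T. ?s y \<in> ball (?s y0) e}" for y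
    using that eq[of y] eq[of y0] W(3) by (auto simp: dist_real_def)
  ultimately show "\<exists>U. openin T U \<and> y0 \<in> U \<and> (\<forall>y\<in>U. \<bar>per h y - per h y0\<bar> \<le> e)"
    using W(3) y0 e by (intro exI[of _ "W \<inter> {y \<in> topspace T. ?s y \<in> ball (?s y0) e}"]) auto
qed

text \<open>A function equal to 1 on \<open>C\<close> has periodisation at least 1 everywhere, since
  every orbit meets \<open>C\<close>; dividing by this invariant function normalises it. For
  \<open>Lam\<close>-invariant \<open>f\<close> the number
  \<open>J (\<lambda>y. \<psi> y * f y)\<close> then plays the part of the integral of
  \<open>f\<close> over the quotient.\<close>

lemma ex_cutoff:
  obtains \<psi> where "\<psi> \<in> Cc T" "\<And>y. y \<in> carrier G \<Longrightarrow> 0 \<le> \<psi> y" "\<And>y. y \<in> carrier G \<Longrightarrow> per \<psi> y = 1"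
proof -
  obtain h where h: "h \<in> Cc T" "\<And>y. 0 \<le> h y" "\<And>y. y \<in> C \<Longrightarrow> h y = 1"
    using Cc_dominating[OF loc_compact Hausdorff C] by metis
  have pos: "1 \<le> per h y" if y: "y \<in> carrier G" for y
  proof -
    obtain l where l: "l \<in> Lam" "l \<otimes> y \<in> C" using Lam_C[OF y] by blast
    then have "h (l \<otimes> y) \<le> per h y"
      unfolding per_def using h(3)[OF l(2)] h(2)
      by (intro member_le_sum per_finite[OF h(1) y]) auto
    then show ?thesis using h(3)[OF l(2)] by simp
  qed
  let ?\<psi> = "\<lambda>y. h y * (1 / per h y)"
  show thesis
  proof (rule that[of ?\<psi>])
    show "?\<psi> \<in> Cc T"
      using pos by (intro Cc_mult_right h continuous_map_real_divide per_continuous) force+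
    show "0 \<le> ?\<psi> y" if "y \<in> carrier G" for y using pos[OF that] h(2)[of y] by simp
    show "per ?\<psi> y = 1" if y: "y \<in> carrier G" for y
    proof -
      have "per ?\<psi> y = (\<Sum>l\<in>{l\<in>Lam. h (l \<otimes> y) \<noteq> 0}. ?\<psi> (l \<otimes> y))"
        using per_finite[OF h(1) y] by (intro per_eq) auto
      also have "\<dots> = (\<Sum>l\<in>{l\<in>Lam. h (l \<otimes> y) \<noteq> 0}. h (l \<otimes> y) / per h y)"
        using y by (intro sum.cong) (auto simp: per_inv)
      also have "\<dots> = per h y / per h y" by (simp add: per_def[of h y] flip: sum_divide_distrib)
      also have "\<dots> = 1" using pos[OF y] by simp
      finally show ?thesis .
    qed
  qed
qed

end

section \<open>Unfolding integrals over the quotient\<close>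

lemma (in top_group) Cc_inv:
  assumes "k \<in> Cc T"
  shows "(\<lambda>y. k (inv y)) \<in> Cc T"
proof -
  obtain K where K: "compactin T K" "\<And>x. x \<in> carrier G \<Longrightarrow> x \<notin> K \<Longrightarrow> k x = 0"
    using Cc_support[OF assms] by (metis topspace_eq)
  show ?thesis
  proof (rule CcI[OF _ compactin_inv[OF K(1)]])
    have "continuous_map T T (\<lambda>x. inv x)" using top_group unfolding topological_group_def by blast
    from continuous_map_compose[OF this Cc_continuous[OF assms]]
    show "continuous_map T euclideanreal (\<lambda>y. k (inv y))" by (simp add: o_def)
    fix x assume x: "x \<in> topspace T" "x \<notin> (\<lambda>x. inv x) ` K"
    show "k (inv x) = 0"
    proof (rule K(2))
      show "inv x \<notin> K" using x by (metis image_eqI inv_inv topspace_eq)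
    qed (use x in auto)
  qed
qed

text \<open>An unfolding argument using only left invariance. Fubini and the substitution
  \<open>g\<close> to \<open>inv y \<otimes> g\<close> turn the left side into
  \<open>J (f h)\<close>. Inserting \<open>per \<psi> = 1\<close> and shifting each term by
  \<open>l\<close> moves the sum over \<open>Lam\<close> onto \<open>h\<close>. Another shift inside
  \<open>h\<close> produces \<open>per \<psi>\<close> in the inner variable, again 1, and the
  remaining inner integral is that of \<open>k\<close> composed with inversion.\<close>

lemma (in haar) cocompact_integral:
  assumes "cocompact G T Lam C"
    and \<psi>: "\<psi> \<in> Cc T" and per1: "\<And>y. y \<in> carrier G \<Longrightarrow> cocompact.per G Lam \<psi> y = 1"
    and f: "continuous_map T euclideanreal f" and finv: "\<And>l y. l \<in> Lam \<Longrightarrow> y \<in> carrier G \<Longrightarrow> f (l \<otimes> y) = f y"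
    and k: "k \<in> Cc T"
  shows "J (\<lambda>g. k g * J (\<lambda>y. \<psi> y * f (y \<otimes> g))) = J (\<lambda>y. \<psi> y * f y) * J (\<lambda>y. k (inv y))"
proof -
  interpret cocompact G T Lam C by fact
  obtain K where K: "compactin T K" "\<And>x. x \<in> carrier G \<Longrightarrow> x \<notin> K \<Longrightarrow> k x = 0"
    using Cc_support[OF k] by (metis topspace_eq)
  obtain L where L: "compactin T L" "\<And>x. x \<in> carrier G \<Longrightarrow> x \<notin> L \<Longrightarrow> \<psi> x = 0"
    using Cc_support[OF \<psi>] by (metis topspace_eq)
  \<comment> \<open>\<open>?R\<close> contains each \<open>g\<close> with
    \<open>k (inv y \<otimes> g)\<close> nonzero for some \<open>y \<in> L\<close>;
    \<open>?R'\<close> contains each \<open>y\<close> with this value nonzero for some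
    \<open>g \<in> L\<close>. They control the supports in the two shifts.\<close>
  let ?R = "(\<lambda>(x, y). x \<otimes> y) ` (L \<times> K)"
  let ?R' = "(\<lambda>(x, y). x \<otimes> y) ` (L \<times> (\<lambda>x. inv x) ` K)"
  have R: "compactin T ?R" "compactin T ?R'" by (intro compactin_mult compactin_inv K L)+
  have kR: "k (inv y \<otimes> g) = 0" if "y \<in> L" "g \<in> carrier G" "g \<notin> ?R" for y g
  proof -
    have yc: "y \<in> carrier G" using compactin_carrier[OF L(1) that(1)] .
    have "inv y \<otimes> g \<notin> K"
    proof
      assume "inv y \<otimes> g \<in> K"
      then have "y \<otimes> (inv y \<otimes> g) \<in> ?R" using that(1) by force
      then show False using that yc by (simp flip: m_assoc)
    qed
    then show ?thesis using K(2) yc that by simp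
  qed
  have kR': "k (inv y \<otimes> g) = 0" if "g \<in> L" "y \<in> carrier G" "y \<notin> ?R'" for y g
  proof -
    have gc: "g \<in> carrier G" using compactin_carrier[OF L(1) that(1)] .
    have "inv y \<otimes> g \<notin> K"
    proof
      assume "inv y \<otimes> g \<in> K"
      then have "g \<otimes> inv (inv y \<otimes> g) \<in> ?R'" using that(1) by force
      then show False using that gc by (simp add: inv_mult_group flip: m_assoc)
    qed
    then show ?thesis using K(2) gc that by simp
  qed
  \<comment> \<open>\<open>f\<close> is invariant and so in general not compactly supported. The
    factor \<xi> puts \<open>\<xi> f\<close> into \<open>Cc T\<close> without changing
    \<open>f h\<close>, since \<open>h\<close> vanishes off \<open>?R\<close>.\<close>
  obtain \<xi> where \<xi>: "\<xi> \<in> Cc T" "\<And>y. 0 \<le> \<xi> y" "\<And>y. y \<in> ?R \<Longrightarrow> \<xi> y = 1"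
    using Cc_dominating[OF loc_compact Hausdorff R(1)] by metis
  \<comment> \<open>One finite index set for two periodisations: it contains every \<open>l\<close>
    with \<open>\<psi> (l \<otimes> g)\<close> nonzero for some \<open>g \<in> ?R\<close>, and its
    inverses contain every \<open>l\<close> with \<open>\<psi> (l \<otimes> y)\<close> nonzero for
    some \<open>y \<in> ?R'\<close>.\<close>
  define S where "S = {l \<in> Lam. \<exists>x\<in>?R. l \<otimes> x \<in> L} \<union> (\<lambda>l. inv l) ` {l \<in> Lam. \<exists>x\<in>?R'. l \<otimes> x \<in> L}"
  have Sfin: "finite S" unfolding S_def using finite_returns[OF R(1) L(1)] finite_returns[OF R(2) L(1)] by simp
  have SL: "S \<subseteq> Lam" unfolding S_def using Lam by (auto intro: subgroup.m_inv_closed)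
  have SG: "l \<in> carrier G" if "l \<in> S" for l using that SL by auto

  have cH1: "continuous_map (prod_topology T T) euclideanreal (\<lambda>p. f (snd p \<otimes> fst p))"
  proof -
    have "continuous_map (prod_topology T T) T (\<lambda>p. snd p \<otimes> fst p)" by (intro continuous_intros)
    from continuous_map_compose[OF this f] show ?thesis by (simp add: o_def)
  qed
  have cH2: "continuous_map (prod_topology T T) euclideanreal (\<lambda>p. k (inv (snd p) \<otimes> fst p))"
  proof -
    have "continuous_map (prod_topology T T) T (\<lambda>p. inv (snd p) \<otimes> fst p)" by (intro continuous_intros)
    from continuous_map_compose[OF this Cc_continuous[OF k]] show ?thesis by (simp add: o_def)
  qed
  define h where "h g = J (\<lambda>y. \<psi> y * k (inv y \<otimes> g))" for g
  have hcont: "continuous_map T euclideanreal h"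
    unfolding h_def using J_continuous_param[OF \<psi>, of T "\<lambda>g y. k (inv y \<otimes> g)"] cH2 by simp
  have \<psi>k: "(\<lambda>y. \<psi> y * k (inv y \<otimes> g)) \<in> Cc T" if "g \<in> carrier G" for g
    using J_integrand[OF \<psi>, of T "\<lambda>g y. k (inv y \<otimes> g)"] cH2 that by simp
  have h0: "h g = 0" if "g \<in> carrier G" "g \<notin> ?R" for g
  proof -
    have "J (\<lambda>y. \<psi> y * k (inv y \<otimes> g)) = J (\<lambda>y. 0)"
    proof (rule J_cong[OF \<psi>k[OF that(1)] Cc_zero])
      fix y assume "y \<in> carrier G"
      then show "\<psi> y * k (inv y \<otimes> g) = 0" using L(2) kR[OF _ that] that by (cases "y \<in> L") auto
    qed
    then show ?thesis by (simp add: h_def J_zero)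
  qed
  have \<xi>f: "(\<lambda>g. \<xi> g * f g) \<in> Cc T" using \<xi> f by (intro Cc_mult_right) auto
  define u where "u g = \<xi> g * f g * h g" for g
  have uC: "u \<in> Cc T" unfolding u_def using \<xi>f hcont by (rule Cc_mult_right)
  have u_eq: "u g = f g * h g" if "g \<in> carrier G" for g
    using \<xi>(3)[of g] h0[OF that] by (cases "g \<in> ?R") (auto simp: u_def)

  have "J (\<lambda>g. k g * J (\<lambda>y. \<psi> y * f (y \<otimes> g))) = J (\<lambda>y. \<psi> y * J (\<lambda>g. k g * f (y \<otimes> g)))"
    using J_Fubini[OF k \<psi>, of "\<lambda>g y. f (y \<otimes> g)"] cH1 by simp
  also have "\<dots> = J (\<lambda>y. \<psi> y * J (\<lambda>g. (\<xi> g * f g) * k (inv y \<otimes> g)))"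
  proof (rule J_cong)
    show "(\<lambda>y. \<psi> y * J (\<lambda>g. k g * f (y \<otimes> g))) \<in> Cc T"
      using J_continuous_param[OF k, of T "\<lambda>y g. f (y \<otimes> g)"] continuous_map_swapped[of T T _ "\<lambda>g y. f (y \<otimes> g)"] cH1
      by (intro Cc_mult_right \<psi>) simp
    show "(\<lambda>y. \<psi> y * J (\<lambda>g. \<xi> g * f g * k (inv y \<otimes> g))) \<in> Cc T"
      using J_continuous_param[OF \<xi>f, of T "\<lambda>y g. k (inv y \<otimes> g)"] continuous_map_swapped[of T T _ "\<lambda>g y. k (inv y \<otimes> g)"] cH2
      by (intro Cc_mult_right \<psi>) simp
    fix y assume y: "y \<in> carrier G"
    show "\<psi> y * J (\<lambda>g. k g * f (y \<otimes> g)) = \<psi> y * J (\<lambda>g. \<xi> g * f g * k (inv y \<otimes> g))"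
    proof (cases "y \<in> L")
      case True
      have 1: "(\<lambda>g. k g * f (y \<otimes> g)) \<in> Cc T"
        using continuous_map_compose[OF continuous_map_const_mult[OF y] f]
        by (intro Cc_mult_right k) (simp add: o_def)
      have "J (\<lambda>g. k g * f (y \<otimes> g)) = J (\<lambda>g. k (inv y \<otimes> g) * f (y \<otimes> (inv y \<otimes> g)))"
        using J_translate[OF 1, of "inv y"] y by simp
      also have "\<dots> = J (\<lambda>g. \<xi> g * f g * k (inv y \<otimes> g))"
      proof (rule J_cong)
        show "(\<lambda>g. k (inv y \<otimes> g) * f (y \<otimes> (inv y \<otimes> g))) \<in> Cc T"
          using Cc_translate[OF 1, of "inv y"] y by simp
        show "(\<lambda>g. \<xi> g * f g * k (inv y \<otimes> g)) \<in> Cc T"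
          using y by (intro Cc_mult_right[OF \<xi>f] Cc_continuous Cc_translate k) auto
        fix g assume g: "g \<in> carrier G"
        show "k (inv y \<otimes> g) * f (y \<otimes> (inv y \<otimes> g)) = \<xi> g * f g * k (inv y \<otimes> g)"
          using kR[OF True g] \<xi>(3)[of g] g y by (cases "g \<in> ?R") (auto simp flip: m_assoc)
      qed
      finally show ?thesis by simp
    qed (use L(2) y in simp)
  qed
  also have "\<dots> = J (\<lambda>g. (\<xi> g * f g) * h g)"
    unfolding h_def using J_Fubini[OF \<xi>f \<psi>, of "\<lambda>g y. k (inv y \<otimes> g)"] cH2 by simp
  also have "\<dots> = J u" by (intro arg_cong[where f=J] ext) (simp add: u_def)
  also have "\<dots> = J (\<lambda>g. \<Sum>l\<in>S. u g * \<psi> (l \<otimes> g))"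
  proof (rule J_cong[OF uC])
    show "(\<lambda>g. \<Sum>l\<in>S. u g * \<psi> (l \<otimes> g)) \<in> Cc T"
      using SG by (intro Cc_sum Sfin Cc_mult_right uC Cc_continuous Cc_translate \<psi>)
    fix g assume g: "g \<in> carrier G"
    show "u g = (\<Sum>l\<in>S. u g * \<psi> (l \<otimes> g))"
    proof (cases "g \<in> ?R")
      case True
      have "per \<psi> g = (\<Sum>l\<in>S. \<psi> (l \<otimes> g))"
      proof (rule per_eq[OF Sfin SL])
        fix l assume "l \<in> Lam" "\<psi> (l \<otimes> g) \<noteq> 0"
        then show "l \<in> S" using L(2)[of "l \<otimes> g"] g True unfolding S_def by auto
      qed
      then show ?thesis using per1[OF g] by (simp flip: sum_distrib_left)
    qed (use u_eq h0 g in simp)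
  qed
  also have "\<dots> = (\<Sum>l\<in>S. J (\<lambda>g. u g * \<psi> (l \<otimes> g)))"
    using SG by (intro J_sum Sfin Cc_mult_right uC Cc_continuous Cc_translate \<psi>)
  also have "\<dots> = (\<Sum>l\<in>S. J (\<lambda>g. \<psi> g * u (inv l \<otimes> g)))"
  proof (rule sum.cong[OF refl])
    fix l assume l: "l \<in> S"
    have 1: "(\<lambda>g. u g * \<psi> (l \<otimes> g)) \<in> Cc T"
      using SG[OF l] by (intro Cc_mult_right uC Cc_continuous Cc_translate \<psi>)
    have "J (\<lambda>g. u g * \<psi> (l \<otimes> g)) = J (\<lambda>g. u (inv l \<otimes> g) * \<psi> (l \<otimes> (inv l \<otimes> g)))"
      using J_translate[OF 1, of "inv l"] SG[OF l] by simp
    also have "\<dots> = J (\<lambda>g. \<psi> g * u (inv l \<otimes> g))"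
      using SG[OF l] Cc_translate[OF 1, of "inv l"] 
      by (intro J_cong Cc_mult_right \<psi> Cc_continuous Cc_translate uC) (auto simp flip: m_assoc)
    finally show "J (\<lambda>g. u g * \<psi> (l \<otimes> g)) = J (\<lambda>g. \<psi> g * u (inv l \<otimes> g))" .
  qed
  also have "\<dots> = J (\<lambda>g. \<Sum>l\<in>S. \<psi> g * u (inv l \<otimes> g))"
    using SG by (intro J_sum[symmetric] Sfin Cc_mult_right \<psi> Cc_continuous Cc_translate uC) auto
  also have "\<dots> = J (\<lambda>g. J (\<lambda>y. k (inv y)) * (\<psi> g * f g))"
  proof (rule J_cong)
    show "(\<lambda>g. \<Sum>l\<in>S. \<psi> g * u (inv l \<otimes> g)) \<in> Cc T"
      using SG by (intro Cc_sum Sfin Cc_mult_right \<psi> Cc_continuous Cc_translate uC) auto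
    show "(\<lambda>g. J (\<lambda>y. k (inv y)) * (\<psi> g * f g)) \<in> Cc T"
      by (intro Cc_scale Cc_mult_right \<psi> f)
    fix g assume g: "g \<in> carrier G"
    show "(\<Sum>l\<in>S. \<psi> g * u (inv l \<otimes> g)) = J (\<lambda>y. k (inv y)) * (\<psi> g * f g)"
    proof (cases "g \<in> L")
      case True
      have kg: "(\<lambda>y. k (inv y \<otimes> g)) \<in> Cc T"
      proof (rule CcI[OF _ R(2)])
        have "continuous_map T T (\<lambda>y. inv y \<otimes> g)" using g by (intro continuous_intros) auto
        from continuous_map_compose[OF this Cc_continuous[OF k]]
        show "continuous_map T euclideanreal (\<lambda>y. k (inv y \<otimes> g))" by (simp add: o_def)
      qed (use kR'[OF True] in auto)
      have hl: "h (inv l \<otimes> g) = J (\<lambda>y. k (inv y \<otimes> g) * \<psi> (inv l \<otimes> y))" if l: "l \<in> S" for l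
      proof -
        have lc: "l \<in> carrier G" using SG[OF l] .
        have 1: "(\<lambda>y. \<psi> y * k (inv y \<otimes> (inv l \<otimes> g))) \<in> Cc T" using \<psi>k lc g by simp
        have "h (inv l \<otimes> g) = J (\<lambda>y. \<psi> (inv l \<otimes> y) * k (inv (inv l \<otimes> y) \<otimes> (inv l \<otimes> g)))"
          unfolding h_def using J_translate[OF 1, of "inv l"] lc by simp
        also have "\<dots> = J (\<lambda>y. k (inv y \<otimes> g) * \<psi> (inv l \<otimes> y))"
        proof (rule J_cong)
          show "(\<lambda>y. \<psi> (inv l \<otimes> y) * k (inv (inv l \<otimes> y) \<otimes> (inv l \<otimes> g))) \<in> Cc T"
            using Cc_translate[OF 1, of "inv l"] lc by simp
          show "(\<lambda>y. k (inv y \<otimes> g) * \<psi> (inv l \<otimes> y)) \<in> Cc T"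
            using lc by (intro Cc_mult_right kg Cc_continuous Cc_translate \<psi>) auto
          fix y assume y: "y \<in> carrier G"
          have "inv (inv l \<otimes> y) \<otimes> (inv l \<otimes> g) = inv y \<otimes> (l \<otimes> inv l) \<otimes> g"
            using y lc g by (simp only: inv_mult_group inv_inv m_assoc m_closed inv_closed)
          also have "\<dots> = inv y \<otimes> g" using y lc g by simp
          finally show "\<psi> (inv l \<otimes> y) * k (inv (inv l \<otimes> y) \<otimes> (inv l \<otimes> g)) = k (inv y \<otimes> g) * \<psi> (inv l \<otimes> y)"
            by simp
        qed
        finally show ?thesis .
      qed
      have ul: "u (inv l \<otimes> g) = f g * h (inv l \<otimes> g)" if l: "l \<in> S" for l
      proof -
        have "inv l \<in> Lam" using l SL Lam by (auto intro: subgroup.m_inv_closed)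
        then show ?thesis using u_eq[of "inv l \<otimes> g"] finv[of "inv l" g] SG[OF l] g by simp
      qed
      have "(\<Sum>l\<in>S. h (inv l \<otimes> g)) = (\<Sum>l\<in>S. J (\<lambda>y. k (inv y \<otimes> g) * \<psi> (inv l \<otimes> y)))"
        using hl by simp
      also have "\<dots> = J (\<lambda>y. \<Sum>l\<in>S. k (inv y \<otimes> g) * \<psi> (inv l \<otimes> y))"
        using SG by (intro J_sum[symmetric] Sfin Cc_mult_right kg Cc_continuous Cc_translate \<psi>) auto
      also have "\<dots> = J (\<lambda>y. k (inv y \<otimes> g))"
      proof (rule J_cong[OF _ kg])
        show "(\<lambda>y. \<Sum>l\<in>S. k (inv y \<otimes> g) * \<psi> (inv l \<otimes> y)) \<in> Cc T"
          using SG by (intro Cc_sum Sfin Cc_mult_right kg Cc_continuous Cc_translate \<psi>) auto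
        fix y assume y: "y \<in> carrier G"
        show "(\<Sum>l\<in>S. k (inv y \<otimes> g) * \<psi> (inv l \<otimes> y)) = k (inv y \<otimes> g)"
        proof (cases "y \<in> ?R'")
          case yR: True
          have "per \<psi> y = (\<Sum>l\<in>(\<lambda>l. inv l) ` S. \<psi> (l \<otimes> y))"
          proof (rule per_eq)
            show "finite ((\<lambda>l. inv l) ` S)" using Sfin by simp
            show "(\<lambda>l. inv l) ` S \<subseteq> Lam" using SL Lam by (auto intro: subgroup.m_inv_closed)
            fix l assume l: "l \<in> Lam" "\<psi> (l \<otimes> y) \<noteq> 0"
            then have "l \<otimes> y \<in> L" using L(2)[of "l \<otimes> y"] y by auto
            then have "inv l \<in> S" using l yR unfolding S_def by blast
            then have "inv (inv l) \<in> (\<lambda>l. inv l) ` S" by (rule imageI)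
            then show "l \<in> (\<lambda>l. inv l) ` S" using l by simp
          qed
          also have "\<dots> = (\<Sum>l\<in>S. \<psi> (inv l \<otimes> y))"
          proof (subst sum.reindex)
            show "inj_on (\<lambda>l. inv l) S"
              by (rule inj_onI) (metis SG inv_inv)
          qed simp
          finally show ?thesis using per1[OF y] by (simp flip: sum_distrib_left)
        qed (use kR'[OF True y] in simp)
      qed
      also have "\<dots> = J (\<lambda>y. k (inv (inv g \<otimes> y)))"
        using g Cc_translate[OF Cc_inv[OF k], of "inv g"]
        by (intro J_cong[OF kg]) (auto simp: inv_mult_group)
      also have "\<dots> = J (\<lambda>y. k (inv y))" using J_translate[OF Cc_inv[OF k], of "inv g"] g by simp
      finally have "(\<Sum>l\<in>S. h (inv l \<otimes> g)) = J (\<lambda>y. k (inv y))" .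
      moreover have "(\<Sum>l\<in>S. \<psi> g * u (inv l \<otimes> g)) = \<psi> g * f g * (\<Sum>l\<in>S. h (inv l \<otimes> g))"
        using ul by (simp add: sum_distrib_left mult.assoc)
      ultimately show ?thesis by simp
    qed (use L(2) g in simp)
  qed
  also have "\<dots> = J (\<lambda>y. k (inv y)) * J (\<lambda>g. \<psi> g * f g)"
    by (intro J_scale Cc_mult_right \<psi> f)
  finally show ?thesis by simp
qed

text \<open>The function \<open>1\<close> in the previous identity shows that \<open>J\<close> is invariant under inversion;
  then the identity says that \<open>g \<mapsto> J (\<psi> f(\<cdot> g))\<close> has the same integrals as a constant.\<close>

lemma (in haar) cocompact_mean_invariant:
  assumes cc: "cocompact G T Lam C"
    and \<psi>: "\<psi> \<in> Cc T" and per1: "\<And>y. y \<in> carrier G \<Longrightarrow> cocompact.per G Lam \<psi> y = 1"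
    and pos: "0 < J \<psi>"
    and f: "continuous_map T euclideanreal f" and finv: "\<And>l y. l \<in> Lam \<Longrightarrow> y \<in> carrier G \<Longrightarrow> f (l \<otimes> y) = f y"
    and g: "g \<in> carrier G"
  shows "J (\<lambda>y. \<psi> y * f (y \<otimes> g)) = J (\<lambda>y. \<psi> y * f y)"
proof -
  have Jinv: "J k = J (\<lambda>y. k (inv y))" if k: "k \<in> Cc T" for k
    using cocompact_integral[OF cc \<psi> per1 _ _ k, of "\<lambda>_. 1"] pos J_scale[OF k, of "J \<psi>"]
    by (simp add: mult.commute)
  define a where "a g = J (\<lambda>y. \<psi> y * f (y \<otimes> g)) - J (\<lambda>y. \<psi> y * f y)" for g
  have ac: "continuous_map T euclideanreal (\<lambda>g. J (\<lambda>y. \<psi> y * f (y \<otimes> g)))"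
  proof -
    have "continuous_map (prod_topology T T) T (\<lambda>p. snd p \<otimes> fst p)" by (intro continuous_intros)
    from continuous_map_compose[OF this f] show ?thesis
      using J_continuous_param[OF \<psi>, of T "\<lambda>g y. f (y \<otimes> g)"] by (simp add: o_def)
  qed
  have ac': "continuous_map T euclideanreal a"
    unfolding a_def by (intro continuous_map_diff ac) auto
  have ka: "J (\<lambda>g. k g * a g) = 0" if k: "k \<in> Cc T" for k
  proof -
    have "J (\<lambda>g. k g * a g) = J (\<lambda>g. k g * J (\<lambda>y. \<psi> y * f (y \<otimes> g)) - J (\<lambda>y. \<psi> y * f y) * k g)"
      by (simp add: a_def algebra_simps)
    also have "\<dots> = J (\<lambda>g. k g * J (\<lambda>y. \<psi> y * f (y \<otimes> g))) - J (\<lambda>g. J (\<lambda>y. \<psi> y * f y) * k g)"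
      by (intro J_diff Cc_mult_right k ac Cc_scale)
    also have "\<dots> = 0"
      using cocompact_integral[OF cc \<psi> per1 f finv k] J_scale[OF k] Jinv[OF k] by simp
    finally show ?thesis .
  qed
  \<comment> \<open>Testing \<open>a\<close> against \<open>b * a\<close>, with \<open>b\<close> a
    bump at \<open>g\<close>, gives \<open>J\<close> of the nonnegative function
    \<open>b * a * a\<close>, which is 0. Strict positivity of \<open>J\<close> then forces
    \<open>a g = 0\<close>.\<close>
  obtain b where b: "b \<in> Cc T" "\<And>y. 0 \<le> b y" "\<And>y. b y \<le> 1" "b g = 1"
    using bump[OF loc_compact Hausdorff openin_topspace, of g] g by auto
  have ba: "(\<lambda>x. b x * a x) \<in> Cc T" by (intro Cc_mult_right b ac')
  have "a g = 0"
  proof (rule ccontr)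
    assume "a g \<noteq> 0"
    then have "0 < J (\<lambda>x. (b x * a x) * a x)"
      using b(2,4) g by (intro J_pos[of _ g] Cc_mult_right[OF ba ac']) (auto simp: mult.assoc zero_less_mult_iff)
    then show False using ka[OF ba] by simp
  qed
  then show ?thesis by (simp add: a_def)
qed

section \<open>Equivariant local sections\<close>

text \<open>A finite form of Baire's theorem: two closed sets with empty interior have a union with
  empty interior.\<close>

lemma interior_of_finite_Union_closed:
  assumes "finite F" "\<And>A. A \<in> F \<Longrightarrow> closedin X A" "X interior_of (\<Union>F) \<noteq> {}"
  shows "\<exists>A\<in>F. X interior_of A \<noteq> {}"
  using assms
proof (induction F rule: finite_induct)
  case (insert A F)
  then show ?case using interior_of_union_eq_empty[of X A "\<Union>F"] by auto
qed simp

locale group_extension = Gh: top_group Gh TGh + Q: cocompact Q TQ Lam C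
  for Gh :: "('g, 'm) monoid_scheme" and TGh :: "'g topology"
    and Q :: "('q, 'n) monoid_scheme" and TQ :: "'q topology" and Lam C :: "'q set" +
  fixes q :: "'g \<Rightarrow> 'q" and s1 :: "'q \<Rightarrow> 'g"
  assumes q_hom: "q \<in> hom Gh Q" and q_cont: "continuous_map TGh TQ q"
    and q_surj: "q ` carrier Gh = carrier Q"
    and s1_hom: "s1 \<in> hom (Q\<lparr>carrier := Lam\<rparr>) Gh"
    and s1_sec: "\<And>l. l \<in> Lam \<Longrightarrow> q (s1 l) = l"
begin

sublocale group_hom Gh Q q
  using q_hom by unfold_locales

lemma s1_closed [simp]: "l \<in> Lam \<Longrightarrow> s1 l \<in> carrier Gh"
  using s1_hom by (auto simp: hom_def)

lemma s1_mult: "l \<in> Lam \<Longrightarrow> l' \<in> Lam \<Longrightarrow> s1 (l \<otimes>\<^bsub>Q\<^esub> l') = s1 l \<otimes>\<^bsub>Gh\<^esub> s1 l'"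
  using s1_hom by (auto simp: hom_def)

lemma Lam_inv [simp]: "l \<in> Lam \<Longrightarrow> inv\<^bsub>Q\<^esub> l \<in> Lam"
  using Q.Lam by (rule subgroup.m_inv_closed)

lemma Lam_mult [simp]: "l \<in> Lam \<Longrightarrow> l' \<in> Lam \<Longrightarrow> l \<otimes>\<^bsub>Q\<^esub> l' \<in> Lam"
  using Q.Lam by (rule subgroup.m_closed)

lemma Lam_one [simp]: "\<one>\<^bsub>Q\<^esub> \<in> Lam"
  using Q.Lam by (rule subgroup.one_closed)

definition local_section :: "'q set \<Rightarrow> ('q \<Rightarrow> 'g) \<Rightarrow> bool" where
  "local_section V \<sigma> \<longleftrightarrow> openin TQ V \<and> continuous_map (subtopology TQ V) TGh \<sigma> \<and> (\<forall>v\<in>V. q (\<sigma> v) = v)"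

lemma local_section_closed: "local_section V \<sigma> \<Longrightarrow> v \<in> V \<Longrightarrow> \<sigma> v \<in> carrier Gh"
  unfolding local_section_def continuous_map_def using openin_subset[of TQ V] by auto

text \<open>For \<open>v0 \<in> V\<close> choose \<open>g0\<close> over
  \<open>inv v0 \<otimes> y0\<close>. Right translation by \<open>q g0\<close> moves
  \<open>v0\<close> to \<open>y0\<close>, and multiplying the section by \<open>g0\<close> on the
  right lifts it. Thus a section over one nonempty open set yields sections near every
  point.\<close>

lemma local_section_translate:
  assumes \<sigma>: "local_section V \<sigma>" "V \<noteq> {}" and y0: "y0 \<in> carrier Q"
  obtains W \<tau> where "local_section W \<tau>" "y0 \<in> W"
proof -
  obtain v0 where v0: "v0 \<in> V" using \<sigma> by blast
  have V: "openin TQ V" using \<sigma> unfolding local_section_def by blast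
  have v0Q: "v0 \<in> carrier Q" using v0 V Q.openin_carrier by blast
  then have "inv\<^bsub>Q\<^esub> v0 \<otimes>\<^bsub>Q\<^esub> y0 \<in> q ` carrier Gh" using q_surj y0 by simp
  then obtain g0 where g0: "g0 \<in> carrier Gh" "q g0 = inv\<^bsub>Q\<^esub> v0 \<otimes>\<^bsub>Q\<^esub> y0" by force
  let ?t = "\<lambda>x. x \<otimes>\<^bsub>Q\<^esub> inv\<^bsub>Q\<^esub> (q g0)"
  have t: "continuous_map TQ TQ ?t" using g0(1) by (intro Q.continuous_map_mult_const) auto
  let ?W = "{x \<in> topspace TQ. ?t x \<in> V}"
  let ?\<tau> = "\<lambda>x. \<sigma> (?t x) \<otimes>\<^bsub>Gh\<^esub> g0"
  have "openin TQ ?W" using t V by (rule openin_continuous_map_preimage)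
  moreover have "continuous_map (subtopology TQ ?W) TGh ?\<tau>"
  proof (intro Gh.continuous_map_mult)
    have "continuous_map (subtopology TQ ?W) (subtopology TQ V) ?t"
      by (intro continuous_map_into_subtopology continuous_map_from_subtopology[OF t]) auto
    from continuous_map_compose[OF this, of TGh \<sigma>]
    show "continuous_map (subtopology TQ ?W) TGh (\<lambda>x. \<sigma> (?t x))"
      using \<sigma> unfolding local_section_def by (simp add: o_def)
  qed (use g0 in auto)
  moreover have "q (?\<tau> x) = x" if x: "x \<in> ?W" for x
  proof -
    have "q (?\<tau> x) = q (\<sigma> (?t x)) \<otimes>\<^bsub>Q\<^esub> q g0" using x g0(1) local_section_closed[OF \<sigma>(1)] by simp
    also have "\<dots> = ?t x \<otimes>\<^bsub>Q\<^esub> q g0" using x \<sigma>(1) unfolding local_section_def by simp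
    also have "\<dots> = x" using x g0(1) by (simp add: Q.m_assoc)
    finally show ?thesis .
  qed
  ultimately have "local_section ?W ?\<tau>" unfolding local_section_def by blast
  moreover have "?t y0 = v0"
    unfolding g0(2) using y0 v0Q by (simp add: Q.inv_mult_group flip: Q.m_assoc)
  then have "y0 \<in> ?W" using y0 v0 by simp
  ultimately show thesis by (rule that)
qed

text \<open>The closed set \<open>D\<close> between the support of \<rho> and \<open>U\<close> lets
  a product of \<rho> with something continuous only on \<open>U\<close> be extended by 0. The data
  form one triple so that a single choice function selects them.\<close>

definition equivariant_piece :: "('q \<Rightarrow> real) \<times> 'q set \<times> ('q \<Rightarrow> 'g) \<Rightarrow> bool" where
  "equivariant_piece = (\<lambda>(\<rho>, U, s). local_section U s \<and> continuous_map TQ euclideanreal \<rho> \<and> (\<forall>y. 0 \<le> \<rho> y) \<and>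
     (\<exists>D. closedin TQ D \<and> D \<subseteq> U \<and> (\<forall>y\<in>carrier Q - D. \<rho> y = 0)) \<and>
     (\<forall>l\<in>Lam. \<forall>y\<in>carrier Q. \<rho> (l \<otimes>\<^bsub>Q\<^esub> y) = \<rho> y) \<and>
     (\<forall>l\<in>Lam. \<forall>y\<in>U. l \<otimes>\<^bsub>Q\<^esub> y \<in> U \<and> s (l \<otimes>\<^bsub>Q\<^esub> y) = s1 l \<otimes>\<^bsub>Gh\<^esub> s y))"

text \<open>A neighbourhood \<open>V'\<close> of \<open>y0\<close> with disjoint
  \<open>Lam\<close>-translates allows the section to be copied to each translate:
  \<open>s y\<close> is \<open>s1 (inv l)\<close> times \<sigma> at \<open>l \<otimes> y\<close>,
  for the only \<open>l\<close> that carries \<open>y\<close> into \<open>V'\<close>. Uniqueness of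
  \<open>l\<close> makes the copies compatible, and multiplicativity of \<open>s1\<close> makes the
  result equivariant.\<close>

lemma ex_equivariant_piece:
  assumes V0: "local_section V0 \<sigma>0" "V0 \<noteq> {}" and y0: "y0 \<in> carrier Q"
  shows "\<exists>\<rho> U s. equivariant_piece (\<rho>, U, s) \<and> 0 < \<rho> y0"
proof -
  obtain V \<sigma> where \<sigma>: "local_section V \<sigma>" "y0 \<in> V" using local_section_translate[OF V0 y0] by blast
  obtain E where E: "openin TQ E" "\<one>\<^bsub>Q\<^esub> \<in> E" "\<And>l. l \<in> Lam \<Longrightarrow> l \<in> E \<Longrightarrow> l = \<one>\<^bsub>Q\<^esub>"
    using Q.ex_discrete_nbhd by blast
  obtain V1 where V1: "openin TQ V1" "\<one>\<^bsub>Q\<^esub> \<in> V1"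
     "\<And>x y. x \<in> V1 \<Longrightarrow> y \<in> V1 \<Longrightarrow> x \<otimes>\<^bsub>Q\<^esub> inv\<^bsub>Q\<^esub> y \<in> E \<and> inv\<^bsub>Q\<^esub> x \<otimes>\<^bsub>Q\<^esub> y \<in> E"
    using Q.nbhd_division[OF E(1,2)] by blast
  \<comment> \<open>If \<open>l \<otimes> y\<close> and \<open>l' \<otimes> y\<close> both lie in
    \<open>V'\<close>, then the quotient of their right translates by \<open>inv y0\<close> equals
    \<open>l' \<otimes> inv l\<close> and lies in \<open>E\<close>, hence is 1.\<close>
  define V' where "V' = V \<inter> {x \<in> topspace TQ. x \<otimes>\<^bsub>Q\<^esub> inv\<^bsub>Q\<^esub> y0 \<in> V1}"
  have V': "openin TQ V'"
  proof -
    have "openin TQ {x \<in> topspace TQ. x \<otimes>\<^bsub>Q\<^esub> inv\<^bsub>Q\<^esub> y0 \<in> V1}"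
      using y0 by (intro openin_continuous_map_preimage[OF Q.continuous_map_mult_const V1(1)]) auto
    then show ?thesis using \<sigma>(1) unfolding V'_def local_section_def by blast
  qed
  have y0V': "y0 \<in> V'" using y0 \<sigma>(2) V1 unfolding V'_def by simp
  have V'Q: "x \<in> carrier Q" if "x \<in> V'" for x using V' that Q.openin_carrier by blast
  have uniq: "l' = l" if l: "l \<in> Lam" "l' \<in> Lam" "y \<in> carrier Q" "l \<otimes>\<^bsub>Q\<^esub> y \<in> V'" "l' \<otimes>\<^bsub>Q\<^esub> y \<in> V'" for l l' y
  proof -
    let ?a = "l' \<otimes>\<^bsub>Q\<^esub> y \<otimes>\<^bsub>Q\<^esub> inv\<^bsub>Q\<^esub> y0" and ?b = "l \<otimes>\<^bsub>Q\<^esub> y \<otimes>\<^bsub>Q\<^esub> inv\<^bsub>Q\<^esub> y0"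
    have "?a \<otimes>\<^bsub>Q\<^esub> inv\<^bsub>Q\<^esub> ?b \<in> E" using V1(3) l unfolding V'_def by blast
    moreover have "?a \<otimes>\<^bsub>Q\<^esub> inv\<^bsub>Q\<^esub> ?b = l' \<otimes>\<^bsub>Q\<^esub> inv\<^bsub>Q\<^esub> l"
      using l y0 by (simp add: Q.inv_mult_group Q.m_assoc)
    ultimately have "l' \<otimes>\<^bsub>Q\<^esub> inv\<^bsub>Q\<^esub> l = \<one>\<^bsub>Q\<^esub>" using E(3) l by simp
    then show ?thesis using l by (metis Q.Lam_carrier Q.inv_closed Q.inv_equality Q.inv_inv)
  qed
  obtain f where f: "f \<in> Cc TQ" "\<And>y. 0 \<le> f y" "\<And>y. f y \<le> 1" "f y0 = 1"
    "\<And>y. y \<in> topspace TQ \<Longrightarrow> y \<notin> V' \<Longrightarrow> f y = 0"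
    using bump[OF Q.loc_compact Q.Hausdorff V' y0V'] by blast
  define W where "W l = {y \<in> topspace TQ. l \<otimes>\<^bsub>Q\<^esub> y \<in> V'}" for l
  have W: "openin TQ (W l)" if "l \<in> Lam" for l
    unfolding W_def using that by (intro openin_continuous_map_preimage[OF Q.continuous_map_const_mult V']) auto
  define U where "U = (\<Union>l\<in>Lam. W l)"
  have UO: "openin TQ U" unfolding U_def using W by blast
  define L where "L y = (THE l. l \<in> Lam \<and> l \<otimes>\<^bsub>Q\<^esub> y \<in> V')" for y
  have L: "L y = l" if "l \<in> Lam" "y \<in> W l" for l y
    unfolding L_def using that uniq unfolding W_def by (intro the_equality) auto
  define s where "s y = s1 (inv\<^bsub>Q\<^esub> (L y)) \<otimes>\<^bsub>Gh\<^esub> \<sigma> (L y \<otimes>\<^bsub>Q\<^esub> y)" for y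
  have sW: "s y = s1 (inv\<^bsub>Q\<^esub> l) \<otimes>\<^bsub>Gh\<^esub> \<sigma> (l \<otimes>\<^bsub>Q\<^esub> y)" if "l \<in> Lam" "y \<in> W l" for l y
    unfolding s_def L[OF that] ..
  have \<sigma>c: "\<sigma> v \<in> carrier Gh" "q (\<sigma> v) = v" if "v \<in> V'" for v
    using local_section_closed[OF \<sigma>(1)] \<sigma>(1) that unfolding V'_def local_section_def by auto
  have sec: "local_section U s"
    unfolding local_section_def
  proof (intro conjI UO ballI)
    show "continuous_map (subtopology TQ U) TGh s"
    proof (rule pasting_lemma[where I=Lam and T=W and f="\<lambda>l y. s1 (inv\<^bsub>Q\<^esub> l) \<otimes>\<^bsub>Gh\<^esub> \<sigma> (l \<otimes>\<^bsub>Q\<^esub> y)"])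
      fix l assume l: "l \<in> Lam"
      have WU: "W l \<subseteq> U" using l unfolding U_def by blast
      show "openin (subtopology TQ U) (W l)"
        using W[OF l] WU by (simp add: openin_subset_topspace_eq UO openin_open_subtopology)
      have *: "subtopology (subtopology TQ U) (W l) = subtopology TQ (W l)"
        using WU by (simp add: subtopology_subtopology inf_absorb2)
      have "continuous_map (subtopology TQ (W l)) (subtopology TQ V) (\<lambda>y. l \<otimes>\<^bsub>Q\<^esub> y)"
        using l by (intro continuous_map_into_subtopology
            continuous_map_from_subtopology[OF Q.continuous_map_const_mult]) (auto simp: W_def V'_def)
      from continuous_map_compose[OF this, of TGh \<sigma>]
      have "continuous_map (subtopology TQ (W l)) TGh (\<lambda>y. \<sigma> (l \<otimes>\<^bsub>Q\<^esub> y))"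
        using \<sigma>(1) unfolding local_section_def by (simp add: o_def)
      then show "continuous_map (subtopology (subtopology TQ U) (W l)) TGh (\<lambda>y. s1 (inv\<^bsub>Q\<^esub> l) \<otimes>\<^bsub>Gh\<^esub> \<sigma> (l \<otimes>\<^bsub>Q\<^esub> y))"
        unfolding * using l by (intro Gh.continuous_map_mult) auto
    next
      fix i j x assume "i \<in> Lam" "j \<in> Lam" "x \<in> topspace (subtopology TQ U) \<inter> W i \<inter> W j"
      then show "s1 (inv\<^bsub>Q\<^esub> i) \<otimes>\<^bsub>Gh\<^esub> \<sigma> (i \<otimes>\<^bsub>Q\<^esub> x) = s1 (inv\<^bsub>Q\<^esub> j) \<otimes>\<^bsub>Gh\<^esub> \<sigma> (j \<otimes>\<^bsub>Q\<^esub> x)"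
        using sW[of i x] sW[of j x] by auto
    next
      fix x assume "x \<in> topspace (subtopology TQ U)"
      then show "\<exists>j. j \<in> Lam \<and> x \<in> W j \<and> s x = s1 (inv\<^bsub>Q\<^esub> j) \<otimes>\<^bsub>Gh\<^esub> \<sigma> (j \<otimes>\<^bsub>Q\<^esub> x)"
        using sW unfolding U_def by auto
    qed
    fix y assume "y \<in> U"
    then obtain l where l: "l \<in> Lam" "y \<in> W l" unfolding U_def by blast
    then have "l \<otimes>\<^bsub>Q\<^esub> y \<in> V'" "y \<in> carrier Q" unfolding W_def by auto
    then show "q (s y) = y" unfolding sW[OF l] using l \<sigma>c by (simp add: s1_sec)
  qed
  have equi: "l \<otimes>\<^bsub>Q\<^esub> y \<in> U \<and> s (l \<otimes>\<^bsub>Q\<^esub> y) = s1 l \<otimes>\<^bsub>Gh\<^esub> s y" if l: "l \<in> Lam" and y: "y \<in> U" for l y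
  proof -
    obtain m where m: "m \<in> Lam" "y \<in> W m" using y unfolding U_def by blast
    then have mV: "m \<otimes>\<^bsub>Q\<^esub> y \<in> V'" "y \<in> carrier Q" unfolding W_def by auto
    let ?n = "m \<otimes>\<^bsub>Q\<^esub> inv\<^bsub>Q\<^esub> l"
    have n: "?n \<in> Lam" "?n \<otimes>\<^bsub>Q\<^esub> (l \<otimes>\<^bsub>Q\<^esub> y) = m \<otimes>\<^bsub>Q\<^esub> y"
      using m l mV by (auto simp: Q.m_assoc)
    then have lW: "l \<otimes>\<^bsub>Q\<^esub> y \<in> W ?n" using mV l unfolding W_def by simp
    have "s (l \<otimes>\<^bsub>Q\<^esub> y) = s1 (inv\<^bsub>Q\<^esub> ?n) \<otimes>\<^bsub>Gh\<^esub> \<sigma> (m \<otimes>\<^bsub>Q\<^esub> y)"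
      unfolding sW[OF n(1) lW] n(2) ..
    also have "inv\<^bsub>Q\<^esub> ?n = l \<otimes>\<^bsub>Q\<^esub> inv\<^bsub>Q\<^esub> m" using m l by (simp add: Q.inv_mult_group)
    also have "s1 (l \<otimes>\<^bsub>Q\<^esub> inv\<^bsub>Q\<^esub> m) \<otimes>\<^bsub>Gh\<^esub> \<sigma> (m \<otimes>\<^bsub>Q\<^esub> y) = s1 l \<otimes>\<^bsub>Gh\<^esub> s y"
      unfolding sW[OF m] using m l \<sigma>c(1)[OF mV(1)] by (simp add: s1_mult Gh.m_assoc)
    finally show ?thesis using lW n(1) unfolding U_def by blast
  qed
  let ?F = "Q.per f"
  \<comment> \<open>Subtracting 1/2 confines the support to the closed set \<open>?D\<close>, which
    lies in \<open>U\<close> because \<open>?F\<close> is 0 off \<open>U\<close>. The value at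
    \<open>y0\<close> stays positive since \<open>?F y0\<close> is at least 1.\<close>
  let ?\<rho> = "\<lambda>y. max 0 (?F y - 1/2)"
  let ?D = "{y \<in> topspace TQ. ?F y \<in> {1/2..}}"
  have Fc: "continuous_map TQ euclideanreal ?F" by (rule Q.per_continuous[OF f(1)])
  have "closedin TQ ?D" using Fc by (rule closedin_continuous_map_preimage) auto
  moreover have "?D \<subseteq> U"
  proof
    fix y assume y: "y \<in> ?D"
    have "\<exists>l\<in>Lam. f (l \<otimes>\<^bsub>Q\<^esub> y) \<noteq> 0"
    proof (rule ccontr)
      assume "\<not> ?thesis"
      then have "{l \<in> Lam. f (l \<otimes>\<^bsub>Q\<^esub> y) \<noteq> 0} = {}" by blast
      then have "?F y = 0" unfolding Q.per_def by (simp only: sum.empty)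
      then show False using y by simp
    qed
    then obtain l where l: "l \<in> Lam" "f (l \<otimes>\<^bsub>Q\<^esub> y) \<noteq> 0" by blast
    then have "l \<otimes>\<^bsub>Q\<^esub> y \<in> V'" using f(5)[of "l \<otimes>\<^bsub>Q\<^esub> y"] y by auto
    then show "y \<in> U" using l y unfolding U_def W_def by auto
  qed
  moreover have "\<forall>y\<in>carrier Q - ?D. ?\<rho> y = 0" by auto
  ultimately have D: "\<exists>D. closedin TQ D \<and> D \<subseteq> U \<and> (\<forall>y\<in>carrier Q - D. ?\<rho> y = 0)" by blast
  have \<rho>c: "continuous_map TQ euclideanreal ?\<rho>" using Fc by (intro continuous_intros)
  have "equivariant_piece (?\<rho>, U, s)"
    unfolding equivariant_piece_def using sec \<rho>c D equi Q.per_inv by simp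
  moreover have "0 < ?\<rho> y0"
  proof -
    have "f (\<one>\<^bsub>Q\<^esub> \<otimes>\<^bsub>Q\<^esub> y0) \<le> ?F y0"
      unfolding Q.per_def using f(2,4) y0
      by (intro member_le_sum[where f="\<lambda>l. f (l \<otimes>\<^bsub>Q\<^esub> y0)"] Q.per_finite[OF f(1) y0]) auto
    then show ?thesis using y0 f(4) by simp
  qed
  ultimately show ?thesis by blast
qed

text \<open>Compactness of \<open>C\<close> yields finitely many pieces whose sum is positive on
  \<open>C\<close>, and invariance spreads this to all orbits. Dividing by the invariant sum keeps
  every property of a piece.\<close>

lemma ex_equivariant_family:
  assumes V0: "local_section V0 \<sigma>0" "V0 \<noteq> {}"
  obtains n :: nat and \<rho> U s where "\<And>i. i < n \<Longrightarrow> equivariant_piece (\<rho> i, U i, s i)"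
    "\<And>y. y \<in> carrier Q \<Longrightarrow> (\<Sum>i<n. \<rho> i y) = 1"
proof -
  have "\<forall>y0\<in>carrier Q. \<exists>P. equivariant_piece P \<and> 0 < fst P y0"
    using ex_equivariant_piece[OF V0] by (metis fst_conv)
  then obtain P where P: "\<And>y0. y0 \<in> carrier Q \<Longrightarrow> equivariant_piece (P y0)" "\<And>y0. y0 \<in> carrier Q \<Longrightarrow> 0 < fst (P y0) y0"
    by metis
  have Pc: "continuous_map TQ euclideanreal (fst (P x))" "\<And>y. 0 \<le> fst (P x) y"
     "\<And>l y. l \<in> Lam \<Longrightarrow> y \<in> carrier Q \<Longrightarrow> fst (P x) (l \<otimes>\<^bsub>Q\<^esub> y) = fst (P x) y" if "x \<in> carrier Q" for x
    using P(1)[OF that] unfolding equivariant_piece_def by (auto simp: case_prod_unfold)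
  let ?W = "\<lambda>x. {y \<in> topspace TQ. fst (P x) y \<in> {0<..}}"
  have "openin TQ (?W x) \<and> x \<in> ?W x" if x: "x \<in> C" for x
  proof
    have xQ: "x \<in> carrier Q" using Q.compactin_carrier[OF Q.C x] .
    show "openin TQ (?W x)" using Pc(1)[OF xQ] by (rule openin_continuous_map_preimage) auto
    show "x \<in> ?W x" using xQ P(2) by simp
  qed
  then obtain F where F: "finite F" "F \<subseteq> C" "C \<subseteq> \<Union>(?W ` F)"
    by (rule compactin_finite_subcover[OF Q.C])
  have FQ: "x \<in> carrier Q" if "x \<in> F" for x using that F(2) Q.compactin_carrier[OF Q.C] by blast
  obtain e where e: "bij_betw e {..<card F} F"
    using ex_bij_betw_nat_finite[OF F(1)] by (auto simp: atLeast0LessThan)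
  have eF: "e i \<in> F" if "i < card F" for i using bij_betwE[OF e] that by auto
  define S where "S y = (\<Sum>x\<in>F. fst (P x) y)" for y
  have Sinv: "S (l \<otimes>\<^bsub>Q\<^esub> y) = S y" if "l \<in> Lam" "y \<in> carrier Q" for l y
    unfolding S_def using that FQ Pc(3) by (intro sum.cong) auto
  have Spos: "0 < S y" if y: "y \<in> carrier Q" for y
  proof -
    obtain l where l: "l \<in> Lam" "l \<otimes>\<^bsub>Q\<^esub> y \<in> C" using Q.Lam_C[OF y] by blast
    then obtain x where x: "x \<in> F" "0 < fst (P x) (l \<otimes>\<^bsub>Q\<^esub> y)" using F(3) by auto
    have "0 < S (l \<otimes>\<^bsub>Q\<^esub> y)"
      unfolding S_def using x F(1) Pc(2)[OF FQ] by (intro sum_pos2) auto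
    then show ?thesis using Sinv l y by simp
  qed
  have Sc: "continuous_map TQ euclideanreal S"
    unfolding S_def using F(1) FQ Pc(1) by (intro continuous_map_sum) auto
  \<comment> \<open>On the carrier the denominator is \<open>S y > 0\<close>. The \<open>max\<close>
    makes nonnegativity of the quotient evident at every \<open>y\<close>, also off the
    carrier.\<close>
  let ?\<rho> = "\<lambda>i y. fst (P (e i)) y / max (S y) 0"
  show thesis
  proof (rule that[of "card F" ?\<rho> "\<lambda>i. fst (snd (P (e i)))" "\<lambda>i. snd (snd (P (e i)))"])
    fix i assume i: "i < card F"
    have xQ: "e i \<in> carrier Q" using FQ eF i by blast
    have 1: "continuous_map TQ euclideanreal (?\<rho> i)"
      using Spos by (intro continuous_map_real_divide Pc(1)[OF xQ] continuous_map_real_max Sc) (auto simp: less_le)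
    have 2: "\<forall>l\<in>Lam. \<forall>y\<in>carrier Q. ?\<rho> i (l \<otimes>\<^bsub>Q\<^esub> y) = ?\<rho> i y" using Pc(3)[OF xQ] Sinv by simp
    have 3: "\<forall>y. 0 \<le> ?\<rho> i y" using Pc(2)[OF xQ] by simp
    have 4: "\<exists>D. closedin TQ D \<and> D \<subseteq> fst (snd (P (e i))) \<and> (\<forall>y\<in>carrier Q - D. ?\<rho> i y = 0)"
      using P(1)[OF xQ] unfolding equivariant_piece_def by (auto simp: case_prod_unfold)
    show "equivariant_piece (?\<rho> i, fst (snd (P (e i))), snd (snd (P (e i))))"
      using P(1)[OF xQ] 1 2 3 4 unfolding equivariant_piece_def case_prod_unfold fst_conv snd_conv by blast
  next
    fix y assume y: "y \<in> carrier Q"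
    have "(\<Sum>i<card F. fst (P (e i)) y) = S y"
      unfolding S_def using sum.reindex_bij_betw[OF e, of "\<lambda>x. fst (P x) y"] by simp
    then show "(\<Sum>i<card F. ?\<rho> i y) = 1" using Spos[OF y] by (simp flip: sum_divide_distrib)
  qed
qed

end

section \<open>Averaging over overlapping intervals\<close>

text \<open>The length of the intersection of \<open>[a,b]\<close> and \<open>[c,d]\<close>.\<close>

definition overlap :: "real \<Rightarrow> real \<Rightarrow> real \<Rightarrow> real \<Rightarrow> real" where
  "overlap a b c d = max 0 (min b d - max a c)"

text \<open>Consecutive intervals tile a range containing \<open>[c,d]\<close>. Each overlap is the
  difference of two endpoints clamped to \<open>[c,d]\<close>, so the sum telescopes.\<close>

lemma overlap_sum:
  assumes mono: "\<And>k. k < n \<Longrightarrow> a k \<le> a (Suc k)" and "a 0 \<le> c" "d \<le> a n"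
  shows "(\<Sum>k<n. overlap c d (a k) (a (Suc k))) = max 0 (d - c)"
proof (cases "c < d")
  case True
  have "overlap c d (a k) (a (Suc k)) = max c (min d (a (Suc k))) - max c (min d (a k))" if "k < n" for k
    using mono[OF that] True by (auto simp: overlap_def max_def min_def)
  then have "(\<Sum>k<n. overlap c d (a k) (a (Suc k)))
      = (\<Sum>k<n. max c (min d (a (Suc k))) - max c (min d (a k)))"
    by (intro sum.cong) auto
  also have "\<dots> = max c (min d (a n)) - max c (min d (a 0))"
    by (rule sum_lessThan_telescope)
  also have "\<dots> = max 0 (d - c)" using assms True by (auto simp: max_def min_def)
  finally show ?thesis .
next
  case False
  then have "overlap c d x y = 0" for x y by (auto simp: overlap_def max_def min_def)
  with False show ?thesis by simp
qed

text \<open>The product is continuous on \<open>W\<close> and is 0 on the complement of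
  \<open>D\<close>; both sets are open and together they cover the space. This deals with sections
  that carry no information outside their domains.\<close>

lemma continuous_map_mult_support:
  fixes a b :: "'a \<Rightarrow> real"
  assumes a: "continuous_map X euclideanreal a" and W: "openin X W" and D: "closedin X D" "D \<subseteq> W"
    and z: "\<And>x. x \<in> topspace X \<Longrightarrow> x \<notin> D \<Longrightarrow> a x = 0"
    and b: "continuous_map (subtopology X W) euclideanreal b"
  shows "continuous_map X euclideanreal (\<lambda>x. a x * b x)"
proof (rule pasting_lemma[where I="UNIV::bool set" and T="\<lambda>i. if i then W else topspace X - D"
      and f="\<lambda>i x. if i then a x * b x else 0"])
  fix i :: bool
  show "openin X (if i then W else topspace X - D)" using W D by auto
  show "continuous_map (subtopology X (if i then W else topspace X - D)) euclideanreal (\<lambda>x. if i then a x * b x else 0)"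
    using continuous_map_real_mult[OF continuous_map_from_subtopology[OF a] b] by (cases i) auto
next
  fix i j :: bool and x assume x: "x \<in> topspace X \<inter> (if i then W else topspace X - D) \<inter> (if j then W else topspace X - D)"
  then show "(if i then a x * b x else 0) = (if j then a x * b x else 0)"
    using z[of x] by (auto split: if_splits)
next
  fix x assume x: "x \<in> topspace X"
  show "\<exists>j. j \<in> UNIV \<and> x \<in> (if j then W else topspace X - D) \<and> a x * b x = (if j then a x * b x else 0)"
  proof (cases "x \<in> W")
    case True then show ?thesis by (intro exI[of _ True]) auto
  next
    case False then show ?thesis using x z[of x] D(2) by (intro exI[of _ False]) auto
  qed
qed

section \<open>Weights from consecutive intervals\<close>

locale equivariant_family = group_extension Gh TGh Q TQ Lam C q s1
  for Gh :: "('g, 'm) monoid_scheme" and TGh :: "'g topology"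
    and Q :: "('q, 'n) monoid_scheme" and TQ :: "'q topology" and Lam C :: "'q set"
    and q :: "'g \<Rightarrow> 'q" and s1 :: "'q \<Rightarrow> 'g" +
  fixes n :: nat and \<rho> :: "nat \<Rightarrow> 'q \<Rightarrow> real" and U :: "nat \<Rightarrow> 'q set" and s :: "nat \<Rightarrow> 'q \<Rightarrow> 'g"
  assumes piece: "\<And>i. i < n \<Longrightarrow> equivariant_piece (\<rho> i, U i, s i)"
    and sum_\<rho>: "\<And>y. y \<in> carrier Q \<Longrightarrow> (\<Sum>i<n. \<rho> i y) = 1"
begin

lemma piece_facts:
  assumes "i < n"
  shows "local_section (U i) (s i)" "continuous_map TQ euclideanreal (\<rho> i)" "0 \<le> \<rho> i y"
     "l \<in> Lam \<Longrightarrow> y \<in> carrier Q \<Longrightarrow> \<rho> i (l \<otimes>\<^bsub>Q\<^esub> y) = \<rho> i y"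
     "l \<in> Lam \<Longrightarrow> y \<in> U i \<Longrightarrow> l \<otimes>\<^bsub>Q\<^esub> y \<in> U i" "l \<in> Lam \<Longrightarrow> y \<in> U i \<Longrightarrow> s i (l \<otimes>\<^bsub>Q\<^esub> y) = s1 l \<otimes>\<^bsub>Gh\<^esub> s i y"
  using piece[OF assms] unfolding equivariant_piece_def by auto

lemma ex_closed_support:
  assumes "i < n"
  obtains D where "closedin TQ D" "D \<subseteq> U i" "\<And>y. y \<in> carrier Q \<Longrightarrow> y \<notin> D \<Longrightarrow> \<rho> i y = 0"
  using piece[OF assms] unfolding equivariant_piece_def by auto

lemma \<rho>_pos_section:
  assumes "i < n" "y \<in> carrier Q" "\<rho> i y \<noteq> 0"
  shows "y \<in> U i" "s i y \<in> carrier Gh" "q (s i y) = y"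
proof -
  obtain D where "closedin TQ D" "D \<subseteq> U i" "\<And>y. y \<in> carrier Q \<Longrightarrow> y \<notin> D \<Longrightarrow> \<rho> i y = 0"
    using ex_closed_support[OF assms(1)] by blast
  then show "y \<in> U i" using assms(2,3) by blast
  then show "s i y \<in> carrier Gh" "q (s i y) = y"
    using local_section_closed piece_facts(1)[OF assms(1)] unfolding local_section_def by auto
qed

text \<open>The interval \<open>I\<^sub>i(y)\<close> of the overview is
  \<open>[A i y, A (Suc i) y]\<close>.\<close>

definition A :: "nat \<Rightarrow> 'q \<Rightarrow> real" where "A i y = (\<Sum>j<i. \<rho> j y)"

lemma A_Suc: "A (Suc i) y = A i y + \<rho> i y" by (simp add: A_def)

lemma A_0: "A 0 y = 0" by (simp add: A_def)

lemma A_n: "y \<in> carrier Q \<Longrightarrow> A n y = 1" by (simp add: A_def sum_\<rho>)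

lemma A_mono: "i \<le> j \<Longrightarrow> j \<le> n \<Longrightarrow> A i y \<le> A j y"
  unfolding A_def by (intro sum_mono2) (auto intro: piece_facts)

lemma A_bounds: "i \<le> n \<Longrightarrow> y \<in> carrier Q \<Longrightarrow> 0 \<le> A i y \<and> A i y \<le> 1"
  using A_mono[of 0 i y] A_mono[of i n y] by (simp add: A_0 A_n)

lemma A_cont: "i \<le> n \<Longrightarrow> continuous_map TQ euclideanreal (A i)"
  unfolding A_def by (intro continuous_map_sum) (auto intro: piece_facts)

lemma A_inv: "i \<le> n \<Longrightarrow> l \<in> Lam \<Longrightarrow> y \<in> carrier Q \<Longrightarrow> A i (l \<otimes>\<^bsub>Q\<^esub> y) = A i y"
  unfolding A_def by (intro sum.cong) (auto intro: piece_facts)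

definition w :: "nat \<Rightarrow> nat \<Rightarrow> 'q \<Rightarrow> 'q \<Rightarrow> real" where
  "w i j y z = overlap (A i y) (A (Suc i) y) (A j z) (A (Suc j) z)"

text \<open>The length of the common part of the intervals numbered \<open>i\<close>,
  \<open>j\<close>, \<open>k\<close> at the three points: a joint law for three choices.\<close>

definition w3 :: "nat \<Rightarrow> nat \<Rightarrow> nat \<Rightarrow> 'q \<Rightarrow> 'q \<Rightarrow> 'q \<Rightarrow> real" where
  "w3 i j k x y z = max 0 (min (min (A (Suc i) x) (A (Suc j) y)) (A (Suc k) z)
                            - max (max (A i x) (A j y)) (A k z))"

lemma w3_nonneg: "0 \<le> w3 i j k x y z"
  by (simp add: w3_def)

text \<open>A nonzero weight thus makes all three partition functions nonzero and places the points
  in the domains of their sections.\<close>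

lemma w3_le:
  assumes "i < n" "j < n" "k < n"
  shows "w3 i j k x y z \<le> \<rho> i x" "w3 i j k x y z \<le> \<rho> j y" "w3 i j k x y z \<le> \<rho> k z"
  using piece_facts(3)[OF assms(1), of x] piece_facts(3)[OF assms(2), of y] piece_facts(3)[OF assms(3), of z]
  by (auto simp: w3_def A_Suc max_def min_def)

lemma w_le:
  assumes "i < n" "j < n"
  shows "w i j y z \<le> \<rho> i y" "w i j y z \<le> \<rho> j z" "0 \<le> w i j y z"
  using piece_facts(3)[OF assms(1), of y] piece_facts(3)[OF assms(2), of z]
  by (auto simp: w_def overlap_def A_Suc max_def min_def)

text \<open>At one and the same point the intervals are consecutive and meet at most in endpoints.
  The exact agreement with \<phi> on the kernel rests on this.\<close>

lemma w_refl:
  assumes "i < n" "j < n"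
  shows "w i j y y = (if i = j then \<rho> i y else 0)"
proof (cases i j rule: linorder_cases)
  case equal
  then show ?thesis using piece_facts(3)[OF assms(1), of y] by (auto simp: w_def overlap_def A_Suc)
next
  case less
  then have "A (Suc i) y \<le> A j y" using assms by (intro A_mono) auto
  then show ?thesis using less by (auto simp: w_def overlap_def max_def min_def)
next
  case greater
  then have "A (Suc j) y \<le> A i y" using assms by (intro A_mono) auto
  then show ?thesis using greater by (auto simp: w_def overlap_def max_def min_def)
qed

lemma sum_overlap_A:
  assumes "z \<in> carrier Q" "0 \<le> c" "d \<le> 1"
  shows "(\<Sum>k<n. overlap c d (A k z) (A (Suc k) z)) = max 0 (d - c)"
  using assms by (intro overlap_sum) (auto simp: A_0 A_n intro: A_mono)

lemma sum_w:
  assumes "y \<in> carrier Q" "z \<in> carrier Q"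
  shows "(\<Sum>i<n. \<Sum>j<n. w i j y z) = 1"
proof -
  have "(\<Sum>j<n. w i j y z) = \<rho> i y" if "i < n" for i
    unfolding w_def using sum_overlap_A[OF assms(2), of "A i y" "A (Suc i) y"]
      A_bounds[of i y] A_bounds[of "Suc i" y] that assms piece_facts(3)[OF that, of y] by (simp add: A_Suc)
  then show ?thesis using sum_\<rho>[OF assms(1)] by simp
qed

text \<open>The intervals of the point summed over tile \<open>[0,1]\<close>, so that point is
  forgotten and the overlap of the other two remains. All pair weights are marginals of one triple
  weight, which lets three averages be written over a common index set.\<close>

lemma sum_w3:
  assumes ij: "i < n" "j < n" and "x \<in> carrier Q" "y \<in> carrier Q" "z \<in> carrier Q"
  shows "(\<Sum>k<n. w3 i j k x y z) = w i j x y" "(\<Sum>k<n. w3 i k j x z y) = w i j x y" "(\<Sum>k<n. w3 k i j z x y) = w i j x y"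
proof -
  let ?c = "max (A i x) (A j y)" and ?d = "min (A (Suc i) x) (A (Suc j) y)"
  have "0 \<le> ?c" "?d \<le> 1"
    using A_bounds[of i x] A_bounds[of "Suc i" x] assms by auto
  from sum_overlap_A[OF \<open>z \<in> carrier Q\<close> this]
  have *: "(\<Sum>k<n. max 0 (min ?d (A (Suc k) z) - max ?c (A k z))) = w i j x y"
    by (simp add: w_def overlap_def)
  show "(\<Sum>k<n. w3 i j k x y z) = w i j x y"
    using * by (simp add: w3_def)
  show "(\<Sum>k<n. w3 i k j x z y) = w i j x y"
    unfolding *[symmetric] w3_def by (intro sum.cong refl) (simp add: ac_simps)
  show "(\<Sum>k<n. w3 k i j z x y) = w i j x y"
    unfolding *[symmetric] w3_def by (intro sum.cong refl) (simp add: ac_simps)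
qed

section \<open>The averaged cochain and its mean\<close>

definition ker :: "'g set" where "ker = {x \<in> carrier Gh. q x = \<one>\<^bsub>Q\<^esub>}"

text \<open>This is \<open>F\<close> of the overview. Where both sections are defined, the argument
  of \<phi> is mapped to 1 by \<open>q\<close>, so \<phi> is evaluated on the kernel; elsewhere the
  weight is 0.\<close>

definition avg :: "('g \<Rightarrow> real) \<Rightarrow> 'g \<Rightarrow> 'q \<Rightarrow> real" where
  "avg \<phi> x y = (\<Sum>i<n. \<Sum>j<n. w i j y (y \<otimes>\<^bsub>Q\<^esub> q x) *
      \<phi> (x \<otimes>\<^bsub>Gh\<^esub> inv\<^bsub>Gh\<^esub> (s j (y \<otimes>\<^bsub>Q\<^esub> q x)) \<otimes>\<^bsub>Gh\<^esub> s i y))"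

lemma avg_continuous:
  assumes \<phi>: "continuous_map (subtopology TGh (ker)) euclideanreal \<phi>"
  shows "continuous_map (prod_topology TGh TQ) euclideanreal (\<lambda>p. avg \<phi> (fst p) (snd p))"
  unfolding avg_def
proof (intro continuous_map_sum finite_lessThan)
  fix i j assume "i \<in> {..<n}" "j \<in> {..<n}"
  then have i: "i < n" and j: "j < n" by auto
  let ?X = "prod_topology TGh TQ"
  let ?z = "\<lambda>p. snd p \<otimes>\<^bsub>Q\<^esub> q (fst p)"
  have c1: "continuous_map ?X TGh fst" and c2: "continuous_map ?X TQ snd"
    by (rule continuous_map_fst continuous_map_snd)+
  have cz: "continuous_map ?X TQ ?z"
    using continuous_map_compose[OF c1 q_cont] by (intro Q.continuous_map_mult c2) (simp add: o_def)
  obtain D where D: "closedin TQ D" "D \<subseteq> U i" "\<And>y. y \<in> carrier Q \<Longrightarrow> y \<notin> D \<Longrightarrow> \<rho> i y = 0"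
    using ex_closed_support[OF i] by blast
  obtain E where E: "closedin TQ E" "E \<subseteq> U j" "\<And>y. y \<in> carrier Q \<Longrightarrow> y \<notin> E \<Longrightarrow> \<rho> j y = 0"
    using ex_closed_support[OF j] by blast
  \<comment> \<open>Both sections are continuous on the open set \<open>?W\<close>; the weight
    vanishes off the closed subset \<open>?D\<close>.\<close>
  let ?W = "{p \<in> topspace ?X. snd p \<in> U i} \<inter> {p \<in> topspace ?X. ?z p \<in> U j}"
  let ?D = "{p \<in> topspace ?X. snd p \<in> D} \<inter> {p \<in> topspace ?X. ?z p \<in> E}"
  have Ui: "openin TQ (U i)" "openin TQ (U j)" using piece_facts(1) i j unfolding local_section_def by auto
  let ?g = "\<lambda>p. fst p \<otimes>\<^bsub>Gh\<^esub> inv\<^bsub>Gh\<^esub> (s j (?z p)) \<otimes>\<^bsub>Gh\<^esub> s i (snd p)"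
  show "continuous_map ?X euclideanreal (\<lambda>p. w i j (snd p) (?z p) * \<phi> (?g p))"
  proof (rule continuous_map_mult_support[where W="?W" and D="?D"])
    have A2: "continuous_map ?X euclideanreal (\<lambda>p. A k (snd p))" if "k \<le> n" for k
      using continuous_map_compose[OF c2 A_cont[OF that]] by (simp add: o_def)
    have Az: "continuous_map ?X euclideanreal (\<lambda>p. A k (?z p))" if "k \<le> n" for k
      using continuous_map_compose[OF cz A_cont[OF that]] by (simp add: o_def)
    show "continuous_map ?X euclideanreal (\<lambda>p. w i j (snd p) (?z p))"
      unfolding w_def overlap_def using i j
      by (intro continuous_map_real_max continuous_map_real_min continuous_map_diff A2 Az) auto
    show "openin ?X ?W"
      using openin_continuous_map_preimage[OF c2 Ui(1)] openin_continuous_map_preimage[OF cz Ui(2)] by blast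
    show "closedin ?X ?D"
      using closedin_continuous_map_preimage[OF c2 D(1)] closedin_continuous_map_preimage[OF cz E(1)] by blast
    show "?D \<subseteq> ?W" using D E by blast
    show "w i j (snd p) (?z p) = 0" if "p \<in> topspace ?X" "p \<notin> ?D" for p
    proof -
      have "snd p \<in> carrier Q" "?z p \<in> carrier Q" using that(1) by auto
      then have "\<rho> i (snd p) = 0 \<or> \<rho> j (?z p) = 0" using that D(3) E(3) by blast
      then show ?thesis using w_le[OF i j, of "snd p" "?z p"] by linarith
    qed
    let ?Y = "subtopology ?X ?W"
    have Wt: "topspace ?Y = ?W" by auto
    have "continuous_map ?Y (subtopology TQ (U i)) snd"
      using Wt by (intro continuous_map_into_subtopology continuous_map_from_subtopology[OF c2]) blast
    from continuous_map_compose[OF this, of TGh "s i"]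
    have si: "continuous_map ?Y TGh (\<lambda>p. s i (snd p))"
      using piece_facts(1)[OF i] unfolding local_section_def by (simp add: o_def)
    have "continuous_map ?Y (subtopology TQ (U j)) ?z"
      using Wt by (intro continuous_map_into_subtopology continuous_map_from_subtopology[OF cz]) blast
    from continuous_map_compose[OF this, of TGh "s j"]
    have sj: "continuous_map ?Y TGh (\<lambda>p. s j (?z p))"
      using piece_facts(1)[OF j] unfolding local_section_def by (simp add: o_def)
    have "continuous_map ?Y TGh ?g"
      by (intro Gh.continuous_map_mult Gh.continuous_map_inv si sj continuous_map_from_subtopology[OF c1])
    moreover have "?g \<in> topspace ?Y \<rightarrow> ker"
    proof
      fix p assume "p \<in> topspace ?Y"
      then have p: "fst p \<in> carrier Gh" "snd p \<in> carrier Q" "snd p \<in> U i" "?z p \<in> U j" by auto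
      have "s i (snd p) \<in> carrier Gh" "s j (?z p) \<in> carrier Gh"
        using local_section_closed piece_facts(1) i j p by blast+
      moreover have "q (s i (snd p)) = snd p" "q (s j (?z p)) = ?z p"
        using piece_facts(1)[OF i] piece_facts(1)[OF j] p unfolding local_section_def by auto
      ultimately show "?g p \<in> ker"
        using p by (simp add: ker_def Q.inv_mult_group Q.m_assoc)
    qed
    ultimately have "continuous_map ?Y (subtopology TGh (ker)) ?g"
      by (rule continuous_map_into_subtopology)
    from continuous_map_compose[OF this \<phi>] show "continuous_map ?Y euclideanreal (\<lambda>p. \<phi> (?g p))"
      by (simp add: o_def)
  qed
qed

text \<open>Equivariance replaces the two sections by \<open>s1 l\<close> times their old values,
  and the factor \<open>s1 l\<close> cancels between the inverse of one and the other.\<close>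

lemma avg_inv:
  assumes l: "l \<in> Lam" and x: "x \<in> carrier Gh" and y: "y \<in> carrier Q"
  shows "avg \<phi> x (l \<otimes>\<^bsub>Q\<^esub> y) = avg \<phi> x y"
  unfolding avg_def
proof (intro sum.cong refl)
  fix i j assume "i \<in> {..<n}" "j \<in> {..<n}"
  then have i: "i < n" and j: "j < n" by auto
  let ?z = "y \<otimes>\<^bsub>Q\<^esub> q x"
  have z: "?z \<in> carrier Q" using x y by simp
  have lz: "l \<otimes>\<^bsub>Q\<^esub> y \<otimes>\<^bsub>Q\<^esub> q x = l \<otimes>\<^bsub>Q\<^esub> ?z" using l x y by (simp add: Q.m_assoc)
  have ww: "w i j (l \<otimes>\<^bsub>Q\<^esub> y) (l \<otimes>\<^bsub>Q\<^esub> ?z) = w i j y ?z"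
    unfolding w_def using A_inv l y z i j by simp
  show "w i j (l \<otimes>\<^bsub>Q\<^esub> y) (l \<otimes>\<^bsub>Q\<^esub> y \<otimes>\<^bsub>Q\<^esub> q x) *
      \<phi> (x \<otimes>\<^bsub>Gh\<^esub> inv\<^bsub>Gh\<^esub> (s j (l \<otimes>\<^bsub>Q\<^esub> y \<otimes>\<^bsub>Q\<^esub> q x)) \<otimes>\<^bsub>Gh\<^esub> s i (l \<otimes>\<^bsub>Q\<^esub> y))
    = w i j y ?z * \<phi> (x \<otimes>\<^bsub>Gh\<^esub> inv\<^bsub>Gh\<^esub> (s j ?z) \<otimes>\<^bsub>Gh\<^esub> s i y)"
  proof (cases "w i j y ?z = 0")
    case True then show ?thesis unfolding lz ww by simp
  next
    case False
    then have "\<rho> i y \<noteq> 0" "\<rho> j ?z \<noteq> 0" using w_le[OF i j, of y ?z] by linarith+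
    then have s: "y \<in> U i" "s i y \<in> carrier Gh" "?z \<in> U j" "s j ?z \<in> carrier Gh"
      using \<rho>_pos_section[OF i y] \<rho>_pos_section[OF j z] by auto
    show ?thesis
      unfolding lz ww using s l x piece_facts(6)[OF i l s(1)] piece_facts(6)[OF j l s(3)]
      by (simp add: Gh.inv_mult_group Gh.m_assoc)
  qed
qed

lemma avg_kernel:
  assumes x: "x \<in> ker" and y: "y \<in> carrier Q"
  shows "avg \<phi> x y = \<phi> x"
proof -
  have xx: "x \<in> carrier Gh" "q x = \<one>\<^bsub>Q\<^esub>" using x by (auto simp: ker_def)
  have "w i j y y * \<phi> (x \<otimes>\<^bsub>Gh\<^esub> inv\<^bsub>Gh\<^esub> (s j y) \<otimes>\<^bsub>Gh\<^esub> s i y) = (if j = i then \<rho> i y * \<phi> x else 0)"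
    if ij: "i < n" "j < n" for i j
  proof (cases "j = i \<and> \<rho> i y \<noteq> 0")
    case True
    then have "s i y \<in> carrier Gh" using \<rho>_pos_section[OF ij(1) y] by simp
    then show ?thesis using True w_refl[OF ij, of y] xx by (simp add: Gh.m_assoc)
  next
    case False
    then show ?thesis using w_refl[OF ij, of y] by auto
  qed
  then have "avg \<phi> x y = (\<Sum>i<n. \<Sum>j<n. if j = i then \<rho> i y * \<phi> x else 0)"
    unfolding avg_def using xx y by simp
  also have "\<dots> = (\<Sum>i<n. \<rho> i y * \<phi> x)" by (intro sum.cong refl) (simp add: sum.delta')
  also have "\<dots> = \<phi> x" using sum_\<rho>[OF y] by (simp flip: sum_distrib_right)
  finally show ?thesis .
qed

text \<open>Spread over triple overlaps, the three averages carry the same weights, and the estimate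
  is needed only for triples whose three sections are defined. The weights sum to 1, so the bound
  for one triple is the bound for the average.\<close>

lemma avg_quasi_additive:
  assumes D: "\<And>a b. a \<in> ker \<Longrightarrow> b \<in> ker \<Longrightarrow> \<bar>\<phi> (a \<otimes>\<^bsub>Gh\<^esub> b) - \<phi> a - \<phi> b\<bar> \<le> D"
    and D': "\<And>g a. g \<in> carrier Gh \<Longrightarrow> a \<in> ker \<Longrightarrow>
        \<bar>\<phi> (g \<otimes>\<^bsub>Gh\<^esub> a \<otimes>\<^bsub>Gh\<^esub> inv\<^bsub>Gh\<^esub> g) - \<phi> a\<bar> \<le> D'"
    and x: "x \<in> carrier Gh" and x': "x' \<in> carrier Gh" and y: "y \<in> carrier Q"
  shows "\<bar>avg \<phi> (x \<otimes>\<^bsub>Gh\<^esub> x') y - avg \<phi> x y - avg \<phi> x' (y \<otimes>\<^bsub>Q\<^esub> q x)\<bar> \<le> D + D'"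
proof -
  define z where "z = y \<otimes>\<^bsub>Q\<^esub> q x"
  define t where "t = z \<otimes>\<^bsub>Q\<^esub> q x'"
  have z: "z \<in> carrier Q" and t: "t \<in> carrier Q" using x x' y by (simp_all add: z_def t_def)
  have t': "y \<otimes>\<^bsub>Q\<^esub> q (x \<otimes>\<^bsub>Gh\<^esub> x') = t" using x x' y by (simp add: z_def t_def Q.m_assoc)
  define a where "a i k = \<phi> (x \<otimes>\<^bsub>Gh\<^esub> x' \<otimes>\<^bsub>Gh\<^esub> inv\<^bsub>Gh\<^esub> (s k t) \<otimes>\<^bsub>Gh\<^esub> s i y)" for i k
  define b where "b i j = \<phi> (x \<otimes>\<^bsub>Gh\<^esub> inv\<^bsub>Gh\<^esub> (s j z) \<otimes>\<^bsub>Gh\<^esub> s i y)" for i j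
  define c where "c j k = \<phi> (x' \<otimes>\<^bsub>Gh\<^esub> inv\<^bsub>Gh\<^esub> (s k t) \<otimes>\<^bsub>Gh\<^esub> s j z)" for j k
  let ?w = "\<lambda>i j k. w3 i j k y z t"
  have est: "\<bar>a i k - b i j - c j k\<bar> \<le> D + D'"
    if ijk: "i < n" "j < n" "k < n" and nz: "?w i j k \<noteq> 0" for i j k
  proof -
    have "\<rho> i y \<noteq> 0" "\<rho> j z \<noteq> 0" "\<rho> k t \<noteq> 0"
      using w3_le[OF ijk, of y z t] w3_nonneg[of i j k y z t] nz by linarith+
    then have s: "s i y \<in> carrier Gh" "q (s i y) = y" "s j z \<in> carrier Gh" "q (s j z) = z"
      "s k t \<in> carrier Gh" "q (s k t) = t"
      using \<rho>_pos_section[OF ijk(1) y] \<rho>_pos_section[OF ijk(2) z] \<rho>_pos_section[OF ijk(3) t] by auto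
    \<comment> \<open>The element evaluated for the product is \<open>(x ?c x^-1) ?b\<close>: the
      section at \<open>z\<close> cancels. One use of the defect splits it, and one conjugation by
      \<open>x\<close> returns to \<open>?c\<close>.\<close>
    let ?c = "x' \<otimes>\<^bsub>Gh\<^esub> inv\<^bsub>Gh\<^esub> (s k t) \<otimes>\<^bsub>Gh\<^esub> s j z"
    let ?b = "x \<otimes>\<^bsub>Gh\<^esub> inv\<^bsub>Gh\<^esub> (s j z) \<otimes>\<^bsub>Gh\<^esub> s i y"
    have ck: "?c \<in> ker"
      using s x' z by (simp add: ker_def t_def Q.inv_mult_group Q.m_assoc)
    have bk: "?b \<in> ker"
      using s x y by (simp add: ker_def z_def Q.inv_mult_group Q.m_assoc)
    have cc: "x \<otimes>\<^bsub>Gh\<^esub> ?c \<otimes>\<^bsub>Gh\<^esub> inv\<^bsub>Gh\<^esub> x \<in> ker"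
      using ck x by (simp add: ker_def)
    have "x \<otimes>\<^bsub>Gh\<^esub> ?c \<otimes>\<^bsub>Gh\<^esub> inv\<^bsub>Gh\<^esub> x \<otimes>\<^bsub>Gh\<^esub> ?b
        = x \<otimes>\<^bsub>Gh\<^esub> x' \<otimes>\<^bsub>Gh\<^esub> inv\<^bsub>Gh\<^esub> (s k t) \<otimes>\<^bsub>Gh\<^esub> s i y"
      using s x x' by (simp add: Gh.m_assoc)
    then show ?thesis
      using D[OF cc bk] D'[OF x ck] by (simp add: a_def b_def c_def)
  qed
  have e1: "avg \<phi> (x \<otimes>\<^bsub>Gh\<^esub> x') y = (\<Sum>i<n. \<Sum>j<n. \<Sum>k<n. ?w i j k * a i k)"
  proof -
    have "avg \<phi> (x \<otimes>\<^bsub>Gh\<^esub> x') y = (\<Sum>i<n. \<Sum>k<n. w i k y t * a i k)"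
      unfolding avg_def t' by (simp add: a_def)
    also have "\<dots> = (\<Sum>i<n. \<Sum>k<n. \<Sum>j<n. ?w i j k * a i k)"
      using sum_w3(2)[OF _ _ y t z] by (simp flip: sum_distrib_right)
    also have "\<dots> = (\<Sum>i<n. \<Sum>j<n. \<Sum>k<n. ?w i j k * a i k)"
      by (intro sum.cong refl sum.swap)
    finally show ?thesis .
  qed
  have e2: "avg \<phi> x y = (\<Sum>i<n. \<Sum>j<n. \<Sum>k<n. ?w i j k * b i j)"
    using sum_w3(1)[OF _ _ y z t] by (simp add: avg_def b_def z_def[symmetric] flip: sum_distrib_right)
  have e3: "avg \<phi> x' z = (\<Sum>i<n. \<Sum>j<n. \<Sum>k<n. ?w i j k * c j k)"
  proof -
    have "avg \<phi> x' z = (\<Sum>j<n. \<Sum>k<n. w j k z t * c j k)"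
      by (simp add: avg_def c_def t_def)
    also have "\<dots> = (\<Sum>j<n. \<Sum>k<n. \<Sum>i<n. ?w i j k * c j k)"
      using sum_w3(3)[OF _ _ z t y] by (simp flip: sum_distrib_right)
    also have "\<dots> = (\<Sum>j<n. \<Sum>i<n. \<Sum>k<n. ?w i j k * c j k)"
      by (intro sum.cong refl sum.swap)
    also have "\<dots> = (\<Sum>i<n. \<Sum>j<n. \<Sum>k<n. ?w i j k * c j k)"
      by (rule sum.swap)
    finally show ?thesis .
  qed
  have "avg \<phi> (x \<otimes>\<^bsub>Gh\<^esub> x') y - avg \<phi> x y - avg \<phi> x' z
      = (\<Sum>i<n. \<Sum>j<n. \<Sum>k<n. ?w i j k * (a i k - b i j - c j k))"
    unfolding e1 e2 e3 by (simp add: right_diff_distrib sum_subtractf)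
  also have "\<bar>\<dots>\<bar> \<le> (\<Sum>i<n. \<Sum>j<n. \<Sum>k<n. ?w i j k * (D + D'))"
  proof (intro order_trans[OF sum_abs] sum_mono)
    fix i j k assume "i \<in> {..<n}" "j \<in> {..<n}" "k \<in> {..<n}"
    then show "\<bar>?w i j k * (a i k - b i j - c j k)\<bar> \<le> ?w i j k * (D + D')"
      using est[of i j k] w3_nonneg[of i j k y z t]
      by (cases "?w i j k = 0") (auto simp: abs_mult intro: mult_left_mono)
  qed
  also have "\<dots> = D + D'"
    using sum_w3(1)[OF _ _ y z t] sum_w[OF y z] by (simp flip: sum_distrib_right)
  finally show ?thesis by (simp add: z_def)
qed

text \<open>Averaging \<open>avg_quasi_additive\<close> over \<open>y\<close> leaves the last term
  shifted to \<open>y \<otimes> q x\<close>. Right invariance of the mean removes the shift, and the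
  quasimorphism inequality results with an unchanged constant.\<close>

lemma ex_quasimorphism_extension:
  assumes \<phi>: "continuous_map (subtopology TGh (ker)) euclideanreal \<phi>"
    and D: "\<And>a b. a \<in> ker \<Longrightarrow> b \<in> ker \<Longrightarrow> \<bar>\<phi> (a \<otimes>\<^bsub>Gh\<^esub> b) - \<phi> a - \<phi> b\<bar> \<le> D"
    and D': "\<And>g a. g \<in> carrier Gh \<Longrightarrow> a \<in> ker \<Longrightarrow>
        \<bar>\<phi> (g \<otimes>\<^bsub>Gh\<^esub> a \<otimes>\<^bsub>Gh\<^esub> inv\<^bsub>Gh\<^esub> g) - \<phi> a\<bar> \<le> D'"
  obtains \<phi>h where "continuous_map TGh euclideanreal \<phi>h" "\<And>x. x \<in> ker \<Longrightarrow> \<phi>h x = \<phi> x"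
    "\<And>x x'. x \<in> carrier Gh \<Longrightarrow> x' \<in> carrier Gh \<Longrightarrow> \<bar>\<phi>h (x \<otimes>\<^bsub>Gh\<^esub> x') - \<phi>h x - \<phi>h x'\<bar> \<le> D + D'"
proof -
  obtain J where "haar Q TQ J" using Q.ex_haar by blast
  then interpret J: haar Q TQ J .
  obtain \<psi> where \<psi>: "\<psi> \<in> Cc TQ" "\<And>y. y \<in> carrier Q \<Longrightarrow> 0 \<le> \<psi> y" "\<And>y. y \<in> carrier Q \<Longrightarrow> Q.per \<psi> y = 1"
    using Q.ex_cutoff by blast
  have pos: "0 < J \<psi>"
  proof -
    \<comment> \<open>The periodisation of \<psi> is 1 at the identity, so \<psi> is nonzero
      somewhere on \<open>Lam\<close> and strict positivity of \<open>J\<close> applies.\<close>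
    have "\<exists>l\<in>Lam. \<psi> (l \<otimes>\<^bsub>Q\<^esub> \<one>\<^bsub>Q\<^esub>) \<noteq> 0"
    proof (rule ccontr)
      assume "\<not> ?thesis"
      then have "{l \<in> Lam. \<psi> (l \<otimes>\<^bsub>Q\<^esub> \<one>\<^bsub>Q\<^esub>) \<noteq> 0} = {}" by blast
      then have "Q.per \<psi> \<one>\<^bsub>Q\<^esub> = 0" unfolding Q.per_def by (simp only: sum.empty)
      then show False using \<psi>(3)[of "\<one>\<^bsub>Q\<^esub>"] by simp
    qed
    then obtain l where "l \<in> Lam" "\<psi> l \<noteq> 0" by auto
    then show ?thesis using J.J_pos[OF \<psi>(1,2), of l] \<psi>(2)[of l] by (simp add: less_le)
  qed
  have cont: "continuous_map (prod_topology TGh TQ) euclideanreal (\<lambda>p. avg \<phi> (fst p) (snd p))"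
    by (rule avg_continuous[OF \<phi>])
  have avgc: "continuous_map TQ euclideanreal (avg \<phi> x)" if "x \<in> carrier Gh" for x
    using continuous_map_slice[OF cont] that by simp
  define M where "M x = J (\<lambda>y. \<psi> y * avg \<phi> x y)" for x
  show thesis
  proof (rule that[of "\<lambda>x. M x / J \<psi>"])
    show "continuous_map TGh euclideanreal (\<lambda>x. M x / J \<psi>)"
      using J.J_continuous_param[OF \<psi>(1) cont] pos unfolding M_def
      by (intro continuous_map_real_divide) auto
    show "M x / J \<psi> = \<phi> x" if x: "x \<in> ker" for x
    proof -
      have xG: "x \<in> carrier Gh" using x by (simp add: ker_def)
      have "M x = J (\<lambda>y. \<phi> x * \<psi> y)"
        unfolding M_def using avg_kernel[OF x]
        by (intro J.J_cong Cc_mult_right[OF \<psi>(1) avgc[OF xG]] Cc_scale \<psi>(1)) auto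
      also have "\<dots> = \<phi> x * J \<psi>" by (rule J.J_scale[OF \<psi>(1)])
      finally show ?thesis using pos by simp
    qed
    fix x x' assume x: "x \<in> carrier Gh" and x': "x' \<in> carrier Gh"
    have qx: "q x \<in> carrier Q" using x by simp
    let ?a = "avg \<phi> (x \<otimes>\<^bsub>Gh\<^esub> x')" and ?b = "avg \<phi> x" and ?c = "\<lambda>y. avg \<phi> x' (y \<otimes>\<^bsub>Q\<^esub> q x)"
    have c: "continuous_map TQ euclideanreal ?c"
      using continuous_map_compose[OF Q.continuous_map_mult_const[OF qx] avgc[OF x']] by (simp add: o_def)
    have Cs: "(\<lambda>y. \<psi> y * ?a y) \<in> Cc TQ" "(\<lambda>y. \<psi> y * ?b y) \<in> Cc TQ" "(\<lambda>y. \<psi> y * ?c y) \<in> Cc TQ"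
      using x x' by (auto intro!: Cc_mult_right[OF \<psi>(1)] avgc c)
    have "M x' = J (\<lambda>y. \<psi> y * ?c y)"
      unfolding M_def using avg_inv[OF _ x']
      by (intro J.cocompact_mean_invariant[symmetric, OF Q.cocompact_axioms \<psi>(1,3) pos avgc[OF x'] _ qx]) auto
    then have "M (x \<otimes>\<^bsub>Gh\<^esub> x') - M x - M x' = J (\<lambda>y. \<psi> y * ?a y - \<psi> y * ?b y - \<psi> y * ?c y)"
      using J.J_diff[OF Cs(1,2)] J.J_diff[OF Cc_diff[OF Cs(1,2)] Cs(3)] by (simp add: M_def)
    also have "\<bar>\<dots>\<bar> \<le> (D + D') * J (\<lambda>y. \<bar>\<psi> y\<bar>)"
    proof (rule J.J_abs_le[OF Cc_diff[OF Cc_diff[OF Cs(1,2)] Cs(3)] \<psi>(1)])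
      fix y assume y: "y \<in> carrier Q"
      have "\<bar>\<psi> y * ?a y - \<psi> y * ?b y - \<psi> y * ?c y\<bar> = \<bar>?a y - ?b y - ?c y\<bar> * \<bar>\<psi> y\<bar>"
        by (simp add: mult.commute flip: abs_mult right_diff_distrib)
      also have "\<dots> \<le> (D + D') * \<bar>\<psi> y\<bar>"
        using avg_quasi_additive[OF D D' x x' y] by (intro mult_right_mono) auto
      finally show "\<bar>\<psi> y * ?a y - \<psi> y * ?b y - \<psi> y * ?c y\<bar> \<le> (D + D') * \<bar>\<psi> y\<bar>" .
    qed
    also have "J (\<lambda>y. \<bar>\<psi> y\<bar>) = J \<psi>"
      using \<psi> by (intro J.J_cong Cc_abs) auto
    finally have "\<bar>M (x \<otimes>\<^bsub>Gh\<^esub> x') - M x - M x'\<bar> \<le> (D + D') * J \<psi>" .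
    moreover have "M (x \<otimes>\<^bsub>Gh\<^esub> x') / J \<psi> - M x / J \<psi> - M x' / J \<psi> = (M (x \<otimes>\<^bsub>Gh\<^esub> x') - M x - M x') / J \<psi>"
      by (simp add: diff_divide_distrib)
    ultimately show "\<bar>M (x \<otimes>\<^bsub>Gh\<^esub> x') / J \<psi> - M x / J \<psi> - M x' / J \<psi>\<bar> \<le> D + D'"
      using pos by (simp add: divide_le_eq)
  qed
qed

end

section \<open>The extension theorem\<close>

theorem theorem6p5:
  fixes Gh :: "'g monoid" and TGh :: "'g topology" and H :: "'g set"
    and Q :: "'q monoid" and TQ :: "'q topology"
    and q :: "'g \<Rightarrow> 'q" and Lam :: "'q set" and s1 :: "'q \<Rightarrow> 'g"
    and B :: "'q set" and p :: nat and Bs :: "nat \<Rightarrow> 'q set" and s2 :: "nat \<Rightarrow> 'q \<Rightarrow> 'g"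
  assumes Gh_top: "topological_group Gh TGh" and Gh_haus: "Hausdorff_space TGh"
    and H_sub: "subgroup H Gh"
    and Q_top: "topological_group Q TQ" and Q_haus: "Hausdorff_space TQ"
    and Q_lc: "locally_compact_space TQ"
    and q_hom: "q \<in> hom Gh Q" and q_cont: "continuous_map TGh TQ q"
    and q_surj: "q ` carrier Gh = carrier Q"
    and q_ker: "{x \<in> carrier Gh. q x = \<one>\<^bsub>Q\<^esub>} = H"
    and Lam_sub: "subgroup Lam Q"
    and Lam_discrete: "subtopology TQ Lam = discrete_topology Lam"
    and s1_hom: "s1 \<in> hom (Q\<lparr>carrier := Lam\<rparr>) Gh"
    and s1_sec: "\<forall>l\<in>Lam. q (s1 l) = l"
    and B_sub: "B \<subseteq> carrier Q"
    and B_fund: "\<forall>x\<in>carrier Q. \<exists>!b. b \<in> B \<and> (\<exists>l\<in>Lam. b = l \<otimes>\<^bsub>Q\<^esub> x)"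
    and B_relcpt: "compactin TQ (TQ closure_of B)"
    and B_part: "B = (\<Union>i\<in>{1..p}. Bs i)"
    and B_disj: "\<forall>i\<in>{1..p}. \<forall>j\<in>{1..p}. i \<noteq> j \<longrightarrow> Bs i \<inter> Bs j = {}"
    and B_borel: "\<forall>i\<in>{1..p}. Bs i \<in> borel_sets_of TQ"
    and s2_cont: "\<forall>i\<in>{1..p}. continuous_map (subtopology TQ (TQ closure_of Bs i)) TGh (s2 i)"
    and s2_sec: "\<forall>i\<in>{1..p}. \<forall>x\<in>TQ closure_of Bs i. q (s2 i x) = x"
  shows "\<forall>\<phi> :: 'g \<Rightarrow> real.
           continuous_map (subtopology TGh H) euclideanreal \<phi> \<and>
           quasimorphism (Gh\<lparr>carrier := H\<rparr>) \<phi> \<and> quasi_invariant Gh H \<phi> \<longrightarrow>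
           (\<exists>\<phi>h :: 'g \<Rightarrow> real. continuous_map TGh euclideanreal \<phi>h \<and>
              quasimorphism Gh \<phi>h \<and> (\<forall>x\<in>H. \<phi>h x = \<phi> x) \<and>
              defect Gh \<phi>h \<le> defect (Gh\<lparr>carrier := H\<rparr>) \<phi> + 3 * conj_defect Gh H \<phi>)"
proof -
  have "group Gh" "group Q" using Gh_top Q_top unfolding topological_group_def by auto
  then interpret Gh: top_group Gh TGh using Gh_top by (intro top_group.intro top_group_axioms.intro)
  interpret Q: lc_group Q TQ
    using \<open>group Q\<close> Q_top Q_haus Q_lc
    by (intro lc_group.intro lc_group_axioms.intro top_group.intro top_group_axioms.intro)
  let ?C = "TQ closure_of B"
  have BC: "B \<subseteq> ?C" using B_sub by (intro closure_of_subset) simp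
  have LB: "\<exists>l\<in>Lam. l \<otimes>\<^bsub>Q\<^esub> x \<in> B" if "x \<in> carrier Q" for x using B_fund that by metis
  have LC: "\<exists>l\<in>Lam. l \<otimes>\<^bsub>Q\<^esub> x \<in> ?C" if "x \<in> carrier Q" for x using LB[OF that] BC by blast
  interpret E: group_extension Gh TGh Q TQ Lam ?C q s1
    using Lam_sub Lam_discrete B_relcpt LC q_hom q_cont q_surj s1_hom s1_sec
    by (intro group_extension.intro group_extension_axioms.intro cocompact.intro cocompact_axioms.intro
        Gh.top_group_axioms Q.lc_group_axioms) auto
  have "\<exists>V \<sigma>. E.local_section V \<sigma> \<and> V \<noteq> {}"
  proof -
    obtain W N where W: "openin TQ W" "compactin TQ N" "\<one>\<^bsub>Q\<^esub> \<in> W" "W \<subseteq> N"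
      using Q_lc unfolding locally_compact_space_def by (metis Q.one_closed Q.topspace_eq)
    let ?S = "{l \<in> Lam. \<exists>x\<in>N. l \<otimes>\<^bsub>Q\<^esub> x \<in> ?C}"
    have S: "finite ?S" using W(2) B_relcpt by (rule E.Q.finite_returns)
    \<comment> \<open>The preimage of the closure of \<open>Bs i\<close> under translation by
      \<open>l\<close>. Points of \<open>W\<close> lie in the compact \<open>N\<close>, so only the
      finitely many \<open>l\<close> in \<open>?S\<close> can bring them into
      \<open>?C\<close>.\<close>
    let ?A = "\<lambda>(l, i). {x \<in> topspace TQ. l \<otimes>\<^bsub>Q\<^esub> x \<in> TQ closure_of Bs i}"
    have "W \<subseteq> \<Union>(?A ` (?S \<times> {1..p}))"
    proof
      fix x assume x: "x \<in> W"
      then have xQ: "x \<in> carrier Q" using W(1) Q.openin_carrier by blast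
      obtain l where l: "l \<in> Lam" "l \<otimes>\<^bsub>Q\<^esub> x \<in> B" using LB[OF xQ] by blast
      then obtain i where i: "i \<in> {1..p}" "l \<otimes>\<^bsub>Q\<^esub> x \<in> Bs i" using B_part by blast
      have "Bs i \<subseteq> carrier Q" using i(1) B_part B_sub by blast
      then have "Bs i \<subseteq> TQ closure_of Bs i" by (intro closure_of_subset) simp
      then have "x \<in> ?A (l, i)" using i xQ by auto
      moreover have "(l, i) \<in> ?S \<times> {1..p}" using l i x W(4) BC by blast
      ultimately show "x \<in> \<Union>(?A ` (?S \<times> {1..p}))" by blast
    qed
    then have "W \<subseteq> TQ interior_of (\<Union>(?A ` (?S \<times> {1..p})))" using W(1) by (rule interior_of_maximal)
    then have ne: "TQ interior_of (\<Union>(?A ` (?S \<times> {1..p}))) \<noteq> {}" using W(3) by blast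
    have cl: "closedin TQ X" if "X \<in> ?A ` (?S \<times> {1..p})" for X
    proof -
      obtain l i where li: "l \<in> Lam" "X = ?A (l, i)" using \<open>X \<in> _\<close> by auto
      have "closedin TQ {x \<in> topspace TQ. l \<otimes>\<^bsub>Q\<^esub> x \<in> TQ closure_of Bs i}"
        using li(1) by (intro closedin_continuous_map_preimage[OF Q.continuous_map_const_mult]) auto
      then show ?thesis using li(2) by simp
    qed
    have fin: "finite (?A ` (?S \<times> {1..p}))" using S by blast
    obtain X where X: "X \<in> ?A ` (?S \<times> {1..p})" "TQ interior_of X \<noteq> {}"
      using interior_of_finite_Union_closed[OF fin cl ne] by blast
    obtain c where c: "X = ?A c" "c \<in> ?S \<times> {1..p}" using X(1) by (rule imageE)
    obtain l i where [simp]: "c = (l, i)" by (cases c)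
    have li: "l \<in> Lam" "i \<in> {1..p}" and Xe: "X = ?A (l, i)" using c by auto
    let ?V = "TQ interior_of X"
    \<comment> \<open>The translate of \<open>s2 i\<close> back from \<open>Bs i\<close>: under
      \<open>q\<close> the factor \<open>s1 (inv l)\<close> undoes the translation by
      \<open>l\<close>.\<close>
    let ?\<sigma> = "\<lambda>v. s1 (inv\<^bsub>Q\<^esub> l) \<otimes>\<^bsub>Gh\<^esub> s2 i (l \<otimes>\<^bsub>Q\<^esub> v)"
    have V: "v \<in> carrier Q" "l \<otimes>\<^bsub>Q\<^esub> v \<in> TQ closure_of Bs i" if "v \<in> ?V" for v
      using interior_of_subset[of TQ X] that unfolding Xe by auto
    have "continuous_map (subtopology TQ ?V) (subtopology TQ (TQ closure_of Bs i)) (\<lambda>v. l \<otimes>\<^bsub>Q\<^esub> v)"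
      using li(1) V by (intro continuous_map_into_subtopology
          continuous_map_from_subtopology[OF Q.continuous_map_const_mult]) auto
    from continuous_map_compose[OF this bspec[OF s2_cont li(2)]]
    have "continuous_map (subtopology TQ ?V) TGh (\<lambda>v. s2 i (l \<otimes>\<^bsub>Q\<^esub> v))" by (simp add: o_def)
    then have "continuous_map (subtopology TQ ?V) TGh ?\<sigma>"
      using li(1) by (intro Gh.continuous_map_mult) auto
    moreover have "q (?\<sigma> v) = v" if v: "v \<in> ?V" for v
    proof -
      have "s2 i (l \<otimes>\<^bsub>Q\<^esub> v) \<in> carrier Gh"
        using bspec[OF s2_cont li(2)] V[OF v] li(1) unfolding continuous_map_def by auto
      moreover have "q (s2 i (l \<otimes>\<^bsub>Q\<^esub> v)) = l \<otimes>\<^bsub>Q\<^esub> v" using s2_sec li(2) V(2)[OF v] by blast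
      ultimately show ?thesis using V(1)[OF v] li(1) by (simp add: E.s1_sec)
    qed
    ultimately have "E.local_section ?V ?\<sigma>" unfolding E.local_section_def by simp
    then show ?thesis using X(2) by blast
  qed
  then obtain V0 \<sigma>0 where V0: "E.local_section V0 \<sigma>0" "V0 \<noteq> {}" by blast
  obtain n :: nat and \<rho> U s where fam: "\<And>i. i < n \<Longrightarrow> E.equivariant_piece (\<rho> i, U i, s i)"
    "\<And>y. y \<in> carrier Q \<Longrightarrow> (\<Sum>i<n. \<rho> i y) = 1"
    using E.ex_equivariant_family[OF V0] by blast
  interpret F: equivariant_family Gh TGh Q TQ Lam ?C q s1 n \<rho> U s
    using fam by unfold_locales auto
  have ker: "F.ker = H" unfolding F.ker_def using q_ker .
  show ?thesis
  proof (intro allI impI, elim conjE)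
    fix \<phi> :: "'g \<Rightarrow> real"
    assume cont: "continuous_map (subtopology TGh H) euclideanreal \<phi>"
      and quasi: "quasimorphism (Gh\<lparr>carrier := H\<rparr>) \<phi>" and qinv: "quasi_invariant Gh H \<phi>"
    let ?D = "defect (Gh\<lparr>carrier := H\<rparr>) \<phi>" and ?D' = "conj_defect Gh H \<phi>"
    let ?I = "{D. 0 \<le> D \<and> (\<forall>g\<in>carrier Gh. \<forall>x\<in>H. \<bar>\<phi> (g \<otimes>\<^bsub>Gh\<^esub> x \<otimes>\<^bsub>Gh\<^esub> inv\<^bsub>Gh\<^esub> g) - \<phi> x\<bar> \<le> D)}"
    have ne: "?I \<noteq> {}" using qinv unfolding quasi_invariant_def by blast
    have D: "\<bar>\<phi> (a \<otimes>\<^bsub>Gh\<^esub> b) - \<phi> a - \<phi> b\<bar> \<le> ?D" if "a \<in> H" "b \<in> H" for a b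
      using quasi that unfolding defect_def quasimorphism_def by (intro cSup_upper) auto
    \<comment> \<open>The infimum in \<open>conj_defect\<close> is attained: every difference is a
      lower bound of the nonempty set \<open>?I\<close>.\<close>
    have D': "\<bar>\<phi> (g \<otimes>\<^bsub>Gh\<^esub> a \<otimes>\<^bsub>Gh\<^esub> inv\<^bsub>Gh\<^esub> g) - \<phi> a\<bar> \<le> ?D'" if "g \<in> carrier Gh" "a \<in> H" for g a
      using that unfolding conj_defect_def by (intro cInf_greatest[OF ne]) auto
    have D'0: "0 \<le> ?D'" unfolding conj_defect_def by (intro cInf_greatest[OF ne]) auto
    obtain \<phi>h where h: "continuous_map TGh euclideanreal \<phi>h" "\<And>x. x \<in> H \<Longrightarrow> \<phi>h x = \<phi> x"
      "\<And>x x'. x \<in> carrier Gh \<Longrightarrow> x' \<in> carrier Gh \<Longrightarrow> \<bar>\<phi>h (x \<otimes>\<^bsub>Gh\<^esub> x') - \<phi>h x - \<phi>h x'\<bar> \<le> ?D + ?D'"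
      using F.ex_quasimorphism_extension[of \<phi> ?D ?D'] cont D D' unfolding ker by blast
    have qm: "quasimorphism Gh \<phi>h"
      unfolding quasimorphism_def using h(3) by (intro bdd_aboveI[of _ "?D + ?D'"]) auto
    have "defect Gh \<phi>h \<le> ?D + ?D'"
      unfolding defect_def[of Gh \<phi>h] using h(3) Gh.one_closed by (intro cSup_least) auto
    \<comment> \<open>Nonnegativity of \<open>?D'\<close> passes from the coefficient 1 obtained by
      averaging to the coefficient 3.\<close>
    then have "defect Gh \<phi>h \<le> ?D + 3 * ?D'" using D'0 by linarith
    then show "\<exists>\<phi>h. continuous_map TGh euclideanreal \<phi>h \<and> quasimorphism Gh \<phi>h \<and> (\<forall>x\<in>H. \<phi>h x = \<phi> x) \<and>
        defect Gh \<phi>h \<le> ?D + 3 * ?D'"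
      using h qm by blast
  qed
qed

end
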